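(* Let $n\ge 2$ and let $\Lambda\subset\mathbb{R}^n$ be an irrational $n$-dimensional lattice of determinant $1$. Then the following conditions are equivalent: (1) $N(\Lambda)>0$. (2) The facets of all the $2^n$ sails generated by $\Lambda$ have uniformly bounded determinants; that is, there is a constant $D$ such that $\det F\le D$ for every facet $F$ of every one of the $2^n$ sails of $\Lambda$. (3) The facets and the edge stars of the vertices of the sail generated by $\Lambda$ and related to the positive orthant have uniformly bounded determinants; that is, there is a constant $D$ such that $\det F\le D$ for every facet $F$ of this sail and $\det \mathrm{St}_{\mathbf v}\le D$ for every vertex $\mathbf v$ of this sail.
   Context: The lattice $\Lambda$ is irrational if the coordinate hyperplanes $\{x_i=0\}$, $i=1,\dots,n$, contain no points of $\Lambda$ except the origin $\mathbf 0$. The norm minimum of $\Lambda$ is $N(\Lambda)=\inf_{\mathbf x\in\Lambda\setminus\{\mathbf 0\}}|\varphi(\mathbf x)|$, where $\varphi(\mathbf x)=x_1\cdots x_n$. For each of the $2^n$ orthants $\mathcal O$ of $\mathbb{R}^n$, the Klein polyhedron of $\Lambda$ related to $\mathcal O$ is the convex hull of the nonzero points of $\Lambda$ contained in $\mathcal O$. For irrational $\Lambda$ it is a generalized polyhedron: its intersection with any bounded polyhedron is a polyhedron. Its boundary is called the sail related to $\mathcal O$. Faces of a sail are the (proper) faces of the Klein polyhedron; faces of dimension $0$, $1$, $n-1$ are called vertices, edges, facets respectively. Determinant of a facet: if $F$ is a facet of a sail with vertices $\mathbf v_1,\dots,\mathbf v_m$, then $$\det F=\sum_{1\le i_1<\dots<i_n\le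 m}|\det(\mathbf v_{i_1},\dots,\mathbf v_{i_n})|$$ (if $F$ has infinitely many vertices, the corresponding sum over all $n$-element subsets of the vertices is infinite and $\det F=+\infty$). Determinant of an edge star: if a vertex $\mathbf v$ of a sail is incident to $m$ edges, and $\mathbf r_1,\dots,\mathbf r_m$ are the primitive vectors of $\Lambda$ generating these edges (i.e. $\mathbf r_i$ is the primitive lattice vector pointing from $\mathbf v$ along the $i$-th edge), then $$\det\mathrm{St}_{\mathbf v}=\sum_{1\le i_1<\dots<i_n\le m}|\det(\mathbf r_{i_1},\dots,\mathbf r_{i_n})|.$$ *)

theory Defs
  imports "HOL-Analysis.Analysis"
begin

section \<open>Lattices of full rank\<close>

definition lattice_basis :: "('n::finite \<Rightarrow> real^'n) \<Rightarrow> (real^'n) set \<Rightarrow> bool" where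
  "lattice_basis b \<Lambda> \<longleftrightarrow> inj b \<and> independent (range b) \<and>
     \<Lambda> = range (\<lambda>z::'n \<Rightarrow> int. \<Sum>i\<in>UNIV. of_int (z i) *\<^sub>R b i)"

definition full_lattice :: "(real^'n::finite) set \<Rightarrow> bool" where
  "full_lattice \<Lambda> \<longleftrightarrow> (\<exists>b. lattice_basis b \<Lambda>)"

text \<open>The choice of the basis is immaterial, see \<open>lattice_det_eq\<close> below.\<close>

definition lattice_det :: "(real^'n::finite) set \<Rightarrow> real" where
  "lattice_det \<Lambda> = \<bar>det (\<chi> i. (SOME b. lattice_basis b \<Lambda>) i)\<bar>"

lemma lattice_basis_det_multiple:
  fixes b c :: "'n::finite \<Rightarrow> real^'n"
  assumes "lattice_basis b \<Lambda>" "lattice_basis c \<Lambda>"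
  shows "\<exists>k::int. det (\<chi> i. c i) = of_int k * det (\<chi> i. b i)"
proof -
  have "c i \<in> \<Lambda>" for i
  proof -
    have "c i = (\<Sum>j\<in>UNIV. of_int ((\<lambda>j. if j = i then 1 else 0) j) *\<^sub>R c j)"
      by (simp add: if_distrib if_distribR sum.delta cong: if_cong)
    then have "c i \<in> range (\<lambda>z::'n \<Rightarrow> int. \<Sum>j\<in>UNIV. of_int (z j) *\<^sub>R c j)"
      by (rule range_eqI[where x = "\<lambda>j. if j = i then 1 else 0"])
    then show ?thesis
      using assms(2) unfolding lattice_basis_def by simp
  qed
  then have "\<exists>z::'n \<Rightarrow> int. c i = (\<Sum>j\<in>UNIV. of_int (z j) *\<^sub>R b j)" for i
    using assms(1) unfolding lattice_basis_def by blast
  then obtain z :: "'n \<Rightarrow> 'n \<Rightarrow> int"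
    where z: "\<And>i. c i = (\<Sum>j\<in>UNIV. of_int (z i j) *\<^sub>R b j)"
    by metis
  define M :: "real^'n^'n" where "M = (\<chi> i j. of_int (z i j))"
  have "(\<chi> i. c i) = M ** (\<chi> i. b i)"
    by (simp add: vec_eq_iff matrix_matrix_mult_def z M_def)
  moreover have "det M = of_int (\<Sum>p | p permutes (UNIV::'n set). sign p * (\<Prod>i\<in>UNIV. z i (p i)))"
    by (simp add: det_def M_def)
  ultimately show ?thesis
    by (metis det_mul)
qed

lemma lattice_det_eq:
  assumes "lattice_basis b \<Lambda>"
  shows "lattice_det \<Lambda> = \<bar>det (\<chi> i. b i)\<bar>"
proof -
  define c where "c = (SOME b. lattice_basis b \<Lambda>)"
  have c: "lattice_basis c \<Lambda>"
    unfolding c_def by (rule someI[of "\<lambda>b. lattice_basis b \<Lambda>", OF assms])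
  have le: "\<bar>det (\<chi> i. b' i)\<bar> \<le> \<bar>det (\<chi> i. c' i)\<bar>"
    if bc: "lattice_basis b' \<Lambda>" "lattice_basis c' \<Lambda>" for b' c'
  proof -
    obtain k l :: int where k: "det (\<chi> i. c' i) = of_int k * det (\<chi> i. b' i)"
      and l: "det (\<chi> i. b' i) = of_int l * det (\<chi> i. c' i)"
      using lattice_basis_det_multiple[OF bc]
        lattice_basis_det_multiple[OF bc(2) bc(1)] by blast
    show ?thesis
    proof (cases "k = 0")
      case True
      then show ?thesis using k l by simp
    next
      case False
      then have "1 \<le> \<bar>real_of_int k\<bar>" by linarith
      then show ?thesis
        unfolding k abs_mult using mult_right_mono[of 1 "\<bar>real_of_int k\<bar>"] by simp
    qed
  qed
  show ?thesis
    unfolding lattice_det_def c_def[symmetric]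
    using le[OF assms c] le[OF c assms] by simp
qed

definition irrational_lattice :: "(real^'n::finite) set \<Rightarrow> bool" where
  "irrational_lattice \<Lambda> \<longleftrightarrow> (\<forall>i. {x. x $ i = 0} \<inter> \<Lambda> \<subseteq> {0})"

definition norm_min :: "(real^'n::finite) set \<Rightarrow> real" where
  "norm_min \<Lambda> = (INF x\<in>\<Lambda> - {0}. \<bar>\<Prod>i\<in>UNIV. x $ i\<bar>)"

definition primitive_in :: "(real^'n::finite) set \<Rightarrow> real^'n \<Rightarrow> bool" where
  "primitive_in \<Lambda> r \<longleftrightarrow> r \<in> \<Lambda> \<and> r \<noteq> 0 \<and>
     (\<forall>s\<in>\<Lambda>. \<forall>k::int. r = of_int k *\<^sub>R s \<longrightarrow> \<bar>k\<bar> = 1)"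


section \<open>Klein polyhedra\<close>

definition orthant :: "real^'n::finite \<Rightarrow> (real^'n) set" where
  "orthant \<sigma> = {x. \<forall>i. 0 \<le> \<sigma> $ i * x $ i}"

definition orthants :: "(real^'n::finite) set set" where
  "orthants = orthant ` {\<sigma>. \<forall>i. \<sigma> $ i = 1 \<or> \<sigma> $ i = -1}"

definition positive_orthant :: "(real^'n::finite) set" where
  "positive_orthant = {x. \<forall>i. 0 \<le> x $ i}"

lemma positive_orthant_in_orthants: "positive_orthant \<in> orthants"
proof -
  have "positive_orthant = orthant (\<chi> i. 1)"
    by (simp add: positive_orthant_def orthant_def)
  then show ?thesis
    by (auto simp: orthants_def)
qed

text \<open>
  The sail is the frontier of the Klein polyhedron \<open>K\<close>, and its faces are the proper faces
  of \<open>K\<close>.  Its facets and edges are therefore given by \<open>F facet_of K\<close> and \<open>E edge_of K\<close>, and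
  its vertices by \<open>vertices K\<close>.
\<close>

definition klein_polyhedron :: "(real^'n::finite) set \<Rightarrow> (real^'n) set \<Rightarrow> (real^'n) set" where
  "klein_polyhedron \<Lambda> \<O> = convex hull (\<Lambda> \<inter> \<O> - {0})"

definition vertices :: "(real^'n::finite) set \<Rightarrow> (real^'n) set" where
  "vertices P = {v. {v} face_of P}"


section \<open>Determinants of facets and edge stars\<close>

text \<open>
  The absolute value of the determinant of the vectors in a set of \<open>CARD('n)\<close> vectors.
  It does not depend on the enumeration of the set, see \<open>abs_det_eq\<close>.
\<close>

definition abs_det :: "(real^'n::finite) set \<Rightarrow> real" where
  "abs_det S = \<bar>det (\<chi> i. (SOME f. bij_betw f (UNIV::'n set) S) i)\<bar>"

lemma abs_det_eq:
  fixes f :: "'n::finite \<Rightarrow> real^'n"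
  assumes "bij_betw f UNIV S"
  shows "abs_det S = \<bar>det (\<chi> i. f i)\<bar>"
proof -
  define g where "g = (SOME f. bij_betw f (UNIV::'n set) S)"
  have g: "bij_betw g UNIV S"
    unfolding g_def by (rule someI[of "\<lambda>f. bij_betw f UNIV S", OF assms])
  define p where "p = inv_into UNIV f \<circ> g"
  have "bij_betw p UNIV UNIV"
    unfolding p_def using g bij_betw_inv_into[OF assms] by (rule bij_betw_trans)
  then have p: "p permutes UNIV"
    by (intro bij_imp_permutes) auto
  have "f (p i) = g i" for i
    using assms g unfolding p_def bij_betw_def by (auto intro!: f_inv_into_f)
  then have "det (\<chi> i. g i) = of_int (sign p) * det (\<chi> i. f i)"
    using det_permute_rows[OF p, of "\<chi> i. f i"] by simp
  then show ?thesis
    unfolding abs_det_def g_def[symmetric] by (simp add: abs_mult sign_def)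
qed

text \<open>
  The sum of the absolute determinants over all \<open>CARD('n)\<close>-element subsets of \<open>V\<close>.  It takes
  values in \<^typ>\<open>ennreal\<close> because a facet may have infinitely many vertices.
\<close>

definition det_sum :: "(real^'n::finite) set \<Rightarrow> ennreal" where
  "det_sum V = (\<Sum>\<^sub>\<infinity>S\<in>{S. S \<subseteq> V \<and> card S = CARD('n)}. ennreal (abs_det S))"

definition facet_det :: "(real^'n::finite) set \<Rightarrow> ennreal" where
  "facet_det F = det_sum (vertices F)"

definition star_vectors :: "(real^'n::finite) set \<Rightarrow> (real^'n) set \<Rightarrow> real^'n \<Rightarrow> (real^'n) set" where
  "star_vectors \<Lambda> K v = {r. primitive_in \<Lambda> r \<and>
     (\<exists>E. E edge_of K \<and> v \<in> E \<and> (\<exists>t>0. v + t *\<^sub>R r \<in> E))}"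

definition star_det :: "(real^'n::finite) set \<Rightarrow> (real^'n) set \<Rightarrow> real^'n \<Rightarrow> ennreal" where
  "star_det \<Lambda> K v = det_sum (star_vectors \<Lambda> K v)"

end

theory Submission
  imports Defs
begin

text \<open>
  If \<open>N(\<Lambda>) > 0\<close>, every box of sufficiently large volume contains a lattice point.  When two
  lattice points \<open>x, y\<close> of a facet span a box of large volume, this yields a lattice point \<open>z\<close> such
  that \<open>z\<close> and \<open>x + y - z\<close> lie in the orthant while \<open>z\<close> is off the hyperplane of the facet, although
  the midpoint of the two is that of \<open>x\<close> and \<open>y\<close>.  Hence up to a diagonal map of bounded determinant a
  facet or an edge star consists of boundedly many bounded vectors.

  Conversely, if the determinants of the facets and edge stars at a vertex \<open>v\<close> are bounded, Cramer's
  rule and the integrality of determinants bound the edge vectors at \<open>v\<close> and the points of the facets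
  through \<open>v\<close> coordinatewise by multiples of \<open>v\<close>.  Every \<open>y \<in> \<Lambda>\<close> becomes, after reflecting
  it into the orthant, a multiple of a point of such a facet, and integrality of determinants containing
  \<open>y\<close> bounds the product of its coordinates from below.

  Finally assume \<open>N(\<Lambda>) = 0\<close>.  Then for some box the very short lattice vectors span a proper
  subspace \<open>V\<close>, while modulo \<open>V\<close> the lattice is neither dense nor sparse.  After a reflection some
  functional \<open>a \<ge> 0\<close> vanishes on \<open>V\<close> and dominates all others that do.  A lattice point \<open>x\<close> of the
  orthant that minimizes \<open>a\<close> can be moved along \<open>V\<close> deep into the orthant, so that the facet through
  it contains a long lattice segment parallel to \<open>V\<close> and has a large determinant.
\<close>

section \<open>Determinants and lattices\<close>

text \<open>Two obstacles shape the proof. Nothing bounds the faces of the Klein polyhedron a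
  priori: a facet may have infinitely many vertices, and closedness and the existence of facets have
  to be proved. Local finiteness is therefore established only at lattice points, through their
  tangent cones, and facets are always produced at a lattice point. Where a compact face would be
  convenient, the substitute is a line of mixed-sign direction, which leaves the orthant at both
  ends. The second obstacle is that a vanishing norm minimum does not by itself single out a
  suitable box. The argument is a descent on the rank: \<open>rank_drop m\<close> says that a box
  whose lattice points do not span has rank at most m once it is shrunk by a fixed factor. This is
  trivial for m = n - 1 and gives a positive norm minimum for m = 0. If the step from m + 1 to m
  fails, the failure is the flat configuration to which bounded facet determinants can be applied:
  between the scales \<open>\<epsilon> * t\<close> and \<open>c0 * t\<close> the rank does not
  change. The constants depend only on n, the bound D and the previous factor, so no compactness of
  the space of lattices is needed.\<close>

lemma det_replace_row:
  fixes g :: "'n::finite \<Rightarrow> real^'n"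
  assumes "x = (\<Sum>i\<in>UNIV. c i *\<^sub>R g i)"
  shows "det (\<chi> i. (g(k := x)) i) = c k * det (\<chi> i. g i)"
proof -
  have "(\<chi> i. (g(k := x)) i) =
    (\<chi> i. if i = k then sum (\<lambda>i. (\<chi> j. c j)$i *s row i (\<chi> i. g i)) UNIV else row i (\<chi> i. g i))"
    by (auto simp: vec_eq_iff assms row_def)
  then show ?thesis
    using cramer_lemma_transpose[of k "\<chi> j. c j" "\<chi> i. g i"] by simp
qed

text \<open>In each Leibniz term every row and every column occurs once, so the weights separate.
  With columns weighted by a box, the bound sees only the volume of the box and not its
  shape.\<close>

lemma abs_det_le:
  fixes g :: "'n::finite \<Rightarrow> real^'n"
  assumes "\<And>i j. \<bar>g i $ j\<bar> \<le> h i * v j" "\<And>i. 0 \<le> h i" "\<And>j. 0 \<le> v j"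
  shows "\<bar>det (\<chi> i. g i)\<bar> \<le> fact CARD('n) * (\<Prod>i\<in>UNIV. h i) * (\<Prod>j\<in>UNIV. v j)"
proof -
  let ?P = "{p. p permutes (UNIV::'n set)}"
  have "\<bar>det (\<chi> i. g i)\<bar> \<le> (\<Sum>p\<in>?P. \<bar>of_int (sign p) * (\<Prod>i\<in>UNIV. g i $ p i)\<bar>)"
    unfolding det_def by simp
  also have "\<dots> \<le> (\<Sum>p\<in>?P. (\<Prod>i\<in>UNIV. h i) * (\<Prod>j\<in>UNIV. v j))"
  proof (rule sum_mono)
    fix p assume p: "p \<in> ?P"
    have "\<bar>of_int (sign p) * (\<Prod>i\<in>UNIV. g i $ p i)\<bar> = (\<Prod>i\<in>UNIV. \<bar>g i $ p i\<bar>)"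
      by (simp add: abs_mult abs_prod sign_def)
    also have "\<dots> \<le> (\<Prod>i\<in>UNIV. h i * v (p i))"
      by (intro prod_mono) (use assms in auto)
    also have "\<dots> = (\<Prod>i\<in>UNIV. h i) * (\<Prod>i\<in>UNIV. v (p i))"
      by (simp add: prod.distrib)
    also have "(\<Prod>i\<in>UNIV. v (p i)) = (\<Prod>j\<in>UNIV. v j)"
      using p prod.permute[of p UNIV v] by (simp add: o_def)
    finally show "\<bar>of_int (sign p) * (\<Prod>i\<in>UNIV. g i $ p i)\<bar> \<le> (\<Prod>i\<in>UNIV. h i) * (\<Prod>j\<in>UNIV. v j)" .
  qed
  also have "\<dots> = fact CARD('n) * (\<Prod>i\<in>UNIV. h i) * (\<Prod>j\<in>UNIV. v j)"
    using card_permutations[of "UNIV::'n set" "CARD('n)"] by simp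
  finally show ?thesis .
qed

lemma det_nz_iff_independent:
  fixes g :: "'n::finite \<Rightarrow> real^'n"
  shows "det (\<chi> i. g i) \<noteq> 0 \<longleftrightarrow> inj g \<and> independent (range g)"
proof
  assume d: "det (\<chi> i. g i) \<noteq> 0"
  have rows: "rows (\<chi> i. g i) = range g" by (auto simp: rows_def row_def)
  have "inj g"
  proof (rule injI, rule ccontr)
    fix i j assume "g i = g j" "i \<noteq> j"
    then have "det (\<chi> i. g i) = 0"
      by (intro det_identical_rows[of i j]) (auto simp: row_def)
    with d show False by simp
  qed
  moreover have "independent (range g)"
  proof
    assume "dependent (range g)"
    then have "det (\<chi> i. g i) = 0"
      by (intro det_dependent_rows) (simp add: rows dependent_vec_eq)
    with d show False by simp
  qed
  ultimately show "inj g \<and> independent (range g)" by simp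
next
  assume g: "inj g \<and> independent (range g)"
  show "det (\<chi> i. g i) \<noteq> 0"
  proof
    assume "det (\<chi> i. g i) = 0"
    then have "\<not> invertible (transpose (\<chi> i. g i))"
      by (simp add: invertible_det_nz)
    then obtain x where x: "transpose (\<chi> i. g i) *v x = 0" "x \<noteq> 0"
      unfolding invertible_left_inverse matrix_left_invertible_ker by auto
    have "(\<Sum>i\<in>UNIV. x $ i *\<^sub>R g i) = 0"
      using x(1) by (simp add: vec_eq_iff matrix_vector_mult_def transpose_def mult.commute)
    then have "(\<Sum>y\<in>range g. (x $ inv g y) *\<^sub>R y) = 0"
      using g by (simp add: sum.reindex)
    then have "x $ inv g y = 0" if "y \<in> range g" for y
      using g that independentD[of "range g" "range g" "\<lambda>y. x $ inv g y" y] by auto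
    then have "x $ i = 0" for i
      using g by (metis inv_f_f rangeI)
    with x(2) show False by (simp add: vec_eq_iff)
  qed
qed

lemma enum_basis:
  fixes B :: "(real^'n::finite) set"
  assumes "independent B" "span B = UNIV"
  obtains g :: "'n \<Rightarrow> real^'n" where "bij_betw g UNIV B" "det (\<chi> i. g i) \<noteq> 0"
proof -
  have "card B = CARD('n)"
    using assms dim_eq_card_independent[of B] dim_span[of B] by (simp)
  moreover have "finite B" using assms independent_imp_finite by blast
  ultimately obtain g where g: "bij_betw g (UNIV::'n set) B"
    using finite_same_card_bij[of "UNIV::'n set" B] by auto
  with assms(1) have "det (\<chi> i. g i) \<noteq> 0"
    by (subst det_nz_iff_independent) (auto simp: bij_betw_def)
  with g that show ?thesis by blast
qed

lemma det_nz_expand: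
  fixes g :: "'n::finite \<Rightarrow> real^'n"
  assumes "det (\<chi> i. g i) \<noteq> 0"
  shows "\<exists>c. x = (\<Sum>i\<in>UNIV. c i *\<^sub>R g i)"
proof -
  have g: "inj g" "independent (range g)"
    using assms by (auto simp: det_nz_iff_independent)
  have "dim (UNIV :: (real^'n) set) \<le> card (range g)"
    using g by (simp add: card_image)
  then have "span (range g) = UNIV"
    using g card_ge_dim_independent[of "range g" UNIV] by auto
  then obtain u where "x = (\<Sum>v\<in>range g. u v *\<^sub>R v)"
    using span_finite[of "range g"] by auto
  then have "x = (\<Sum>i\<in>UNIV. u (g i) *\<^sub>R g i)"
    using g(1) by (simp add: sum.reindex)
  then show ?thesis by (rule exI[of _ "\<lambda>i. u (g i)"])
qed

locale irrational_unimodular_lattice =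
  fixes L :: "(real^'n::finite) set"
  assumes two_le_dim: "CARD('n) \<ge> 2"
    and full: "full_lattice L"
    and unimodular: "lattice_det L = 1"
    and irrational: "irrational_lattice L"
begin

lemma basis:
  obtains b where "lattice_basis b L" "\<bar>det (\<chi> i. b i)\<bar> = 1"
  using full lattice_det_eq unimodular unfolding full_lattice_def by metis

lemma int_combination_in:
  assumes "lattice_basis b L"
  shows "(\<Sum>i\<in>UNIV. of_int (z i) *\<^sub>R b i) \<in> L"
  using assms unfolding lattice_basis_def by auto

lemma zero_in [simp]: "0 \<in> L"
proof -
  obtain b where b: "lattice_basis b L" using basis by blast
  show ?thesis using int_combination_in[OF b, of "\<lambda>_. 0"] by simp
qed

lemma add_in: assumes "x \<in> L" "y \<in> L" shows "x + y \<in> L"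
proof -
  obtain b where b: "lattice_basis b L" using basis by blast
  obtain z w where "x = (\<Sum>i\<in>UNIV. of_int (z i) *\<^sub>R b i)" "y = (\<Sum>i\<in>UNIV. of_int (w i) *\<^sub>R b i)"
    using assms b unfolding lattice_basis_def by auto
  then have "x + y = (\<Sum>i\<in>UNIV. of_int (z i + w i) *\<^sub>R b i)"
    by (simp add: scaleR_left_distrib sum.distrib)
  then show ?thesis using int_combination_in[OF b, of "\<lambda>i. z i + w i"] by simp
qed

lemma of_int_scaleR_in: assumes "x \<in> L" shows "of_int k *\<^sub>R x \<in> L"
proof -
  obtain b where b: "lattice_basis b L" using basis by blast
  obtain z where "x = (\<Sum>i\<in>UNIV. of_int (z i) *\<^sub>R b i)"
    using assms b unfolding lattice_basis_def by auto
  then have "of_int k *\<^sub>R x = (\<Sum>i\<in>UNIV. of_int (k * z i) *\<^sub>R b i)"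
    by (simp add: scaleR_right.sum)
  then show ?thesis using int_combination_in[OF b, of "\<lambda>i. k * z i"] by simp
qed

lemma of_nat_scaleR_in: "x \<in> L \<Longrightarrow> of_nat k *\<^sub>R x \<in> L"
  using of_int_scaleR_in[of x "int k"] by simp

lemma uminus_in: "x \<in> L \<Longrightarrow> - x \<in> L"
  using of_int_scaleR_in[of x "-1"] by simp

lemma diff_in: "x \<in> L \<Longrightarrow> y \<in> L \<Longrightarrow> x - y \<in> L"
  using add_in[of x "-y"] uminus_in by simp

lemma sum_in: "(\<And>i. i \<in> I \<Longrightarrow> f i \<in> L) \<Longrightarrow> sum f I \<in> L"
  by (induction I rule: infinite_finite_induct) (auto intro: add_in)

lemma coord_nonzero: "x \<in> L \<Longrightarrow> x \<noteq> 0 \<Longrightarrow> x $ i \<noteq> 0"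
  using irrational unfolding irrational_lattice_def by auto

text \<open>The rows are integer combinations of a basis of determinant 1 or -1, so up to sign this
  is the determinant of an integer matrix.\<close>

lemma det_integer:
  assumes "\<And>i. g i \<in> L"
  shows "det (\<chi> i. g i) \<in> \<int>"
proof -
  obtain b where b: "lattice_basis b L" "\<bar>det (\<chi> i. b i)\<bar> = 1" using basis by blast
  have "\<forall>i. \<exists>z::'n \<Rightarrow> int. g i = (\<Sum>j\<in>UNIV. of_int (z j) *\<^sub>R b j)"
    using assms b(1) unfolding lattice_basis_def by blast
  then obtain z where z: "\<And>i. g i = (\<Sum>j\<in>UNIV. of_int (z i j :: int) *\<^sub>R b j)" by metis
  define M :: "real^'n^'n" where "M = (\<chi> i j. of_int (z i j))"
  have "(\<chi> i. g i) = M ** (\<chi> i. b i)"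
    by (simp add: vec_eq_iff matrix_matrix_mult_def z M_def)
  moreover have "det M = of_int (\<Sum>p | p permutes (UNIV::'n set). sign p * (\<Prod>i\<in>UNIV. z i (p i)))"
    by (simp add: det_def M_def)
  moreover have "det (\<chi> i. b i) = 1 \<or> det (\<chi> i. b i) = -1" using b(2) by linarith
  ultimately show ?thesis by (auto simp: det_mul intro!: Ints_sum Ints_mult Ints_prod)
qed

lemma abs_det_ge_1:
  assumes "\<And>i. g i \<in> L" "det (\<chi> i. g i) \<noteq> 0"
  shows "1 \<le> \<bar>det (\<chi> i. g i)\<bar>"
proof -
  obtain k where k: "det (\<chi> i. g i) = of_int k"
    using det_integer[of g, OF assms(1)] by (auto elim: Ints_cases)
  then have "k \<noteq> 0" using assms(2) by auto
  then show ?thesis unfolding k by linarith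
qed

text \<open>The inverse of the basis matrix recovers the integer coordinates of x, so a bound on x
  bounds these as well.\<close>

lemma finite_bounded: "finite {x \<in> L. \<forall>i. \<bar>x $ i\<bar> \<le> r}"
proof -
  obtain b where b: "lattice_basis b L" "\<bar>det (\<chi> i. b i)\<bar> = 1" using basis by blast
  define B where "B = transpose (\<chi> i. b i)"
  have "invertible B" using b(2) by (auto simp: B_def invertible_det_nz)
  then obtain C where C: "C ** B = mat 1" by (auto simp: invertible_def)
  define R where "R = (\<Sum>i\<in>UNIV. \<Sum>j\<in>UNIV. \<bar>C $ i $ j\<bar>) * \<bar>r\<bar>"
  have "{x \<in> L. \<forall>i. \<bar>x $ i\<bar> \<le> r} \<subseteq>
    (\<lambda>z. \<Sum>j\<in>UNIV. of_int (z j) *\<^sub>R b j) ` (PiE UNIV (\<lambda>_. {-\<lceil>R\<rceil>..\<lceil>R\<rceil>}))"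
  proof safe
    fix x assume x: "x \<in> L" "\<forall>i. \<bar>x $ i\<bar> \<le> r"
    obtain z where z: "x = (\<Sum>j\<in>UNIV. of_int (z j :: int) *\<^sub>R b j)"
      using x b unfolding lattice_basis_def by auto
    have "x = B *v (\<chi> j. of_int (z j))"
      by (simp add: z vec_eq_iff B_def matrix_vector_mult_def transpose_def mult.commute)
    then have Cx: "C *v x = (\<chi> j. of_int (z j))"
      by (simp add: matrix_vector_mul_assoc C)
    have "\<bar>real_of_int (z j)\<bar> \<le> R" for j
    proof -
      have "real_of_int (z j) = (\<Sum>k\<in>UNIV. C $ j $ k * x $ k)"
        using Cx by (simp add: vec_eq_iff matrix_vector_mult_def)
      then have "\<bar>real_of_int (z j)\<bar> \<le> (\<Sum>k\<in>UNIV. \<bar>C $ j $ k\<bar> * \<bar>x $ k\<bar>)"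
        by (metis (no_types, lifting) abs_mult sum.cong sum_abs)
      also have "\<dots> \<le> (\<Sum>k\<in>UNIV. \<bar>C $ j $ k\<bar> * \<bar>r\<bar>)"
        using x(2) by (intro sum_mono mult_left_mono) (auto intro: order_trans)
      also have "\<dots> \<le> R"
        unfolding R_def sum_distrib_right[symmetric]
        by (intro mult_right_mono member_le_sum[of j UNIV "\<lambda>i. \<Sum>j\<in>UNIV. \<bar>C $ i $ j\<bar>"]) (auto intro: sum_nonneg)
      finally show ?thesis .
    qed
    then have "z j \<in> {-\<lceil>R\<rceil>..\<lceil>R\<rceil>}" for j
      by (smt (verit, best) atLeastAtMost_iff le_of_int_ceiling of_int_le_iff of_int_minus)
    then have "z \<in> PiE UNIV (\<lambda>_. {-\<lceil>R\<rceil>..\<lceil>R\<rceil>})" by auto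
    then show "x \<in> (\<lambda>z. \<Sum>j\<in>UNIV. of_int (z j) *\<^sub>R b j) ` (PiE UNIV (\<lambda>_. {-\<lceil>R\<rceil>..\<lceil>R\<rceil>}))"
      using z by blast
  qed
  then show ?thesis
    by (rule finite_subset) (intro finite_imageI finite_PiE, auto)
qed

text \<open>Counting lattice points in a large cube against cells of the given shape.\<close>

lemma minkowski_box:
  obtains M where "0 < M"
    "\<And>l. (\<And>i. 0 < l i) \<Longrightarrow> M < (\<Prod>i\<in>UNIV. l i) \<Longrightarrow> \<exists>x\<in>L. x \<noteq> 0 \<and> (\<forall>i. \<bar>x $ i\<bar> < l i)"
proof -
  obtain b where b: "lattice_basis b L" "\<bar>det (\<chi> i. b i)\<bar> = 1" using basis by blast
  then have inj_b: "inj b" "independent (range b)" by (auto simp: lattice_basis_def)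
  define C where "C = (\<Sum>j\<in>UNIV. \<Sum>i\<in>UNIV. \<bar>b j $ i\<bar>) + 1"
  have C: "1 \<le> C" unfolding C_def by (simp add: sum_nonneg)
  have "\<exists>x\<in>L. x \<noteq> 0 \<and> (\<forall>i. \<bar>x $ i\<bar> < l i)"
    if l: "\<And>i. 0 < l i" and vol: "(5 * C) ^ CARD('n) < (\<Prod>i\<in>UNIV. l i)" for l :: "'n \<Rightarrow> real"
  proof -
    \<comment> \<open>With N at least every \<open>l i\<close>, the number
      \<open>y = C * N / l i\<close> is at least 1, so the \<open>2 * \<lceil>y\<rceil> + 1\<close>
      cells needed in one direction are at most \<open>5 * y\<close>. This is the origin of the
      factor 5.\<close>
    define N where "N = nat \<lceil>\<Sum>i\<in>UNIV. l i\<rceil> + 1"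
    have lN: "l i \<le> C * real N" for i
    proof -
      have "l i \<le> (\<Sum>i\<in>UNIV. l i)" using l by (intro member_le_sum) (auto simp: less_imp_le)
      also have "\<dots> \<le> real N" unfolding N_def by linarith
      also have "\<dots> \<le> C * real N" using C mult_right_mono[of 1 C "real N"] by simp
      finally show ?thesis .
    qed
    define p where "p z = (\<Sum>j\<in>UNIV. of_int (z j) *\<^sub>R b j)" for z :: "'n \<Rightarrow> int"
    define Z where "Z = PiE (UNIV::'n set) (\<lambda>_. {0..int N})"
    define q where "q z i = \<lfloor>p z $ i / l i\<rfloor>" for z i
    define W where "W = PiE (UNIV::'n set) (\<lambda>i. {-\<lceil>C * N / l i\<rceil>..\<lceil>C * N / l i\<rceil>})"
    have pb: "\<bar>p z $ i\<bar> \<le> C * N" if "z \<in> Z" for z i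
    proof -
      have "\<bar>p z $ i\<bar> \<le> (\<Sum>j\<in>UNIV. \<bar>of_int (z j)\<bar> * \<bar>b j $ i\<bar>)"
        unfolding p_def by (simp add: sum_abs flip: abs_mult)
      also have "\<dots> \<le> (\<Sum>j\<in>UNIV. real N * \<bar>b j $ i\<bar>)"
        using that by (intro sum_mono mult_right_mono) (auto simp: Z_def PiE_iff, metis of_int_le_iff of_int_of_nat_eq)
      also have "\<dots> = real N * (\<Sum>j\<in>UNIV. \<bar>b j $ i\<bar>)" by (simp add: sum_distrib_left)
      also have "\<dots> \<le> real N * (\<Sum>j\<in>UNIV. \<Sum>i\<in>UNIV. \<bar>b j $ i\<bar>)"
        by (intro mult_left_mono sum_mono member_le_sum) auto
      also have "\<dots> \<le> C * N" unfolding C_def by (simp add: algebra_simps)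
      finally show ?thesis .
    qed
    have "q ` Z \<subseteq> W"
    proof (rule image_subsetI)
      fix z assume z: "z \<in> Z"
      have "- (C * N / l i) \<le> p z $ i / l i \<and> p z $ i / l i \<le> C * N / l i" for i
        using pb[OF z, of i] l[of i] by (auto simp: field_simps abs_le_iff)
      then have "q z i \<in> {-\<lceil>C * N / l i\<rceil>..\<lceil>C * N / l i\<rceil>}" for i
        unfolding q_def by (smt (verit, ccfv_SIG) atLeastAtMost_iff ceiling_def ceiling_mono floor_le_ceiling floor_mono)
      then show "q z \<in> W" unfolding W_def by auto
    qed
    have "card W < card Z"
    proof -
      have "real (card W) = (\<Prod>i\<in>UNIV. real (card {-\<lceil>C * N / l i\<rceil>..\<lceil>C * N / l i\<rceil>}))"
        unfolding W_def by (simp add: card_PiE)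
      also have "\<dots> \<le> (\<Prod>i\<in>UNIV. 5 * C * N / l i)"
      proof (rule prod_mono, safe)
        fix i
        have 1: "1 \<le> C * N / l i" using lN[of i] l[of i] by (simp add: field_simps)
        have 2: "real (card {-\<lceil>C * N / l i\<rceil>..\<lceil>C * N / l i\<rceil>}) = 2 * of_int \<lceil>C * N / l i\<rceil> + 1"
          using 1 by (simp add: nat_eq_iff)
        have 3: "2 * of_int \<lceil>C * N / l i\<rceil> + 1 \<le> 2 * (C * N / l i) + 3" by linarith
        show "real (card {-\<lceil>C * N / l i\<rceil>..\<lceil>C * N / l i\<rceil>}) \<le> 5 * C * N / l i"
          using 1 2 3 by (simp add: mult.assoc)
      qed simp
      also have "\<dots> = (5 * C) ^ CARD('n) * real N ^ CARD('n) / (\<Prod>i\<in>UNIV. l i)"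
        by (simp add: prod_dividef power_mult_distrib)
      also have "\<dots> < real N ^ CARD('n)"
      proof -
        have "0 < (\<Prod>i\<in>UNIV. l i)" using l by (simp add: prod_pos)
        moreover have "0 < real N ^ CARD('n)" by (simp add: N_def)
        ultimately show ?thesis using vol by (simp add: field_simps)
      qed
      also have "\<dots> \<le> real (card Z)"
        unfolding Z_def by (simp add: card_PiE power_mono)
      finally show ?thesis by simp
    qed
    have "\<not> inj_on q Z"
    proof -
      have "finite W" unfolding W_def by (intro finite_PiE) auto
      with \<open>q ` Z \<subseteq> W\<close> \<open>card W < card Z\<close> show ?thesis
        using card_inj_on_le[of q Z W] by linarith
    qed
    then obtain z w where zw: "z \<in> Z" "w \<in> Z" "z \<noteq> w" "q z = q w"
      by (auto simp: inj_on_def)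
    have "p z - p w \<in> L"
      unfolding p_def by (intro diff_in int_combination_in b(1))
    moreover have "p z - p w \<noteq> 0"
    proof
      assume "p z - p w = 0"
      then have "(\<Sum>j\<in>UNIV. of_int (z j - w j) *\<^sub>R b j) = 0"
        by (simp add: p_def scaleR_left_diff_distrib sum_subtractf)
      then have "(\<Sum>y\<in>range b. (of_int (z (inv b y) - w (inv b y))) *\<^sub>R y) = 0"
        using inj_b(1) by (simp add: sum.reindex)
      then have "real_of_int (z (inv b (b j)) - w (inv b (b j))) = 0" for j
        using inj_b(2) independentD[of "range b" "range b" "\<lambda>y. of_int (z (inv b y) - w (inv b y))" "b j"] by auto
      then have "z j = w j" for j using inj_b(1) by simp
      then show False using zw(3) by auto
    qed
    moreover have "\<bar>(p z - p w) $ i\<bar> < l i" for i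
    proof -
      have "\<lfloor>p z $ i / l i\<rfloor> = \<lfloor>p w $ i / l i\<rfloor>"
        using zw(4) unfolding q_def by meson
      then have "\<bar>p z $ i / l i - p w $ i / l i\<bar> < 1" by linarith
      then have "\<bar>(p z $ i - p w $ i) / l i\<bar> < 1" by (simp add: diff_divide_distrib)
      then show ?thesis using l[of i] by (simp add: abs_divide)
    qed
    ultimately show ?thesis by blast
  qed
  moreover have "0 < (5 * C) ^ CARD('n)" using C by simp
  ultimately show ?thesis using that by blast
qed

end

section \<open>The Klein polyhedron\<close>

text \<open>Collecting all other summands into one normalised point y puts the combination strictly
  between y and \<open>x i\<close>, where the defining property of a face applies. Weight 1 and y =
  \<open>x i\<close> are the degenerate cases.\<close>

lemma face_of_convex_sum:
  assumes F: "F face_of S" and S: "convex S" and I: "finite I"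
    and x: "\<And>i. i \<in> I \<Longrightarrow> x i \<in> S" and \<mu>: "\<And>i. i \<in> I \<Longrightarrow> 0 \<le> \<mu> i" "sum \<mu> I = 1"
    and z: "(\<Sum>i\<in>I. \<mu> i *\<^sub>R x i) \<in> F" and i: "i \<in> I" "0 < \<mu> i"
  shows "x i \<in> F"
proof (cases "\<mu> i = 1")
  case True
  have "sum \<mu> (I - {i}) = 0" using \<mu>(2) i I True by (simp add: sum_diff1)
  then have "\<mu> j = 0" if "j \<in> I - {i}" for j
    using that \<mu>(1) I sum_nonneg_eq_0_iff[of "I - {i}" \<mu>] by auto
  then have "(\<Sum>j\<in>I - {i}. \<mu> j *\<^sub>R x j) = 0" by (intro sum.neutral) auto
  then have "(\<Sum>i\<in>I. \<mu> i *\<^sub>R x i) = x i"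
    using True sum.remove[OF I i(1), of "\<lambda>i. \<mu> i *\<^sub>R x i"] by simp
  then show ?thesis using z by simp
next
  case False
  have le: "\<mu> i \<le> 1" using \<mu> i I member_le_sum[of i I \<mu>] by auto
  with False have lt: "\<mu> i < 1" by simp
  define y where "y = (\<Sum>j\<in>I - {i}. (\<mu> j / (1 - \<mu> i)) *\<^sub>R x j)"
  have "y \<in> S"
    unfolding y_def
  proof (rule convex_sum[OF _ S])
    show "(\<Sum>j\<in>I - {i}. \<mu> j / (1 - \<mu> i)) = 1"
      using \<mu>(2) I i lt by (simp add: sum_diff1 flip: sum_divide_distrib)
  qed (use I x \<mu>(1) lt in auto)
  have "(1 - \<mu> i) *\<^sub>R y = (\<Sum>j\<in>I - {i}. \<mu> j *\<^sub>R x j)"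
    unfolding y_def scaleR_right.sum using lt by simp
  then have zz: "(\<Sum>i\<in>I. \<mu> i *\<^sub>R x i) = (1 - \<mu> i) *\<^sub>R y + \<mu> i *\<^sub>R x i"
    using sum.remove[OF I i(1), of "\<lambda>i. \<mu> i *\<^sub>R x i"] by (simp add: add.commute)
  show ?thesis
  proof (cases "y = x i")
    case True
    then show ?thesis using z zz by (simp flip: scaleR_left_distrib)
  next
    case False
    then have "(\<Sum>i\<in>I. \<mu> i *\<^sub>R x i) \<in> open_segment y (x i)"
      unfolding zz in_segment using i lt by auto
    then show ?thesis using F \<open>y \<in> S\<close> x i z unfolding face_of_def by blast
  qed
qed

text \<open>In a finite convex combination representing a point of F, all points of positive weight
  lie in F. The set A may be infinite and unbounded, as it is for K.\<close>

lemma face_of_convex_hull_eq: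
  assumes "F face_of convex hull A"
  shows "F = convex hull (A \<inter> F)"
proof
  show "convex hull (A \<inter> F) \<subseteq> F"
    using face_of_imp_convex[OF assms] by (simp add: hull_minimal)
  show "F \<subseteq> convex hull (A \<inter> F)"
  proof
    fix z assume z: "z \<in> F"
    then have "z \<in> convex hull A" using face_of_imp_subset[OF assms] by auto
    then obtain S u where S: "finite S" "S \<subseteq> A" "\<forall>x\<in>S. 0 \<le> u x" "sum u S = 1" "(\<Sum>v\<in>S. u v *\<^sub>R v) = z"
      unfolding convex_hull_explicit by blast
    define T where "T = {x\<in>S. 0 < u x}"
    have "x \<in> F" if "x \<in> T" for x
      using face_of_convex_sum[OF assms convex_convex_hull S(1), of "\<lambda>x. x" u x] S that z
      by (auto simp: T_def intro: hull_inc)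
    then have "T \<subseteq> A \<inter> F" using S by (auto simp: T_def)
    moreover have "sum u T = 1"
    proof -
      have "sum u S = sum u T"
        by (rule sum.mono_neutral_right[OF S(1)]) (use S(3) in \<open>auto simp: T_def less_le\<close>)
      then show ?thesis using S(4) by simp
    qed
    moreover have "(\<Sum>v\<in>T. u v *\<^sub>R v) = z"
    proof -
      have "(\<Sum>v\<in>S. u v *\<^sub>R v) = (\<Sum>v\<in>T. u v *\<^sub>R v)"
        by (rule sum.mono_neutral_right[OF S(1)]) (use S(3) in \<open>auto simp: T_def less_le\<close>)
      then show ?thesis using S(5) by simp
    qed
    ultimately show "z \<in> convex hull (A \<inter> F)"
      unfolding convex_hull_explicit using S(1) by (intro CollectI exI[of _ T] exI[of _ u]) (auto simp: T_def)
  qed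
qed

lemma convex_hull_inner_le:
  assumes "z \<in> convex hull S" "\<And>x. x \<in> S \<Longrightarrow> c \<le> b \<bullet> x"
  shows "c \<le> b \<bullet> z"
proof -
  have "convex hull S \<subseteq> {x. c \<le> b \<bullet> x}"
    using assms(2) by (intro hull_minimal convex_halfspace_ge) auto
  with assms(1) show ?thesis by auto
qed

context irrational_unimodular_lattice
begin

definition positive_points :: "(real^'n) set" where
  "positive_points = L \<inter> positive_orthant - {0}"

definition K :: "(real^'n) set" where
  "K = klein_polyhedron L positive_orthant"

lemma K_eq: "K = convex hull positive_points"
  by (simp add: K_def klein_polyhedron_def positive_points_def)

text \<open>Irrationality makes the weak inequalities of the orthant strict on nonzero lattice
  points; this is the room used by all midpoint arguments.\<close>

lemma positive_points_iff: "x \<in> positive_points \<longleftrightarrow> x \<in> L \<and> (\<forall>i. 0 < x $ i)"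
proof
  assume x: "x \<in> positive_points"
  then have "x $ i \<noteq> 0" for i
    using coord_nonzero unfolding positive_points_def by auto
  with x show "x \<in> L \<and> (\<forall>i. 0 < x $ i)"
    unfolding positive_points_def positive_orthant_def by (auto simp: order_less_le)
next
  assume "x \<in> L \<and> (\<forall>i. 0 < x $ i)"
  then show "x \<in> positive_points"
    unfolding positive_points_def positive_orthant_def by (auto simp: less_imp_le)
qed

lemma positive_points_subset_K: "positive_points \<subseteq> K"
  unfolding K_eq by (rule hull_subset)

lemma in_K: "x \<in> L \<Longrightarrow> (\<And>i. 0 < x $ i) \<Longrightarrow> x \<in> K"
  using positive_points_subset_K positive_points_iff by blast

lemma convex_K: "convex K"
  unfolding K_eq by (rule convex_convex_hull)

lemma K_pos: assumes "z \<in> K" shows "0 < z $ i"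
proof -
  have "convex hull positive_points \<subseteq> {z. 0 < axis i 1 \<bullet> z}"
    by (intro hull_minimal convex_halfspace_gt) (auto simp: positive_points_iff inner_axis')
  then show ?thesis using assms unfolding K_eq by (auto simp: inner_axis')
qed

lemma positive_points_eq_K: "positive_points = L \<inter> K"
  using positive_points_subset_K K_pos positive_points_iff by blast

lemma positive_points_scale: "x \<in> positive_points \<Longrightarrow> 0 < k \<Longrightarrow> of_nat k *\<^sub>R x \<in> positive_points"
  by (auto simp: positive_points_iff of_nat_scaleR_in)

section \<open>Lattice points in boxes\<close>

definition lattice_box :: "('n \<Rightarrow> real) \<Rightarrow> (real^'n) set" where
  "lattice_box t = {y \<in> L. \<forall>i. \<bar>y $ i\<bar> \<le> t i}"

text \<open>Rounding down the coefficients with respect to a basis chosen among the box vectors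
  costs at most \<open>t i\<close> for each of the at most n basis vectors.\<close>

lemma lattice_near_span:
  assumes "p \<in> span (lattice_box t)" "\<And>i. 0 \<le> t i"
  obtains x where "x \<in> L" "x \<in> span (lattice_box t)" "\<And>i. \<bar>x $ i - p $ i\<bar> \<le> real CARD('n) * t i"
proof -
  obtain B where B: "B \<subseteq> lattice_box t" "independent B" "lattice_box t \<subseteq> span B"
    using maximal_independent_subset by blast
  have fB: "finite B" using B(2) independent_imp_finite by blast
  have cB: "card B \<le> CARD('n)" using independent_bound[OF B(2)] by simp
  have "p \<in> span B" using assms(1) span_minimal[OF B(3) subspace_span] by blast
  then obtain c where c: "p = (\<Sum>v\<in>B. c v *\<^sub>R v)"
    using span_finite[OF fB] by auto
  define x where "x = (\<Sum>v\<in>B. of_int \<lfloor>c v\<rfloor> *\<^sub>R v)"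
  have "x \<in> L" unfolding x_def
    using B(1) by (intro sum_in of_int_scaleR_in) (auto simp: lattice_box_def)
  moreover have "x \<in> span (lattice_box t)" unfolding x_def
    using B(1) by (intro span_sum span_scale span_base) auto
  moreover have "\<bar>x $ i - p $ i\<bar> \<le> real CARD('n) * t i" for i
  proof -
    have "x $ i - p $ i = (\<Sum>v\<in>B. (of_int \<lfloor>c v\<rfloor> - c v) * v $ i)"
      by (simp add: x_def c sum_subtractf left_diff_distrib)
    also have "\<bar>\<dots>\<bar> \<le> (\<Sum>v\<in>B. \<bar>of_int \<lfloor>c v\<rfloor> - c v\<bar> * \<bar>v $ i\<bar>)"
      by (metis (no_types, lifting) abs_mult sum.cong sum_abs)
    also have "\<dots> \<le> (\<Sum>v\<in>B. 1 * t i)"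
    proof (rule sum_mono, rule mult_mono)
      fix v assume "v \<in> B"
      show "\<bar>of_int \<lfloor>c v\<rfloor> - c v\<bar> \<le> 1" by linarith
      show "\<bar>v $ i\<bar> \<le> t i" using \<open>v \<in> B\<close> B(1) by (auto simp: lattice_box_def)
    qed auto
    also have "\<dots> = real (card B) * t i" by simp
    also have "\<dots> \<le> real CARD('n) * t i"
      using cB assms(2) by (intro mult_right_mono) auto
    finally show ?thesis .
  qed
  ultimately show ?thesis using that by blast
qed

lemma lattice_box_mono: "(\<And>i. s i \<le> t i) \<Longrightarrow> lattice_box s \<subseteq> lattice_box t"
  unfolding lattice_box_def by (auto intro: order_trans)

lemma lattice_box_subset: "lattice_box t \<subseteq> L"
  by (auto simp: lattice_box_def)

lemma span_lattice_box_UNIV: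
  obtains r where "0 < r" "\<And>t. (\<And>i. r \<le> t i) \<Longrightarrow> span (lattice_box t) = UNIV"
proof -
  obtain b where b: "lattice_basis b L" "\<bar>det (\<chi> i. b i)\<bar> = 1" using basis by blast
  define r where "r = (\<Sum>j\<in>UNIV. \<Sum>i\<in>UNIV. \<bar>b j $ i\<bar>) + 1"
  have "0 < r" unfolding r_def by (simp add: sum_nonneg add_nonneg_pos)
  moreover have "span (lattice_box t) = UNIV" if t: "\<And>i. r \<le> t i" for t
  proof -
    have "b j \<in> lattice_box t" for j
    proof -
      have "b j \<in> L" using int_combination_in[OF b(1), of "\<lambda>i. if i = j then 1 else 0"]
        by (simp add: if_distrib if_distribR sum.delta cong: if_cong)
      moreover have "\<bar>b j $ i\<bar> \<le> t i" for i
      proof -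
        have "\<bar>b j $ i\<bar> \<le> (\<Sum>i\<in>UNIV. \<bar>b j $ i\<bar>)" by (rule member_le_sum) auto
        also have "\<dots> \<le> (\<Sum>j\<in>UNIV. \<Sum>i\<in>UNIV. \<bar>b j $ i\<bar>)"
          by (rule member_le_sum[of j UNIV "\<lambda>j. \<Sum>i\<in>UNIV. \<bar>b j $ i\<bar>"]) (auto intro: sum_nonneg)
        also have "\<dots> \<le> t i" using t[of i] unfolding r_def by simp
        finally show ?thesis .
      qed
      ultimately show ?thesis by (simp add: lattice_box_def)
    qed
    moreover have "x \<in> span (range b)" for x
    proof -
      obtain c where "x = (\<Sum>i\<in>UNIV. c i *\<^sub>R b i)" using det_nz_expand[of b x] b(2) by force
      moreover have "(\<Sum>i\<in>UNIV. c i *\<^sub>R b i) \<in> span (range b)"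
        by (intro span_sum span_scale span_base) auto
      ultimately show ?thesis by simp
    qed
    ultimately show ?thesis using span_mono[of "range b" "lattice_box t"] by blast
  qed
  ultimately show ?thesis using that by blast
qed

lemma lattice_cover:
  obtains C where "0 < C" "\<And>p. \<exists>x\<in>L. \<forall>i. \<bar>x $ i - p $ i\<bar> \<le> C"
proof -
  obtain r where r: "0 < r" "\<And>t. (\<And>i. r \<le> t i) \<Longrightarrow> span (lattice_box t) = UNIV"
    using span_lattice_box_UNIV by blast
  have "\<exists>x\<in>L. \<forall>i. \<bar>x $ i - p $ i\<bar> \<le> real CARD('n) * r" for p
  proof -
    have "p \<in> span (lattice_box (\<lambda>_. r))" using r(2)[of "\<lambda>_. r"] by simp
    then show ?thesis by (rule lattice_near_span) (use r(1) in auto)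
  qed
  then show ?thesis using that[of "real CARD('n) * r"] r(1) by simp
qed

lemma span_L: "span L = UNIV"
proof -
  obtain r where "0 < r" "\<And>t. (\<And>i. r \<le> t i) \<Longrightarrow> span (lattice_box t) = UNIV"
    using span_lattice_box_UNIV by blast
  then have "span (lattice_box (\<lambda>_. r)) = UNIV" by simp
  then show ?thesis using span_mono[OF lattice_box_subset] by blast
qed

text \<open>The integer multiples of \<open>R w\<close> reduced modulo the lattice have a cluster point.\<close>

lemma dirichlet_direction:
  assumes "0 < \<delta>" "1 \<le> R"
  obtains k s where "R \<le> k" "s \<in> L" "norm (s - k *\<^sub>R w) < \<delta>"
proof -
  obtain C where C: "0 < C" "\<And>p. \<exists>x\<in>L. \<forall>i. \<bar>x $ i - p $ i\<bar> \<le> C"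
    using lattice_cover by blast
  have "\<exists>x\<in>L. \<forall>i. \<bar>x $ i - ((real m * R) *\<^sub>R w) $ i\<bar> \<le> C" for m :: nat using C(2) by blast
  then obtain q where q: "\<And>m. q m \<in> L" "\<And>m i. \<bar>q m $ i - ((real m * R) *\<^sub>R w) $ i\<bar> \<le> C"
    by metis
  define u where "u m = q m - (real m * R) *\<^sub>R w" for m
  have "norm (u m) \<le> (\<Sum>i\<in>UNIV. \<bar>u m $ i\<bar>)" for m by (rule norm_le_l1_cart)
  also have "(\<Sum>i\<in>UNIV. \<bar>u m $ i\<bar>) \<le> (\<Sum>i\<in>(UNIV::'n set). C)" for m
    using q(2)[of m] by (intro sum_mono) (simp add: u_def)
  finally have "bounded (range u)" unfolding bounded_iff by auto
  then obtain l r where lr: "strict_mono r" "(u \<circ> r) \<longlonglongrightarrow> l"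
    using bounded_imp_convergent_subsequence by blast
  then have "Cauchy (u \<circ> r)" by (metis LIMSEQ_imp_Cauchy)
  then obtain N where N: "\<And>m n. m \<ge> N \<Longrightarrow> n \<ge> N \<Longrightarrow> norm ((u \<circ> r) m - (u \<circ> r) n) < \<delta>"
    using assms(1) unfolding Cauchy_iff by metis
  \<comment> \<open>Two late terms of the subsequence nearly agree. Their indices differ by at least
    1, so the difference of the two multiples of w is at least R.\<close>
  define m1 m2 where "m1 = r N" and "m2 = r (Suc N)"
  have m: "m1 < m2" using lr(1) unfolding m1_def m2_def strict_mono_def by simp
  have "norm (u m2 - u m1) < \<delta>" using N[of "Suc N" N] by (simp add: m1_def m2_def)
  moreover have "u m2 - u m1 = (q m2 - q m1) - ((real m2 - real m1) * R) *\<^sub>R w"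
    by (simp add: u_def algebra_simps)
  moreover have "R \<le> (real m2 - real m1) * R"
  proof -
    have "1 \<le> real m2 - real m1" using m by linarith
    then show ?thesis using assms(2) mult_right_mono[of 1 "real m2 - real m1" R] by simp
  qed
  ultimately show ?thesis
    by (intro that[of "(real m2 - real m1) * R" "q m2 - q m1"] diff_in q(1)) auto
qed

end

section \<open>Tangent cones are finitely generated\<close>

lemma independent_coordinates_bounded:
  fixes B :: "'a::euclidean_space set"
  assumes "independent B"
  obtains \<kappa> where "0 < \<kappa>" "\<And>c. (\<Sum>b\<in>B. \<bar>c b\<bar>) \<le> \<kappa> * norm (\<Sum>b\<in>B. c b *\<^sub>R b)"
proof -
  have fB: "finite B" using assms independent_imp_finite by blast
  have "\<exists>\<kappa>>0. \<forall>c. \<bar>c b\<bar> \<le> \<kappa> * norm (\<Sum>v\<in>B. c v *\<^sub>R v)" if b: "b \<in> B" for b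
  proof -
    obtain g :: "'a \<Rightarrow> real" where g: "linear g" "\<forall>v\<in>B. g v = (if v = b then 1 else 0)"
      using linear_independent_extend[OF assms, of "\<lambda>v. if v = b then 1 else 0"] by blast
    obtain \<kappa> where \<kappa>: "\<kappa> > 0" "\<And>x. norm (g x) \<le> \<kappa> * norm x"
      using linear_bounded_pos[OF g(1)] by blast
    have "g (\<Sum>v\<in>B. c v *\<^sub>R v) = c b" for c
    proof -
      have "g (\<Sum>v\<in>B. c v *\<^sub>R v) = (\<Sum>v\<in>B. c v *\<^sub>R g v)"
        using g(1) by (simp add: linear_sum linear_scale)
      also have "\<dots> = (\<Sum>v\<in>B. if v = b then c v else 0)"
        using g(2) by (intro sum.cong) auto
      also have "\<dots> = c b" using fB b by simp
      finally show ?thesis .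
    qed
    then show ?thesis using \<kappa> by (metis real_norm_def)
  qed
  then obtain f where f: "\<And>b. b \<in> B \<Longrightarrow> 0 < f b" "\<And>b c. b \<in> B \<Longrightarrow> \<bar>c b\<bar> \<le> f b * norm (\<Sum>v\<in>B. c v *\<^sub>R v)"
    by metis
  show ?thesis
  proof
    show "0 < sum f B + 1" using f(1) by (simp add: sum_nonneg add_nonneg_pos less_imp_le)
    fix c
    have "(\<Sum>b\<in>B. \<bar>c b\<bar>) \<le> (\<Sum>b\<in>B. f b * norm (\<Sum>v\<in>B. c v *\<^sub>R v))"
      using f(2) by (rule sum_mono)
    also have "\<dots> \<le> (sum f B + 1) * norm (\<Sum>v\<in>B. c v *\<^sub>R v)"
      by (simp add: sum_distrib_right[symmetric] distrib_right)
    finally show "(\<Sum>b\<in>B. \<bar>c b\<bar>) \<le> (sum f B + 1) * norm (\<Sum>b\<in>B. c b *\<^sub>R b)" .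
  qed
qed

lemma convex_comb3:
  assumes "convex H" "a \<in> H" "b \<in> H" "c \<in> H" "0 \<le> \<alpha>" "0 \<le> \<beta>" "0 \<le> \<gamma>" "\<alpha> + \<beta> + \<gamma> = 1"
  shows "\<alpha> *\<^sub>R a + \<beta> *\<^sub>R b + \<gamma> *\<^sub>R c \<in> H"
proof (cases "\<alpha> + \<beta> = 0")
  case True
  then have "\<alpha> = 0" "\<beta> = 0" "\<gamma> = 1" using assms(5-8) by linarith+
  then show ?thesis using assms(4) by simp
next
  case False
  let ?p = "(\<alpha> / (\<alpha> + \<beta>)) *\<^sub>R a + (\<beta> / (\<alpha> + \<beta>)) *\<^sub>R b"
  have "?p \<in> H" using assms(2,3,5,6) False
    by (intro convexD[OF assms(1)]) (simp_all flip: add_divide_distrib)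
  then have "(\<alpha> + \<beta>) *\<^sub>R ?p + \<gamma> *\<^sub>R c \<in> H" 
    by (rule convexD[OF assms(1) _ assms(4)]) (use assms(5-8) in linarith)+
  moreover have "(\<alpha> + \<beta>) *\<^sub>R ?p = \<alpha> *\<^sub>R a + \<beta> *\<^sub>R b"
    using False by (simp add: scaleR_right_distrib)
  ultimately show ?thesis by simp
qed

lemma sum_in_convex_cone_hull:
  assumes "\<And>i. i \<in> I \<Longrightarrow> f i \<in> convex_cone hull S"
  shows "sum f I \<in> convex_cone hull S"
  using assms
proof (induction I rule: infinite_finite_induct)
  case (insert i I)
  then have "f i + sum f I \<in> convex_cone hull S" by (intro convex_cone_hull_add) simp_all
  with insert show ?case by simp
qed (simp_all add: convex_cone_hull_contains_0)

context irrational_unimodular_lattice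
begin

definition indicator_vec :: "'n set \<Rightarrow> real^'n" where
  "indicator_vec Z = (\<chi> i. if i \<in> Z then 1 else 0)"

text \<open>Z stands for the coordinates in which there is unlimited room. The generating vectors
  may be added to or subtracted from x without violating positivity off Z.\<close>

definition slab_span :: "real^'n \<Rightarrow> 'n set \<Rightarrow> (real^'n) set" where
  "slab_span x Z = span {z \<in> L. \<forall>i. i \<notin> Z \<longrightarrow> \<bar>z $ i\<bar> < x $ i}"

text \<open>A lattice vector s close to k times the indicator of Z is large on Z and negligible off
  Z. Hence x + s and x + m s plus or minus b lie in the orthant for every b in a basis of the slab
  span, and the hull of these finitely many points and x contains a neighbourhood of x + s relative
  to x plus the slab span.\<close>

lemma slab_neighbourhood_in_hull:
  assumes x: "x \<in> positive_points" and R: "1 \<le> R"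
  obtains k \<eta> Y where "R \<le> k" "0 < \<eta>" "finite Y" "Y \<subseteq> positive_points"
    "\<And>u. u \<in> slab_span x Z \<Longrightarrow> norm (u - k *\<^sub>R indicator_vec Z) \<le> \<eta> \<Longrightarrow> x + u \<in> convex hull (insert x Y)"
proof -
  define G where "G = {z \<in> L. \<forall>i. i \<notin> Z \<longrightarrow> \<bar>z $ i\<bar> < x $ i}"
  obtain B where B: "B \<subseteq> G" "independent B" "G \<subseteq> span B"
    using maximal_independent_subset by blast
  have fB: "finite B" using B(2) independent_imp_finite by blast
  obtain \<kappa> where \<kappa>: "0 < \<kappa>" "\<And>c. (\<Sum>b\<in>B. \<bar>c b\<bar>) \<le> \<kappa> * norm (\<Sum>b\<in>B. c b *\<^sub>R b)"
    using independent_coordinates_bounded[OF B(2)] by blast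
  have xpos: "x \<in> L" "\<And>i. 0 < x $ i" using x by (auto simp: positive_points_iff)
  \<comment> \<open>On Z the vector s is at least 1/2, so m copies of it compensate any basis vector
    b.\<close>
  define m where "m = nat \<lceil>2 * (\<Sum>b\<in>B. \<Sum>i\<in>UNIV. \<bar>b $ i\<bar>)\<rceil> + 1"
  have m1: "1 \<le> real m" by (simp add: m_def)
  have mb: "\<bar>b $ i\<bar> \<le> real m / 2" if "b \<in> B" for b i
  proof -
    have "\<bar>b $ i\<bar> \<le> (\<Sum>i\<in>UNIV. \<bar>b $ i\<bar>)" by (rule member_le_sum) auto
    also have "\<dots> \<le> (\<Sum>b\<in>B. \<Sum>i\<in>UNIV. \<bar>b $ i\<bar>)"
      using that fB by (intro member_le_sum[of b B "\<lambda>b. \<Sum>i\<in>UNIV. \<bar>b $ i\<bar>"]) (auto intro: sum_nonneg)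
    also have "\<dots> \<le> real m / 2"
      using of_nat_ceiling[of "2 * (\<Sum>b\<in>B. \<Sum>i\<in>UNIV. \<bar>b $ i\<bar>)"] unfolding m_def by simp
    finally show ?thesis .
  qed
  \<comment> \<open>The minimum of T is the slack left off Z after adding or subtracting a basis
    vector; the coordinates of x are included so that it also bounds s itself.\<close>
  define T where "T = (\<lambda>(b, i). x $ i - \<bar>b $ i\<bar>) ` (B \<times> (- Z)) \<union> range (($) x)"
  define \<gamma> where "\<gamma> = Min T"
  have T: "finite T" "T \<noteq> {}" "\<And>t. t \<in> T \<Longrightarrow> 0 < t"
    using fB xpos B(1) unfolding T_def G_def by auto
  have \<gamma>: "0 < \<gamma>" using T unfolding \<gamma>_def by simp
  have \<gamma>x: "\<gamma> \<le> x $ i" for i unfolding \<gamma>_def by (rule Min_le[OF T(1)]) (auto simp: T_def)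
  have \<gamma>b: "\<bar>b $ i\<bar> + \<gamma> \<le> x $ i" if "b \<in> B" "i \<notin> Z" for b i
  proof -
    have "\<gamma> \<le> x $ i - \<bar>b $ i\<bar>" unfolding \<gamma>_def by (rule Min_le[OF T(1)]) (use that in \<open>auto simp: T_def\<close>)
    then show ?thesis by simp
  qed
  \<comment> \<open>The three bounds keep s at least 1/2 on Z, keep m s within the slack
    \<open>\<gamma>\<close> off Z, and make m times the coefficient sum of u - s at most 1.\<close>
  define \<delta> where "\<delta> = min (1/2) (min (\<gamma> / (real m + 1)) (1 / (2 * \<kappa> * real m)))"
  have \<delta>: "\<delta> \<le> 1/2" "\<delta> \<le> \<gamma> / (real m + 1)" "\<delta> \<le> 1 / (2 * \<kappa> * real m)"
    unfolding \<delta>_def by linarith+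
  have \<delta>0: "0 < \<delta>" using \<gamma> \<kappa>(1) m1 unfolding \<delta>_def by simp
  note \<delta> = \<delta>0 \<delta>
  have m\<delta>: "real m * \<delta> + \<delta> \<le> \<gamma>" using \<delta>(3) m1 by (simp add: field_simps)
  have m\<delta>': "real m * \<delta> < \<gamma>" "\<delta> < \<gamma>" using m\<delta> \<delta>(1) m1 by (smt (verit) mult_pos_pos)+
  have \<kappa>\<delta>: "\<kappa> * (2 * \<delta>) \<le> 1 / real m" using \<delta>(4) \<kappa>(1) m1 by (simp add: field_simps)
  obtain k s where ks: "R \<le> k" "s \<in> L" "norm (s - k *\<^sub>R indicator_vec Z) < \<delta>"
    using dirichlet_direction[OF \<delta>(1) R] by blast
  have comp: "\<bar>s $ i - k * (if i \<in> Z then 1 else 0)\<bar> < \<delta>" for i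
    using component_le_norm_cart[of "s - k *\<^sub>R indicator_vec Z" i] ks(3) by (simp add: indicator_vec_def)
  have sZ: "1/2 \<le> s $ i" if "i \<in> Z" for i
  proof -
    have "\<bar>s $ i - k\<bar> < \<delta>" using comp[of i] that by simp
    then show ?thesis using \<delta>(2) ks(1) R by linarith
  qed
  have soff: "\<bar>s $ i\<bar> < \<delta>" if "i \<notin> Z" for i using comp[of i] that by simp
  have "\<bar>s $ i\<bar> < x $ i" if "i \<notin> Z" for i
    using soff[OF that] \<gamma>x[of i] m\<delta>'(2) by linarith
  then have sG: "s \<in> G" unfolding G_def using ks(2) by simp
  define y where "y \<epsilon> b = x + \<epsilon> *\<^sub>R b + real m *\<^sub>R s" for \<epsilon> b
  define Y where "Y = insert (x + s) (y 1 ` B \<union> y (-1) ` B)"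
  have ypos: "y \<epsilon> b \<in> positive_points" if b: "b \<in> B" and e: "\<epsilon> = 1 \<or> \<epsilon> = -1" for \<epsilon> b
  proof -
    have bL: "b \<in> L" using B(1) b by (auto simp: G_def)
    have "y \<epsilon> b \<in> L" unfolding y_def
    proof (intro add_in of_nat_scaleR_in xpos(1) ks(2))
      show "\<epsilon> *\<^sub>R b \<in> L" using e bL uminus_in[OF bL] by auto
    qed
    moreover have "0 < y \<epsilon> b $ i" for i
    proof (cases "i \<in> Z")
      case True
      have "real m / 2 \<le> real m * s $ i" using sZ[OF True] mult_left_mono[of "1/2" "s $ i" "real m"] by simp
      moreover have "\<bar>b $ i\<bar> \<le> real m / 2" using mb[OF b] .
      ultimately show ?thesis using xpos(2)[of i] e unfolding y_def by auto
    next
      case False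
      have "real m * \<bar>s $ i\<bar> \<le> real m * \<delta>" using soff[OF False] by (intro mult_left_mono) auto
      then have "\<bar>real m * s $ i\<bar> < \<gamma>" using m\<delta>'(1) by (simp add: abs_mult)
      then show ?thesis using \<gamma>b[OF b False] e unfolding y_def by auto
    qed
    ultimately show ?thesis by (simp add: positive_points_iff)
  qed
  have "x + s \<in> positive_points"
  proof -
    have "0 < (x + s) $ i" for i
      using sZ[of i] soff[of i] \<gamma>x[of i] m\<delta>'(2) xpos(2)[of i] by (cases "i \<in> Z") auto
    then show ?thesis using add_in[OF xpos(1) ks(2)] by (simp add: positive_points_iff)
  qed
  then have Y: "finite Y" "Y \<subseteq> positive_points" using fB ypos unfolding Y_def by auto
  have main: "x + u \<in> convex hull (insert x Y)"
    if u: "u \<in> slab_span x Z" "norm (u - k *\<^sub>R indicator_vec Z) \<le> \<delta>" for u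
  proof -
    let ?H = "convex hull (insert x Y)"
    have "u - s \<in> span G" using u(1) sG unfolding slab_span_def G_def[symmetric]
      by (intro span_diff) (auto intro: span_base)
    then have "u - s \<in> span B" using span_minimal[OF B(3) subspace_span] by blast
    then obtain c where c: "u - s = (\<Sum>b\<in>B. c b *\<^sub>R b)" using span_finite[OF fB] by auto
    define C where "C = (\<Sum>b\<in>B. \<bar>c b\<bar>)"
    have "norm (u - s) \<le> 2 * \<delta>"
      using norm_triangle_ineq4[of "u - k *\<^sub>R indicator_vec Z" "s - k *\<^sub>R indicator_vec Z"] u(2) ks(3) by simp
    then have "\<kappa> * norm (u - s) \<le> 1 / real m" using \<kappa>\<delta> \<kappa>(1) mult_left_mono[of "norm (u - s)" "2 * \<delta>" \<kappa>] by linarith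
    then have "C \<le> 1 / real m" unfolding C_def using \<kappa>(2)[of c] c by simp
    then have mC: "real m * C \<le> 1" using m1 by (simp add: field_simps)
    have C0: "0 \<le> C" unfolding C_def by (simp add: sum_nonneg)
    have yH: "y \<epsilon> b \<in> ?H" if "b \<in> B" "\<epsilon> = 1 \<or> \<epsilon> = -1" for \<epsilon> b
      using that by (auto simp: Y_def intro!: hull_inc)
    have sH: "x + s \<in> ?H" "x \<in> ?H" by (auto simp: Y_def intro!: hull_inc)
    define \<epsilon> where "\<epsilon> b = (if 0 \<le> c b then 1 else -1 :: real)" for b
    have \<epsilon>: "\<bar>c b\<bar> * \<epsilon> b = c b" "\<epsilon> b = 1 \<or> \<epsilon> b = -1" for b by (auto simp: \<epsilon>_def)
    define p where "p = (if C = 0 then x else (\<Sum>b\<in>B. (\<bar>c b\<bar> / C) *\<^sub>R y (\<epsilon> b) b))"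
    have "p \<in> ?H"
    proof (cases "C = 0")
      case False
      then have "(\<Sum>b\<in>B. (\<bar>c b\<bar> / C) *\<^sub>R y (\<epsilon> b) b) \<in> ?H"
        using fB C0 yH \<epsilon>(2) by (intro convex_sum) (auto simp: C_def[symmetric] sum_divide_distrib[symmetric])
      then show ?thesis using False by (simp add: p_def)
    qed (use sH in \<open>simp add: p_def\<close>)
    moreover have "C *\<^sub>R p = C *\<^sub>R x + (u - s) + (real m * C) *\<^sub>R s"
    proof (cases "C = 0")
      case True
      then have "c b = 0" if "b \<in> B" for b
        using that fB unfolding C_def by (simp add: sum_nonneg_eq_0_iff)
      then show ?thesis using True c by simp
    next
      case False
      then have "C *\<^sub>R p = (\<Sum>b\<in>B. \<bar>c b\<bar> *\<^sub>R y (\<epsilon> b) b)"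
        unfolding p_def by (simp add: scaleR_right.sum)
      also have "\<dots> = (\<Sum>b\<in>B. \<bar>c b\<bar> *\<^sub>R x + c b *\<^sub>R b + (real m * \<bar>c b\<bar>) *\<^sub>R s)"
        unfolding y_def using \<epsilon>(1) by (intro sum.cong) (auto simp: scaleR_right_distrib mult.commute)
      also have "\<dots> = C *\<^sub>R x + (u - s) + (real m * C) *\<^sub>R s"
        unfolding c C_def by (simp add: sum.distrib scaleR_left.sum sum_distrib_left)
      finally show ?thesis .
    qed
    \<comment> \<open>The three weights add up to 1 and are nonnegative because
      \<open>real m * C \<le> 1\<close> and m is at least 1. The point p carries the correction u -
      s at the price of m copies of s per unit, which the first weight gives back.\<close>
    then have "x + u = (1 - real m * C) *\<^sub>R (x + s) + C *\<^sub>R p + (real m * C - C) *\<^sub>R x"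
      by (simp add: algebra_simps)
    moreover have "C \<le> real m * C" using m1 C0 mult_right_mono[of 1 "real m" C] by simp
    ultimately show ?thesis using mC C0 sH
      by (simp only:) (rule convex_comb3[OF convex_convex_hull], auto)
  qed
  show ?thesis by (rule that[OF ks(1) \<delta>(1) Y main])
qed

text \<open>The indicator is a limit of lattice vectors of the slab divided by large multiples, and
  a subspace is closed.\<close>

lemma indicator_in_slab_span:
  assumes x: "x \<in> positive_points"
  shows "indicator_vec Z \<in> slab_span x Z"
proof -
  have xpos: "\<And>i. 0 < x $ i" using x by (auto simp: positive_points_iff)
  define \<gamma> where "\<gamma> = Min (range (($) x))"
  have \<gamma>: "0 < \<gamma>" "\<And>i. \<gamma> \<le> x $ i" using xpos unfolding \<gamma>_def by auto
  have "\<exists>y\<in>slab_span x Z. dist y (indicator_vec Z) < e" if e: "0 < e" for e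
  proof -
    obtain k s where ks: "1 \<le> k" "s \<in> L" "norm (s - k *\<^sub>R indicator_vec Z) < min e \<gamma>"
      using dirichlet_direction[of "min e \<gamma>" 1 "indicator_vec Z"] e \<gamma> by auto
    have "\<bar>s $ i\<bar> < x $ i" if "i \<notin> Z" for i
      using component_le_norm_cart[of "s - k *\<^sub>R indicator_vec Z" i] ks(3) \<gamma>(2)[of i] that
      by (simp add: indicator_vec_def)
    then have "s \<in> slab_span x Z" unfolding slab_span_def using ks(2) by (intro span_base) auto
    then have "(1 / k) *\<^sub>R s \<in> slab_span x Z" unfolding slab_span_def by (rule span_scale)
    moreover have "dist ((1 / k) *\<^sub>R s) (indicator_vec Z) = norm (s - k *\<^sub>R indicator_vec Z) / k"
    proof -
      have "(1 / k) *\<^sub>R s - indicator_vec Z = (1 / k) *\<^sub>R (s - k *\<^sub>R indicator_vec Z)"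
        using ks(1) by (simp add: scaleR_right_diff_distrib)
      then show ?thesis using ks(1) by (simp add: dist_norm)
    qed
    moreover have "norm (s - k *\<^sub>R indicator_vec Z) / k < e"
    proof -
      have "norm (s - k *\<^sub>R indicator_vec Z) < e * 1" using ks(3) by simp
      also have "\<dots> \<le> e * k" using ks(1) e by (intro mult_left_mono) auto
      finally show ?thesis using ks(1) by (simp add: field_simps)
    qed
    ultimately show ?thesis by (intro bexI[of _ "(1 / k) *\<^sub>R s"]) auto
  qed
  moreover have "closed (slab_span x Z)" unfolding slab_span_def by (intro closed_subspace subspace_span)
  ultimately show ?thesis using closed_approachable by blast
qed

lemma slab_span_mono: "Z \<subseteq> W \<Longrightarrow> slab_span x Z \<subseteq> slab_span x W"
  unfolding slab_span_def by (intro span_mono) auto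

text \<open>The axis is usually not a lattice direction, but some far point
  \<open>x + k *\<^sub>R indicator_vec {i}\<close> lies in the hull of finitely many lattice points.
  Convexity fills in the nearer points, and the statement passes from lattice points to their
  hull.\<close>

lemma K_add_axis:
  assumes "z \<in> K" "0 \<le> c"
  shows "z + c *\<^sub>R indicator_vec {i} \<in> K"
proof -
  have pt: "x + c *\<^sub>R indicator_vec {i} \<in> K" if x: "x \<in> positive_points" for x
  proof -
    obtain k \<eta> Y where k: "max 1 c \<le> k" "0 < \<eta>" "Y \<subseteq> positive_points"
      "\<And>u. u \<in> slab_span x {i} \<Longrightarrow> norm (u - k *\<^sub>R indicator_vec {i}) \<le> \<eta> \<Longrightarrow> x + u \<in> convex hull (insert x Y)"
      using slab_neighbourhood_in_hull[OF x, of "max 1 c" "{i}"] by (metis max.cobounded1)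
    have "k *\<^sub>R indicator_vec {i} \<in> slab_span x {i}"
      using indicator_in_slab_span[OF x, of "{i}"] unfolding slab_span_def by (rule span_scale)
    then have "x + k *\<^sub>R indicator_vec {i} \<in> convex hull (insert x Y)" using k(2,4) by simp
    also have "convex hull (insert x Y) \<subseteq> K" unfolding K_eq using x k(3) by (intro hull_mono) auto
    finally have far: "x + k *\<^sub>R indicator_vec {i} \<in> K" .
    have kpos: "0 < k" "c \<le> k" using k(1) by auto
    have "(1 - c / k) *\<^sub>R x + (c / k) *\<^sub>R (x + k *\<^sub>R indicator_vec {i}) \<in> K"
      using kpos assms(2) far x positive_points_subset_K by (intro convexD[OF convex_K]) auto
    moreover have "(1 - c / k) *\<^sub>R x + (c / k) *\<^sub>R (x + k *\<^sub>R indicator_vec {i}) = x + c *\<^sub>R indicator_vec {i}"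
      using kpos by (simp add: algebra_simps)
    ultimately show ?thesis by simp
  qed
  have "convex {z. c *\<^sub>R indicator_vec {i} + z \<in> K}"
  proof (rule convexI, safe)
    fix p q and u v :: real
    assume h: "c *\<^sub>R indicator_vec {i} + p \<in> K" "c *\<^sub>R indicator_vec {i} + q \<in> K" "0 \<le> u" "0 \<le> v" "u + v = 1"
    have "u *\<^sub>R (c *\<^sub>R indicator_vec {i} + p) + v *\<^sub>R (c *\<^sub>R indicator_vec {i} + q)
        = (u + v) *\<^sub>R (c *\<^sub>R indicator_vec {i}) + (u *\<^sub>R p + v *\<^sub>R q)"
      by (simp add: algebra_simps)
    moreover have "u *\<^sub>R (c *\<^sub>R indicator_vec {i} + p) + v *\<^sub>R (c *\<^sub>R indicator_vec {i} + q) \<in> K"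
      by (rule convexD[OF convex_K h])
    ultimately show "c *\<^sub>R indicator_vec {i} + (u *\<^sub>R p + v *\<^sub>R q) \<in> K"
      using h(5) by simp
  qed
  then have "K \<subseteq> {z. c *\<^sub>R indicator_vec {i} + z \<in> K}"
    using pt hull_minimal[of positive_points "{z. c *\<^sub>R indicator_vec {i} + z \<in> K}" convex]
    by (auto simp: add.commute K_eq[symmetric])
  then show ?thesis using assms(1) by (auto simp: add.commute)
qed

lemma vec_eq_sum_axis: "(w::real^'n) = (\<Sum>i\<in>UNIV. (w $ i) *\<^sub>R indicator_vec {i})"
proof -
  have "(\<Sum>i\<in>UNIV. w $ i * (if j = i then 1 else 0)) = w $ j" for j
  proof -
    have "(\<Sum>i\<in>UNIV. w $ i * (if j = i then 1 else 0)) = (\<Sum>i\<in>UNIV. if j = i then w $ i else 0)"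
      by (intro sum.cong) auto
    then show ?thesis by simp
  qed
  then show ?thesis by (simp add: vec_eq_iff indicator_vec_def)
qed

lemma K_upward:
  assumes "z \<in> K" "\<And>i. z $ i \<le> w $ i"
  shows "w \<in> K"
proof -
  have "z + (\<Sum>i\<in>I. (w $ i - z $ i) *\<^sub>R indicator_vec {i}) \<in> K" if "finite I" for I
    using that
  proof (induction I)
    case (insert i I)
    have "(z + (\<Sum>i\<in>I. (w $ i - z $ i) *\<^sub>R indicator_vec {i})) + (w $ i - z $ i) *\<^sub>R indicator_vec {i} \<in> K"
      using insert assms(2) by (intro K_add_axis) auto
    then show ?case using insert by (simp add: ac_simps)
  qed (use assms in simp)
  from this[of UNIV] have "z + (\<Sum>i\<in>UNIV. (w - z) $ i *\<^sub>R indicator_vec {i}) \<in> K" by simp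
  then have "z + (w - z) \<in> K" by (simp only: vec_eq_sum_axis[of "w - z", symmetric])
  then show ?thesis by simp
qed

text \<open>Infinitely many generators of the tangent cone would, along a subsequence, differ by lattice
  vectors that are small off a coordinate set and large on it; these lie in the finitely generated
  cone supplied by \<open>slab_neighbourhood_in_hull\<close>.\<close>

lemma tangent_cone_finite:
  assumes x: "x \<in> positive_points"
  obtains Y where "finite Y" "Y \<subseteq> positive_points"
    "\<And>y. y \<in> positive_points \<Longrightarrow> y - x \<in> convex_cone hull ((\<lambda>y. y - x) ` Y)"
proof -
  have xpos: "x \<in> L" "\<And>i. 0 < x $ i" using x by (auto simp: positive_points_iff)
  define Q where "Q Z k \<eta> Y \<longleftrightarrow> 1 \<le> k \<and> 0 < \<eta> \<and> finite Y \<and> Y \<subseteq> positive_points \<and>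
    (\<forall>u. u \<in> slab_span x Z \<longrightarrow> norm (u - k *\<^sub>R indicator_vec Z) \<le> \<eta> \<longrightarrow> x + u \<in> convex hull (insert x Y))" for Z k \<eta> Y
  have "\<exists>k \<eta> Y. Q Z k \<eta> Y" for Z
    by (rule slab_neighbourhood_in_hull[OF x order_refl, of Z]) (unfold Q_def, blast)
  then obtain k \<eta> Y where Q: "\<And>Z. Q Z (k Z) (\<eta> Z) (Y Z)" by metis
  then have k: "\<And>Z. 1 \<le> k Z" and \<eta>: "\<And>Z. 0 < \<eta> Z"
    and Y: "\<And>Z. finite (Y Z)" "\<And>Z. Y Z \<subseteq> positive_points"
    and hull: "\<And>Z u. u \<in> slab_span x Z \<Longrightarrow> norm (u - k Z *\<^sub>R indicator_vec Z) \<le> \<eta> Z \<Longrightarrow> x + u \<in> convex hull (insert x (Y Z))"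
    unfolding Q_def by blast+
  define Y0 where "Y0 = (\<Union>Z. Y Z)"
  define cone where "cone Y = convex_cone hull ((\<lambda>y. y - x) ` Y)" for Y
  have fY0: "finite Y0" "Y0 \<subseteq> positive_points" unfolding Y0_def using Y by auto
  have cone_mono: "cone S \<subseteq> cone T" if "S \<subseteq> T" for S T
    unfolding cone_def using that by (intro hull_mono) auto
  have ball: "u \<in> cone Y0" if "u \<in> slab_span x Z" "norm (u - k Z *\<^sub>R indicator_vec Z) \<le> \<eta> Z" for u Z
  proof -
    have "convex ((+) x ` cone Y0)" unfolding cone_def
      by (intro convex_translation convex_convex_cone_hull)
    moreover have "insert x (Y Z) \<subseteq> (+) x ` cone Y0"
    proof -
      have "x + 0 \<in> (+) x ` cone Y0" unfolding cone_def by (intro imageI convex_cone_hull_contains_0)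
      moreover have "x + (y - x) \<in> (+) x ` cone Y0" if "y \<in> Y Z" for y
        unfolding cone_def using that by (intro imageI hull_inc) (auto simp: Y0_def)
      ultimately show ?thesis by auto
    qed
    ultimately have "convex hull (insert x (Y Z)) \<subseteq> (+) x ` cone Y0" by (simp add: hull_minimal)
    then show ?thesis using hull[OF that] by auto
  qed
  have axis: "c *\<^sub>R indicator_vec {i} \<in> cone Y0" if "0 \<le> c" for c i
  proof -
    have "k {i} *\<^sub>R indicator_vec {i} \<in> slab_span x {i}"
      using indicator_in_slab_span[OF x, of "{i}"] unfolding slab_span_def by (rule span_scale)
    then have "k {i} *\<^sub>R indicator_vec {i} \<in> cone Y0" using ball[of _ "{i}"] \<eta>[of "{i}"] by simp
    then have "(c / k {i}) *\<^sub>R (k {i} *\<^sub>R indicator_vec {i}) \<in> cone Y0"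
      unfolding cone_def by (rule convex_cone_hull_mul) (use that k[of "{i}"] in simp)
    then show ?thesis using k[of "{i}"] by simp
  qed
  show thesis
  proof (rule ccontr)
    assume "\<not> thesis"
    then have "\<exists>y\<in>positive_points. y - x \<notin> cone S" if "finite S" "S \<subseteq> positive_points" for S
      using \<open>\<And>Y. finite Y \<Longrightarrow> Y \<subseteq> positive_points \<Longrightarrow> (\<And>y. y \<in> positive_points \<Longrightarrow> y - x \<in> convex_cone hull ((\<lambda>y. y - x) ` Y)) \<Longrightarrow> thesis\<close> that
      unfolding cone_def by blast
    then obtain f where f: "\<And>S. finite S \<Longrightarrow> S \<subseteq> positive_points \<Longrightarrow> f S \<in> positive_points \<and> f S - x \<notin> cone S"
      by metis
    \<comment> \<open>Greedy choice: every new lattice point lies outside the cone generated so far,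
      so no later point minus an earlier one lies in the cone of Y0.\<close>
    define h where "h = rec_nat Y0 (\<lambda>_ S. insert (f S) S)"
    have h0: "h 0 = Y0" and hS: "\<And>n. h (Suc n) = insert (f (h n)) (h n)" by (auto simp: h_def)
    have h: "finite (h n) \<and> h n \<subseteq> positive_points \<and> Y0 \<subseteq> h n" for n
      using fY0 f by (induction n) (auto simp: h0 hS)
    define y where "y n = f (h n)" for n
    have y: "y n \<in> positive_points" "y n - x \<notin> cone (h n)" for n using f h by (auto simp: y_def)
    have ypos: "0 < y n $ i" for n i using y(1) by (auto simp: positive_points_iff)
    have hmono: "h m \<subseteq> h n" if "m \<le> n" for m n
      by (rule lift_Suc_mono_le[OF _ that]) (auto simp: hS)
    have yh: "y m \<in> h n" if "m < n" for m n
      using hmono[of "Suc m" n] that by (auto simp: hS y_def)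
    have no: "y n - y m \<notin> cone Y0" if "m < n" for m n
    proof
      assume "y n - y m \<in> cone Y0"
      then have "y n - y m \<in> cone (h n)" using cone_mono h by blast
      moreover have "y m - x \<in> cone (h n)" unfolding cone_def using yh[OF that] by (intro hull_inc) auto
      ultimately have "(y n - y m) + (y m - x) \<in> cone (h n)" unfolding cone_def by (rule convex_cone_hull_add)
      then show False using y(2)[of n] by simp
    qed
    \<comment> \<open>This map compactifies the positive half-line to the interval from 0 to 1.
      Along a subsequence every coordinate converges; the limit 1, which defines Z below, means that
      the coordinate tends to infinity.\<close>
    define w where "w n = (\<chi> i. y n $ i / (1 + y n $ i))" for n
    have w: "0 < w n $ i" "w n $ i < 1" "y n $ i = w n $ i / (1 - w n $ i)" for n i
      using ypos[of n i] by (auto simp: w_def field_simps)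
    have "bounded (range w)"
    proof (rule boundedI)
      fix v assume "v \<in> range w"
      then obtain n where "v = w n" by auto
      have "norm (w n) \<le> (\<Sum>i\<in>UNIV. \<bar>w n $ i\<bar>)" by (rule norm_le_l1_cart)
      also have "\<dots> \<le> (\<Sum>i\<in>(UNIV::'n set). 1)" using w by (intro sum_mono) (auto simp: less_imp_le)
      finally show "norm v \<le> real CARD('n)" using \<open>v = w n\<close> by simp
    qed
    then obtain \<omega> r where r: "strict_mono r" "(w \<circ> r) \<longlonglongrightarrow> \<omega>"
      using bounded_imp_convergent_subsequence by blast
    then have wl: "(\<lambda>n. w (r n) $ i) \<longlonglongrightarrow> \<omega> $ i" for i using tendsto_vec_nth[OF r(2)] by (simp add: o_def)
    define Z where "Z = {i. \<omega> $ i = 1}"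
    define \<gamma> where "\<gamma> = Min (range (($) x))"
    have \<gamma>: "0 < \<gamma>" "\<And>i. \<gamma> \<le> x $ i" using xpos unfolding \<gamma>_def by auto
    define \<delta> where "\<delta> = min \<gamma> (\<eta> Z / real CARD('n))"
    have \<delta>: "0 < \<delta>" "\<delta> \<le> \<gamma>" "real CARD('n) * \<delta> \<le> \<eta> Z"
    proof -
      show "0 < \<delta>" using \<gamma> \<eta>[of Z] by (simp add: \<delta>_def)
      show "\<delta> \<le> \<gamma>" by (simp add: \<delta>_def)
      have "\<delta> \<le> \<eta> Z / real CARD('n)" by (simp add: \<delta>_def)
      then show "real CARD('n) * \<delta> \<le> \<eta> Z" by (simp add: field_simps)
    qed
    define v where "v n = (\<chi> i. if i \<in> Z then 0 else y (r n) $ i)" for n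
    have "v \<longlonglongrightarrow> (\<chi> i. if i \<in> Z then 0 else \<omega> $ i / (1 - \<omega> $ i))"
    proof (rule vec_tendstoI)
      fix i
      show "(\<lambda>n. v n $ i) \<longlonglongrightarrow> (\<chi> i. if i \<in> Z then 0 else \<omega> $ i / (1 - \<omega> $ i)) $ i"
      proof (cases "i \<in> Z")
        case True
        then show ?thesis by (simp add: v_def)
      next
        case False
        then have "(\<lambda>n. w (r n) $ i / (1 - w (r n) $ i)) \<longlonglongrightarrow> \<omega> $ i / (1 - \<omega> $ i)"
          by (intro tendsto_divide tendsto_diff tendsto_const wl) (auto simp: Z_def)
        then show ?thesis using False w(3) by (simp add: v_def)
      qed
    qed
    then have "Cauchy v" by (rule LIMSEQ_imp_Cauchy)
    then obtain N where N: "\<And>m n. m \<ge> N \<Longrightarrow> n \<ge> N \<Longrightarrow> norm (v m - v n) < \<delta>"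
      using \<delta>(1) unfolding Cauchy_iff by metis
    have "eventually (\<lambda>n. i \<in> Z \<longrightarrow> y (r N) $ i + k Z \<le> y (r n) $ i) sequentially" for i
    proof (cases "i \<in> Z")
      case True
      define b where "b = y (r N) $ i + k Z"
      have b: "0 < b" using ypos[of "r N" i] k[of Z] by (simp add: b_def)
      then have "b / (1 + b) < \<omega> $ i" using True by (simp add: Z_def)
      then have "eventually (\<lambda>n. b / (1 + b) < w (r n) $ i) sequentially"
        using wl[of i] by (rule order_tendstoD(1)[rotated])
      then show ?thesis
      proof eventually_elim
        case (elim n)
        then have "b * (1 + y (r n) $ i) < y (r n) $ i * (1 + b)"
          using b ypos[of "r n" i] by (simp add: w_def divide_less_eq less_divide_eq split: if_splits)
        then show ?case by (simp add: b_def algebra_simps)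
      qed
    qed simp
    then have "eventually (\<lambda>n. \<forall>i. i \<in> Z \<longrightarrow> y (r N) $ i + k Z \<le> y (r n) $ i) sequentially"
      by (rule eventually_all_finite)
    then have "eventually (\<lambda>n. N < n \<and> (\<forall>i. i \<in> Z \<longrightarrow> y (r N) $ i + k Z \<le> y (r n) $ i)) sequentially"
      by (intro eventually_conj eventually_gt_at_top)
    then obtain n where n: "N < n" "\<And>i. i \<in> Z \<Longrightarrow> y (r N) $ i + k Z \<le> y (r n) $ i"
      using eventually_happens'[OF sequentially_bot] by blast
    define z where "z = y (r n) - y (r N)"
    have zL: "z \<in> L" unfolding z_def using y(1) by (intro diff_in) (auto simp: positive_points_iff)
    have zoff: "\<bar>z $ i\<bar> < \<delta>" if "i \<notin> Z" for i
    proof -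
      have "\<bar>(v n - v N) $ i\<bar> < \<delta>"
        using component_le_norm_cart[of "v n - v N" i] N[of n N] n(1) by simp
      then show ?thesis using that by (simp add: v_def z_def)
    qed
    have zspan: "z \<in> slab_span x Z" unfolding slab_span_def
    proof (intro span_base CollectI conjI allI impI zL)
      fix i assume "i \<notin> Z"
      then show "\<bar>z $ i\<bar> < x $ i" using zoff[of i] \<delta>(2) \<gamma>(2)[of i] by linarith
    qed
    \<comment> \<open>The vector q is the excess of z over \<open>k Z\<close> on the coordinates of
      Z, a nonnegative combination of axes. What remains is close to \<open>k Z\<close> times the
      indicator of Z and falls under \<open>ball\<close>.\<close>
    define q where "q = (\<Sum>i\<in>Z. (z $ i - k Z) *\<^sub>R indicator_vec {i})"
    have "q \<in> cone Y0"
      unfolding q_def cone_def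
    proof (rule sum_in_convex_cone_hull, fold cone_def)
      show "(z $ i - k Z) *\<^sub>R indicator_vec {i} \<in> cone Y0" if "i \<in> Z" for i
        using n(2)[OF that] by (intro axis) (simp add: z_def)
    qed
    have "q \<in> slab_span x Z"
    proof -
      have "(z $ i - k Z) *\<^sub>R indicator_vec {i} \<in> slab_span x Z" if "i \<in> Z" for i
        using indicator_in_slab_span[OF x, of "{i}"] slab_span_mono[of "{i}" Z x] that
        unfolding slab_span_def by (intro span_scale) auto
      then show ?thesis unfolding q_def slab_span_def by (intro span_sum)
    qed
    have qi: "q $ i = (if i \<in> Z then z $ i - k Z else 0)" for i
    proof -
      have "q $ i = (\<Sum>j\<in>Z. (z $ j - k Z) * (if i = j then 1 else 0))"
        unfolding q_def by (simp add: indicator_vec_def)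
      also have "\<dots> = (\<Sum>j\<in>Z. if i = j then z $ j - k Z else 0)"
        by (intro sum.cong) auto
      finally show ?thesis by simp
    qed
    have "z - q \<in> cone Y0"
    proof (rule ball)
      show "z - q \<in> slab_span x Z" using zspan \<open>q \<in> slab_span x Z\<close> unfolding slab_span_def by (rule span_diff)
      have "norm (z - q - k Z *\<^sub>R indicator_vec Z) \<le> (\<Sum>i\<in>UNIV. \<bar>(z - q - k Z *\<^sub>R indicator_vec Z) $ i\<bar>)"
        by (rule norm_le_l1_cart)
      also have "\<dots> \<le> (\<Sum>i\<in>(UNIV::'n set). \<delta>)"
        using zoff \<delta>(1) by (intro sum_mono) (auto simp: qi indicator_vec_def less_imp_le)
      also have "\<dots> \<le> \<eta> Z" using \<delta>(3) by simp
      finally show "norm (z - q - k Z *\<^sub>R indicator_vec Z) \<le> \<eta> Z" .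
    qed
    with \<open>q \<in> cone Y0\<close> have "(z - q) + q \<in> cone Y0" unfolding cone_def by (intro convex_cone_hull_add)
    then show False using no[of "r N" "r n"] r(1) n(1) by (simp add: z_def strict_mono_def)
  qed
qed

end

section \<open>General facts on polyhedra and determinants\<close>

lemma polyhedron_translation:
  fixes S :: "'a::euclidean_space set"
  assumes "polyhedron S"
  shows "polyhedron ((+) a ` S)"
proof -
  obtain F where F: "finite F" "S = \<Inter>F" "\<forall>h\<in>F. \<exists>c d. c \<noteq> 0 \<and> h = {x. c \<bullet> x \<le> d}"
    using assms unfolding polyhedron_def by auto
  define F' where "F' = (\<lambda>h. {x. x - a \<in> h}) ` F"
  have "(+) a ` S = {x. x - a \<in> S}"
  proof
    show "{x. x - a \<in> S} \<subseteq> (+) a ` S"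
    proof
      fix x assume "x \<in> {x. x - a \<in> S}"
      then show "x \<in> (+) a ` S" by (intro image_eqI[of _ _ "x - a"]) auto
    qed
  qed auto
  also have "\<dots> = \<Inter>F'" unfolding F'_def F(2) by blast
  finally have "(+) a ` S = \<Inter>F'" .
  moreover have "\<exists>c d. c \<noteq> 0 \<and> h = {x. c \<bullet> x \<le> d}" if "h \<in> F'" for h
  proof -
    obtain g where g: "g \<in> F" "h = {x. x - a \<in> g}" using \<open>h \<in> F'\<close> unfolding F'_def by blast
    obtain c d where "c \<noteq> 0" "g = {x. c \<bullet> x \<le> d}" using F(3) g(1) by blast
    then have "h = {x. c \<bullet> x \<le> d + c \<bullet> a}" using g(2) by (auto simp: inner_diff_right)
    with \<open>c \<noteq> 0\<close> show ?thesis by blast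
  qed
  moreover have "finite F'" unfolding F'_def using F(1) by simp
  ultimately show ?thesis unfolding polyhedron_def by (intro exI[of _ F'] conjI ballI)
qed

lemma linear_det_row: "linear (\<lambda>x. det (\<chi> i. (g(k := x)) i))" for g :: "'n::finite \<Rightarrow> real^'n"
proof
  have upd: "(\<chi> i. (g(k := x)) i) = (\<chi> i. if i = k then x else g i)" for x
    by (auto simp: vec_eq_iff)
  fix x y :: "real^'n" and c :: real
  show "det (\<chi> i. (g(k := x + y)) i) = det (\<chi> i. (g(k := x)) i) + det (\<chi> i. (g(k := y)) i)"
    unfolding upd by (rule det_row_add)
  show "det (\<chi> i. (g(k := c *\<^sub>R x)) i) = c *\<^sub>R det (\<chi> i. (g(k := x)) i)"
    unfolding upd scalar_mult_eq_scaleR[symmetric] real_scaleR_def by (rule det_row_mul)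
qed

text \<open>The determinant is linear in each row, so the bound is carried from V to its convex hull
  one row at a time. In this way a bound on vertex determinants reaches all points of a
  facet.\<close>

lemma abs_det_convex_hull_le:
  fixes g :: "'n::finite \<Rightarrow> real^'n"
  assumes bound: "\<And>f. range f \<subseteq> V \<Longrightarrow> \<bar>det (\<chi> i. f i)\<bar> \<le> M"
    and g: "\<And>i. g i \<in> convex hull V"
  shows "\<bar>det (\<chi> i. g i)\<bar> \<le> M"
proof -
  have "\<bar>det (\<chi> i. f i)\<bar> \<le> M" if "finite I" "\<forall>i\<in>I. f i \<in> convex hull V" "\<forall>i. i \<notin> I \<longrightarrow> f i \<in> V" for I f
    using that
  proof (induction I arbitrary: f)
    case empty
    then show ?case by (intro bound) auto
  next
    case (insert k I)
    define l where "l x = det (\<chi> i. (f(k := x)) i)" for x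
    have "linear l" unfolding l_def by (rule linear_det_row)
    have "l x \<in> {-M..M}" if "x \<in> V" for x
    proof -
      have "\<bar>det (\<chi> i. (f(k := x)) i)\<bar> \<le> M"
        using insert that by (intro insert.IH) auto
      then show ?thesis by (simp add: l_def abs_le_iff)
    qed
    then have "V \<subseteq> l -` {-M..M}" by auto
    moreover have "convex (l -` {-M..M})" using \<open>linear l\<close> by (intro convex_linear_vimage) auto
    ultimately have "convex hull V \<subseteq> l -` {-M..M}" by (simp add: hull_minimal)
    then have "l (f k) \<in> {-M..M}" using insert.prems(1) by auto
    then show ?case by (simp add: l_def abs_le_iff)
  qed
  from this[of UNIV g] g show ?thesis by simp
qed

text \<open>An injective choice of rows is one summand of the series; a repeated row makes the
  determinant vanish.\<close>

lemma abs_det_le_det_sum: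
  fixes f :: "'n::finite \<Rightarrow> real^'n"
  assumes "range f \<subseteq> V"
  shows "ennreal \<bar>det (\<chi> i. f i)\<bar> \<le> det_sum V"
proof (cases "inj f")
  case True
  then have bij: "bij_betw f UNIV (range f)" by (simp add: bij_betw_def)
  have "infsum (\<lambda>S. ennreal (abs_det S)) {range f} \<le> det_sum V"
    unfolding det_sum_def
  proof (rule infsum_mono_neutral)
    show "(\<lambda>S. ennreal (abs_det S)) summable_on {S. S \<subseteq> V \<and> card S = CARD('n)}"
      by (rule nonneg_summable_on_complete) simp
    have "range f \<in> {S. S \<subseteq> V \<and> card S = CARD('n)}"
      using assms True by (simp add: card_image)
    then show "ennreal (abs_det S) \<le> 0" if "S \<in> {range f} - {S. S \<subseteq> V \<and> card S = CARD('n)}" for S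
      using that by blast
  qed simp_all
  then show ?thesis using abs_det_eq[OF bij] by simp
next
  case False
  then have "det (\<chi> i. f i) = 0" using det_nz_iff_independent[of f] by auto
  then show ?thesis by simp
qed

section \<open>Closedness and interior of the Klein polyhedron\<close>

context irrational_unimodular_lattice
begin

lemma positive_points_nonempty: obtains x where "x \<in> positive_points"
proof -
  obtain C where C: "0 < C" "\<And>p. \<exists>x\<in>L. \<forall>i. \<bar>x $ i - p $ i\<bar> \<le> C"
    using lattice_cover by blast
  obtain x where x: "x \<in> L" "\<forall>i. \<bar>x $ i - (\<chi> i. C + 1) $ i\<bar> \<le> C" using C(2) by blast
  have "0 < x $ i" for i using x(2)[rule_format, of i] by simp
  then show ?thesis using that x(1) positive_points_iff by blast
qed

text \<open>The second component records the total weight of a conic combination of lattice points.\<close>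

definition weighted_cone :: "nat \<Rightarrow> ((real^'n) \<times> real) set" where
  "weighted_cone k = {(z, c). \<exists>x \<mu>. (\<forall>i<k. x i \<in> positive_points \<and> 0 \<le> \<mu> i) \<and>
     c = (\<Sum>i<k. \<mu> i) \<and> (\<forall>j. (\<Sum>i<k. \<mu> i * x i $ j) \<le> z $ j)}"

lemma weighted_cone_0: "weighted_cone 0 = {(z, c). c = 0 \<and> (\<forall>j. 0 \<le> z $ j)}"
  by (simp add: weighted_cone_def)

lemma weighted_cone_Suc:
  "(z, c) \<in> weighted_cone (Suc k) \<longleftrightarrow>
     (\<exists>x\<in>positive_points. \<exists>\<mu>\<ge>0. (z - \<mu> *\<^sub>R x, c - \<mu>) \<in> weighted_cone k)"
proof
  assume "(z, c) \<in> weighted_cone (Suc k)"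
  then obtain x \<mu> where *: "\<forall>i<Suc k. x i \<in> positive_points \<and> 0 \<le> \<mu> i"
    "c = (\<Sum>i<Suc k. \<mu> i)" "\<forall>j. (\<Sum>i<Suc k. \<mu> i * x i $ j) \<le> z $ j"
    unfolding weighted_cone_def by auto
  have "(z - \<mu> k *\<^sub>R x k, c - \<mu> k) \<in> weighted_cone k"
    unfolding weighted_cone_def using * by (auto intro!: exI[of _ x] exI[of _ \<mu>] simp: algebra_simps)
  with * show "\<exists>x\<in>positive_points. \<exists>\<mu>\<ge>0. (z - \<mu> *\<^sub>R x, c - \<mu>) \<in> weighted_cone k" by blast
next
  assume "\<exists>x\<in>positive_points. \<exists>\<mu>\<ge>0. (z - \<mu> *\<^sub>R x, c - \<mu>) \<in> weighted_cone k"
  then obtain y \<nu> where y: "y \<in> positive_points" "0 \<le> \<nu>" "(z - \<nu> *\<^sub>R y, c - \<nu>) \<in> weighted_cone k" by blast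
  then obtain x \<mu> where *: "\<forall>i<k. x i \<in> positive_points \<and> 0 \<le> \<mu> i"
    "c - \<nu> = (\<Sum>i<k. \<mu> i)" "\<forall>j. (\<Sum>i<k. \<mu> i * x i $ j) \<le> (z - \<nu> *\<^sub>R y) $ j"
    unfolding weighted_cone_def by auto
  have "(\<Sum>i<k. (\<mu>(k := \<nu>)) i * (x(k := y)) i $ j) = (\<Sum>i<k. \<mu> i * x i $ j)" for j
    by (intro sum.cong) auto
  moreover have "(\<Sum>i<k. (\<mu>(k := \<nu>)) i) = (\<Sum>i<k. \<mu> i)" by (intro sum.cong) auto
  moreover have "(\<Sum>i<k. \<mu> i * x i $ j) + \<nu> * y $ j \<le> z $ j" for j using *(3)[rule_format, of j] by simp
  ultimately show "(z, c) \<in> weighted_cone (Suc k)"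
    unfolding weighted_cone_def using *(1,2) y
    by (intro CollectI case_prodI exI[of _ "x(k := y)"] exI[of _ "\<mu>(k := \<nu>)"]) (auto simp: less_Suc_eq)
qed

lemma weighted_cone_nonneg: "(z, c) \<in> weighted_cone k \<Longrightarrow> 0 \<le> z $ j \<and> 0 \<le> c"
proof -
  assume "(z, c) \<in> weighted_cone k"
  then obtain x \<mu> where *: "\<forall>i<k. x i \<in> positive_points \<and> 0 \<le> \<mu> i"
    "c = (\<Sum>i<k. \<mu> i)" "\<forall>j. (\<Sum>i<k. \<mu> i * x i $ j) \<le> z $ j"
    unfolding weighted_cone_def by auto
  have "0 \<le> (\<Sum>i<k. \<mu> i * x i $ j)" using *(1) by (intro sum_nonneg) (auto simp: positive_points_iff less_imp_le)
  also have "\<dots> \<le> z $ j" using *(3) by blast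
  finally show ?thesis using * by (auto intro: sum_nonneg)
qed

lemma weighted_cone_upward:
  assumes "(z, c) \<in> weighted_cone k" "\<And>j. z $ j \<le> w $ j"
  shows "(w, c) \<in> weighted_cone k"
proof -
  obtain x \<mu> where *: "\<forall>i<k. x i \<in> positive_points \<and> 0 \<le> \<mu> i"
    "c = (\<Sum>i<k. \<mu> i)" "\<forall>j. (\<Sum>i<k. \<mu> i * x i $ j) \<le> z $ j"
    using assms(1) unfolding weighted_cone_def by auto
  then have "\<forall>j. (\<Sum>i<k. \<mu> i * x i $ j) \<le> w $ j" using assms(2) order_trans by blast
  with * show ?thesis unfolding weighted_cone_def by blast
qed

text \<open>Induction on the number of summands. Positivity bounds each summand by the total, so
  weights and weighted points converge along a subsequence. If the limit weight is positive, the
  lattice points themselves converge, and by discreteness the limit is again a lattice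
  point.\<close>

lemma closed_weighted_cone: "closed (weighted_cone k)"
proof (induction k)
  case 0
  have "weighted_cone 0 = (\<Inter>j. {p. 0 \<le> fst p $ j}) \<inter> {p. snd p = 0}"
    unfolding weighted_cone_0 by auto
  moreover have "closed \<dots>"
    by (intro closed_Int closed_INT ballI closed_Collect_le closed_Collect_eq continuous_intros)
  ultimately show ?case by simp
next
  case (Suc k)
  show ?case
    unfolding closed_sequential_limits
  proof (intro allI impI, elim conjE)
    fix f :: "nat \<Rightarrow> (real^'n) \<times> real" and l
    assume f: "\<forall>n. f n \<in> weighted_cone (Suc k)" and lim: "f \<longlonglongrightarrow> l"
    define z c where "z = fst l" and "c = snd l"
    define zn cn where "zn n = fst (f n)" and "cn n = snd (f n)" for n
    have zl: "zn \<longlonglongrightarrow> z" "cn \<longlonglongrightarrow> c"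
      unfolding zn_def cn_def z_def c_def using lim by (auto intro: tendsto_fst tendsto_snd)
    have "\<exists>x \<mu>. x \<in> positive_points \<and> 0 \<le> \<mu> \<and> (zn n - \<mu> *\<^sub>R x, cn n - \<mu>) \<in> weighted_cone k" for n
      using f weighted_cone_Suc[of "zn n" "cn n" k] by (auto simp: zn_def cn_def)
    then obtain x \<mu> where x: "\<And>n. x n \<in> positive_points" and \<mu>: "\<And>n. 0 \<le> \<mu> n"
      and rest: "\<And>n. (zn n - \<mu> n *\<^sub>R x n, cn n - \<mu> n) \<in> weighted_cone k" by metis
    define p where "p n = \<mu> n *\<^sub>R x n" for n
    have p0: "0 \<le> p n $ j" for n j using x[of n] \<mu>[of n] by (auto simp: p_def positive_points_iff less_imp_le)
    have pz: "p n $ j \<le> zn n $ j" for n j using weighted_cone_nonneg[OF rest[of n], of j] by (simp add: p_def)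
    have \<mu>c: "\<mu> n \<le> cn n" for n using weighted_cone_nonneg[OF rest[of n]] by simp
    obtain B where B: "\<And>n. norm (zn n) \<le> B" using convergent_imp_Bseq[OF convergentI[OF zl(1)]] by (auto simp: Bseq_def)
    obtain B' where B': "\<And>n. norm (cn n) \<le> B'" using convergent_imp_Bseq[OF convergentI[OF zl(2)]] by (auto simp: Bseq_def)
    have "norm (p n) \<le> B" for n
    proof -
      have "norm (p n) \<le> norm (zn n)"
        using p0 pz by (intro norm_le_componentwise_cart) (metis abs_of_nonneg order_trans real_norm_def)
      then show ?thesis using B[of n] by linarith
    qed
    moreover have "norm (\<mu> n) \<le> B'" for n using B'[of n] \<mu>[of n] \<mu>c[of n] by simp
    ultimately have "norm (p n, \<mu> n) \<le> B + B'" for n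
      by (meson add_mono norm_Pair_le order_trans)
    then have "bounded (range (\<lambda>n. (p n, \<mu> n)))" by (intro boundedI) auto
    then obtain q r where r: "strict_mono r" "((\<lambda>n. (p n, \<mu> n)) \<circ> r) \<longlonglongrightarrow> q"
      using bounded_imp_convergent_subsequence by blast
    define P m where "P = fst q" and "m = snd q"
    have Pl: "(\<lambda>n. p (r n)) \<longlonglongrightarrow> P" "(\<lambda>n. \<mu> (r n)) \<longlonglongrightarrow> m"
      using tendsto_fst[OF r(2)] tendsto_snd[OF r(2)] by (auto simp: o_def P_def m_def)
    have zr: "(\<lambda>n. zn (r n)) \<longlonglongrightarrow> z" "(\<lambda>n. cn (r n)) \<longlonglongrightarrow> c"
      using LIMSEQ_subseq_LIMSEQ[OF zl(1) r(1)] LIMSEQ_subseq_LIMSEQ[OF zl(2) r(1)] by (auto simp: o_def)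
    have "(\<lambda>n. (zn (r n) - p (r n), cn (r n) - \<mu> (r n))) \<longlonglongrightarrow> (z - P, c - m)"
      by (intro tendsto_Pair tendsto_diff Pl zr)
    then have lim: "(z - P, c - m) \<in> weighted_cone k"
      by (rule closed_sequentially[OF Suc.IH, rotated]) (use rest in \<open>simp add: p_def\<close>)
    have m0: "0 \<le> m" using Pl(2) \<mu> by (intro LIMSEQ_le_const) auto
    have "(z, c) \<in> weighted_cone (Suc k)"
    proof (cases "m = 0")
      \<comment> \<open>The points may escape to infinity while their weight tends to 0. The mass P
        left behind is nonnegative and is absorbed because \<open>weighted_cone\<close> asks only
        for an inequality in each coordinate.\<close>
      case True
      obtain y where y: "y \<in> positive_points" by (rule positive_points_nonempty)
      have "0 \<le> P $ j" for j
        using tendsto_vec_nth[OF Pl(1), of j] p0 by (intro LIMSEQ_le_const) auto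
      then have "(z, c) \<in> weighted_cone k" using weighted_cone_upward[OF lim, of z] True by simp
      then show ?thesis unfolding weighted_cone_Suc using y by (intro bexI[of _ y] exI[of _ 0]) auto
    next
      case False
      then have m: "0 < m" using m0 by simp
      have "(\<lambda>n. inverse (\<mu> (r n)) *\<^sub>R p (r n)) \<longlonglongrightarrow> inverse m *\<^sub>R P"
        using m by (intro tendsto_scaleR tendsto_inverse Pl) auto
      moreover have "eventually (\<lambda>n. inverse (\<mu> (r n)) *\<^sub>R p (r n) = x (r n)) sequentially"
        using order_tendstoD(1)[OF Pl(2) m] by eventually_elim (simp add: p_def)
      ultimately have xl: "(\<lambda>n. x (r n)) \<longlonglongrightarrow> inverse m *\<^sub>R P"
        by (rule Lim_transform_eventually)
      then obtain b where b: "\<And>n. norm (x (r n)) \<le> b"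
        using convergent_imp_Bseq[OF convergentI[OF xl]] by (auto simp: Bseq_def)
      let ?S = "{y \<in> L. \<forall>i. \<bar>y $ i\<bar> \<le> b} \<inter> positive_points"
      have "\<bar>x (r n) $ i\<bar> \<le> b" for n i
        using component_le_norm_cart[of "x (r n)" i] b[of n] by linarith
      then have "x (r n) \<in> ?S" for n using x[of "r n"] by (simp add: positive_points_iff)
      moreover have "closed ?S" by (intro finite_imp_closed finite_Int disjI1 finite_bounded)
      ultimately have "inverse m *\<^sub>R P \<in> ?S" by (intro closed_sequentially[OF _ _ xl])
      then show ?thesis unfolding weighted_cone_Suc
        using m lim by (intro bexI[of _ "inverse m *\<^sub>R P"] exI[of _ m]) auto
    qed
    then show "l \<in> weighted_cone (Suc k)" by (simp add: z_def c_def)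
  qed
qed

lemma weighted_cone_mono: "k \<le> l \<Longrightarrow> weighted_cone k \<subseteq> weighted_cone l"
proof (induction rule: dec_induct)
  case (step m)
  obtain y where y: "y \<in> positive_points" by (rule positive_points_nonempty)
  have "p \<in> weighted_cone (Suc m)" if "p \<in> weighted_cone m" for p
  proof (cases p)
    case (Pair z c)
    show ?thesis unfolding Pair weighted_cone_Suc
      using y that Pair by (intro bexI[of _ y] exI[of _ 0]) auto
  qed
  with step show ?case by blast
qed simp

text \<open>Caratheodory bounds the number of summands, and the inequality in
  \<open>weighted_cone\<close> is harmless since K is closed under increasing coordinates.\<close>

lemma K_iff_weighted_cone: "z \<in> K \<longleftrightarrow> (z, 1) \<in> weighted_cone (DIM(real^'n) + 1)"
proof
  assume "z \<in> K"
  then obtain S u where S: "finite S" "S \<subseteq> positive_points" "card S \<le> DIM(real^'n) + 1"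
    "\<forall>x\<in>S. 0 \<le> u x" "sum u S = 1" "(\<Sum>v\<in>S. u v *\<^sub>R v) = z"
    unfolding K_eq convex_hull_caratheodory by auto
  obtain h where h: "bij_betw h {..<card S} S"
    using ex_bij_betw_nat_finite[OF S(1)] by (auto simp: atLeast0LessThan)
  have 1: "(\<Sum>i<card S. u (h i)) = 1" using S(5) sum.reindex_bij_betw[OF h, of u] by simp
  have 2: "(\<Sum>i<card S. u (h i) * h i $ j) = z $ j" for j
    using S(6) sum.reindex_bij_betw[OF h, of "\<lambda>v. u v * v $ j"] by (auto simp: vec_eq_iff)
  have "(z, 1) \<in> weighted_cone (card S)"
    unfolding weighted_cone_def using S h 1 2
    by (intro CollectI case_prodI exI[of _ h] exI[of _ "u \<circ> h"]) (auto simp: bij_betw_def)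
  then show "(z, 1) \<in> weighted_cone (DIM(real^'n) + 1)" using weighted_cone_mono S(3) by blast
next
  assume "(z, 1) \<in> weighted_cone (DIM(real^'n) + 1)"
  then obtain x \<mu> where *: "\<forall>i<DIM(real^'n) + 1. x i \<in> positive_points \<and> 0 \<le> \<mu> i"
    "1 = (\<Sum>i<DIM(real^'n) + 1. \<mu> i)" "\<forall>j. (\<Sum>i<DIM(real^'n) + 1. \<mu> i * x i $ j) \<le> z $ j"
    unfolding weighted_cone_def by auto
  have "(\<Sum>i<DIM(real^'n) + 1. \<mu> i *\<^sub>R x i) \<in> K"
    using * positive_points_subset_K by (intro convex_sum convex_K) auto
  then show "z \<in> K" by (rule K_upward) (use *(3) in simp)
qed

lemma closed_K: "closed K"
proof -
  have "K = (\<lambda>z. (z, 1)) -` weighted_cone (DIM(real^'n) + 1)" using K_iff_weighted_cone by auto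
  moreover have "closed ((\<lambda>z::real^'n. (z, 1::real)) -` weighted_cone (DIM(real^'n) + 1))"
    by (intro closed_vimage closed_weighted_cone continuous_intros)
  ultimately show ?thesis by simp
qed

lemma interior_K: "interior K \<noteq> {}"
proof -
  obtain x where x: "x \<in> positive_points" by (rule positive_points_nonempty)
  let ?U = "\<Inter>i. {w::real^'n. x $ i < w $ i}"
  have "open ?U" by (intro open_INT ballI open_Collect_less continuous_intros) auto
  moreover have "?U \<subseteq> K"
    using K_upward[of x] x positive_points_subset_K by (auto simp: less_imp_le)
  ultimately have "?U \<subseteq> interior K" by (simp add: interior_maximal)
  moreover have "(\<chi> i. x $ i + 1) \<in> ?U" by simp
  ultimately show ?thesis by blast
qed

lemma aff_dim_K: "aff_dim K = int CARD('n)"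
  using aff_dim_nonempty_interior[OF interior_K] by simp

end

section \<open>Facets and vertices\<close>

context irrational_unimodular_lattice
begin

text \<open>The directions with an admissible positive step form a convex cone: two steps are shrunk
  to a common length and averaged. The bound \<open>\<epsilon> \<le> 1\<close> is kept so that the
  stepped point is a convex combination of x and x + c.\<close>

lemma tangent_direction:
  assumes x: "x \<in> positive_points" and c: "c \<in> convex_cone hull ((\<lambda>y. y - x) ` positive_points)"
  shows "\<exists>\<epsilon>>0. \<epsilon> \<le> 1 \<and> x + \<epsilon> *\<^sub>R c \<in> K"
proof -
  have xK: "x \<in> K" using x positive_points_subset_K by blast
  define W where "W = {c. \<exists>\<epsilon>>0. \<epsilon> \<le> 1 \<and> x + \<epsilon> *\<^sub>R c \<in> K}"
  have shrink: "x + \<delta> *\<^sub>R c \<in> K" if "x + \<epsilon> *\<^sub>R c \<in> K" "0 < \<delta>" "\<delta> \<le> \<epsilon>" for \<epsilon> \<delta> c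
  proof -
    have "(1 - \<delta> / \<epsilon>) *\<^sub>R x + (\<delta> / \<epsilon>) *\<^sub>R (x + \<epsilon> *\<^sub>R c) \<in> K"
      by (rule convexD[OF convex_K xK that(1)]) (use that in auto)
    moreover have "(1 - \<delta> / \<epsilon>) *\<^sub>R x + (\<delta> / \<epsilon>) *\<^sub>R (x + \<epsilon> *\<^sub>R c) = x + \<delta> *\<^sub>R c"
      using that by (simp add: algebra_simps)
    ultimately show ?thesis by simp
  qed
  have "convex_cone W"
    unfolding convex_cone_iff
  proof (intro conjI ballI allI impI)
    show "0 \<in> W" unfolding W_def using xK by (auto intro!: exI[of _ 1])
  next
    fix c d assume "c \<in> W" "d \<in> W"
    then obtain \<epsilon> \<delta> where e: "0 < \<epsilon>" "\<epsilon> \<le> 1" "x + \<epsilon> *\<^sub>R c \<in> K" "0 < \<delta>" "\<delta> \<le> 1" "x + \<delta> *\<^sub>R d \<in> K"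
      unfolding W_def by blast
    define \<eta> where "\<eta> = min \<epsilon> \<delta>"
    have "(1/2) *\<^sub>R (x + \<eta> *\<^sub>R c) + (1/2) *\<^sub>R (x + \<eta> *\<^sub>R d) \<in> K"
      by (rule convexD[OF convex_K]) (use e in \<open>auto simp: \<eta>_def intro: shrink\<close>)
    moreover have "(1/2) *\<^sub>R (x + \<eta> *\<^sub>R c) + (1/2) *\<^sub>R (x + \<eta> *\<^sub>R d) = x + (\<eta> / 2) *\<^sub>R (c + d)"
      by (simp add: vec_eq_iff field_simps)
    ultimately have "x + (\<eta> / 2) *\<^sub>R (c + d) \<in> K" by simp
    moreover have "0 < \<eta> / 2" "\<eta> / 2 \<le> 1" using e by (auto simp: \<eta>_def)
    ultimately show "c + d \<in> W" unfolding W_def by blast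
  next
    fix c and k :: real assume "c \<in> W" "0 \<le> k"
    then obtain \<epsilon> where e: "0 < \<epsilon>" "\<epsilon> \<le> 1" "x + \<epsilon> *\<^sub>R c \<in> K" unfolding W_def by blast
    define \<eta> where "\<eta> = \<epsilon> / (1 + k)"
    have \<eta>: "0 < \<eta>" "\<eta> \<le> 1" using e \<open>0 \<le> k\<close> by (auto simp: \<eta>_def field_simps)
    have "x + \<eta> *\<^sub>R (k *\<^sub>R c) \<in> K"
    proof (cases "k = 0")
      case False
      have "\<eta> * k \<le> \<epsilon>" using e \<open>0 \<le> k\<close> by (simp add: \<eta>_def field_simps)
      then have "x + (\<eta> * k) *\<^sub>R c \<in> K" using False \<open>0 \<le> k\<close> \<eta>(1) by (intro shrink[OF e(3)]) auto
      then show ?thesis by simp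
    qed (use xK in simp)
    with \<eta> show "k *\<^sub>R c \<in> W" unfolding W_def by blast
  qed
  moreover have "(\<lambda>y. y - x) ` positive_points \<subseteq> W"
    unfolding W_def using positive_points_subset_K by (auto intro!: exI[of _ 1])
  ultimately have "convex_cone hull ((\<lambda>y. y - x) ` positive_points) \<subseteq> W" by (simp add: hull_minimal)
  then show ?thesis using c unfolding W_def by blast
qed

text \<open>C is x plus the tangent cone, a polyhedron since the cone is finitely generated. Its
  facets through x are those of K, so polyhedral theory becomes available at every lattice point of
  K.\<close>

lemma local_polyhedron:
  assumes x: "x \<in> positive_points"
  obtains C where "polyhedron C" "K \<subseteq> C" "\<And>p. p \<in> C \<Longrightarrow> \<exists>\<epsilon>>0. \<epsilon> \<le> 1 \<and> x + \<epsilon> *\<^sub>R (p - x) \<in> K"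
proof -
  obtain Y where Y: "finite Y" "Y \<subseteq> positive_points"
    "\<And>y. y \<in> positive_points \<Longrightarrow> y - x \<in> convex_cone hull ((\<lambda>y. y - x) ` Y)"
    using tangent_cone_finite[OF x] by blast
  define T where "T = convex_cone hull ((\<lambda>y. y - x) ` Y)"
  define C where "C = (+) x ` T"
  have xK: "x \<in> K" using x positive_points_subset_K by blast
  have "polyhedron C" unfolding C_def T_def
    using Y(1) by (intro polyhedron_translation polyhedron_convex_cone_hull) simp
  moreover have "K \<subseteq> C"
    unfolding K_eq
  proof (rule hull_minimal)
    show "positive_points \<subseteq> C"
    proof
      fix y assume "y \<in> positive_points"
      then show "y \<in> C" using Y(3) unfolding C_def T_def by (intro image_eqI[of _ _ "y - x"]) auto
    qed
    show "convex C" unfolding C_def T_def by (intro convex_translation convex_convex_cone_hull)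
  qed
  moreover have "\<exists>\<epsilon>>0. \<epsilon> \<le> 1 \<and> x + \<epsilon> *\<^sub>R (p - x) \<in> K" if p: "p \<in> C" for p
  proof -
    have "T \<subseteq> convex_cone hull ((\<lambda>y. y - x) ` positive_points)"
      unfolding T_def using Y(2) by (intro hull_mono image_mono)
    then show ?thesis using p unfolding C_def by (auto intro!: tangent_direction[OF x])
  qed
  ultimately show ?thesis using that by blast
qed

text \<open>Cutting F down to K loses no dimension: any p in F can be pulled towards x into K,
  staying in F, and p lies on the line through x and the pulled point.\<close>

lemma facet_of_local_polyhedron:
  assumes x: "x \<in> positive_points" and C: "K \<subseteq> C" "\<And>p. p \<in> C \<Longrightarrow> \<exists>\<epsilon>>0. \<epsilon> \<le> 1 \<and> x + \<epsilon> *\<^sub>R (p - x) \<in> K"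
    and F: "F facet_of C" "x \<in> F"
  shows "(F \<inter> K) facet_of K"
proof -
  have face: "F face_of C" using F(1) by (simp add: facet_of_def)
  have cF: "convex F" using face_of_imp_convex[OF face] .
  have "(F \<inter> K) face_of (C \<inter> K)" using face_of_slice[OF face convex_K] .
  then have fK: "(F \<inter> K) face_of K" using C(1) by (simp add: Int_absorb1)
  have "F \<subseteq> affine hull (F \<inter> K)"
  proof
    fix p assume p: "p \<in> F"
    then have "p \<in> C" using face_of_imp_subset[OF face] by blast
    then obtain \<epsilon> where e: "0 < \<epsilon>" "\<epsilon> \<le> 1" "x + \<epsilon> *\<^sub>R (p - x) \<in> K" using C(2) by blast
    have xe: "x + \<epsilon> *\<^sub>R (p - x) = (1 - \<epsilon>) *\<^sub>R x + \<epsilon> *\<^sub>R p" by (simp add: algebra_simps)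
    then have "x + \<epsilon> *\<^sub>R (p - x) \<in> F"
      using e by (simp only: xe) (rule convexD[OF cF F(2) p], auto)
    then have "x + \<epsilon> *\<^sub>R (p - x) \<in> affine hull (F \<inter> K)" using e(3) by (intro hull_inc) simp
    moreover have "x \<in> affine hull (F \<inter> K)" using F(2) x positive_points_subset_K by (intro hull_inc) auto
    ultimately have "(1 - 1 / \<epsilon>) *\<^sub>R x + (1 / \<epsilon>) *\<^sub>R (x + \<epsilon> *\<^sub>R (p - x)) \<in> affine hull (F \<inter> K)"
      by (intro mem_affine[OF affine_affine_hull]) auto
    then show "p \<in> affine hull (F \<inter> K)" using e(1) by (simp add: algebra_simps)
  qed
  then have "aff_dim F \<le> aff_dim (F \<inter> K)" by (metis aff_dim_affine_hull aff_dim_subset)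
  then have "aff_dim (F \<inter> K) = aff_dim F" using aff_dim_subset[of "F \<inter> K" F] by simp
  moreover have "aff_dim C = aff_dim K"
    using aff_dim_subset[OF C(1)] aff_dim_le_DIM[of C] aff_dim_K by simp
  ultimately show ?thesis using F fK x positive_points_subset_K unfolding facet_of_def by auto
qed

lemma K_not_in_hyperplane:
  assumes "b \<noteq> 0"
  obtains w where "w \<in> K" "b \<bullet> w \<noteq> c"
proof -
  obtain x where x: "x \<in> K" using positive_points_nonempty positive_points_subset_K by blast
  obtain i where i: "b $ i \<noteq> 0" using assms by (auto simp: vec_eq_iff)
  have "x + 1 *\<^sub>R indicator_vec {i} \<in> K" by (rule K_add_axis[OF x]) simp
  moreover have "b \<bullet> indicator_vec {i} = b $ i"
    by (simp add: inner_vec_def indicator_vec_def if_distrib[of "\<lambda>x. _ * x"] cong: if_cong)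
  then have "b \<bullet> (x + 1 *\<^sub>R indicator_vec {i}) \<noteq> b \<bullet> x" using i by (simp add: inner_add_right)
  ultimately show ?thesis using that x by metis
qed

text \<open>The inequality for b extends from lattice points to K and, by pulling points towards x,
  to the local polyhedron C. There the exposed face lies in a facet, since C is a
  polyhedron.\<close>

lemma facet_through:
  assumes x: "x \<in> positive_points" and b: "b \<noteq> 0" "\<And>y. y \<in> positive_points \<Longrightarrow> b \<bullet> x \<le> b \<bullet> y"
  obtains F where "F facet_of K" "\<And>y. y \<in> K \<Longrightarrow> b \<bullet> y = b \<bullet> x \<Longrightarrow> y \<in> F"
proof -
  obtain C where C: "polyhedron C" "K \<subseteq> C" "\<And>p. p \<in> C \<Longrightarrow> \<exists>\<epsilon>>0. \<epsilon> \<le> 1 \<and> x + \<epsilon> *\<^sub>R (p - x) \<in> K"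
    using local_polyhedron[OF x] by blast
  have bK: "b \<bullet> x \<le> b \<bullet> y" if "y \<in> K" for y
    using that b(2) unfolding K_eq by (rule convex_hull_inner_le)
  have bC: "b \<bullet> x \<le> b \<bullet> p" if p: "p \<in> C" for p
  proof -
    obtain \<epsilon> where e: "0 < \<epsilon>" "x + \<epsilon> *\<^sub>R (p - x) \<in> K" using C(3)[OF p] by blast
    have "0 \<le> \<epsilon> * (b \<bullet> p - b \<bullet> x)" using bK[OF e(2)] by (simp add: inner_add_right inner_diff_right)
    then show ?thesis using e(1) by (simp add: zero_le_mult_iff)
  qed
  define G where "G = C \<inter> {y. b \<bullet> y = b \<bullet> x}"
  have "G face_of C" unfolding G_def
    by (rule face_of_Int_supporting_hyperplane_ge) (use bC polyhedron_imp_convex[OF C(1)] in auto)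
  moreover have xG: "x \<in> G" using x C(2) positive_points_subset_K by (auto simp: G_def)
  moreover have "G \<noteq> C"
    using K_not_in_hyperplane[OF b(1), of "b \<bullet> x"] C(2) unfolding G_def by blast
  ultimately obtain F where F: "F facet_of C" "G \<subseteq> F"
    using face_of_polyhedron_subset_facet[OF C(1)] by blast
  have "(F \<inter> K) facet_of K"
    using F xG by (intro facet_of_local_polyhedron[OF x C(2,3)]) auto
  moreover have "y \<in> F \<inter> K" if "y \<in> K" "b \<bullet> y = b \<bullet> x" for y
    using that C(2) F(2) by (auto simp: G_def)
  ultimately show ?thesis using that by blast
qed

text \<open>The vertex v remains extreme in the local polyhedron C, because a segment of C around v
  can be shortened at both ends into K. In a polyhedron, \<open>{v}\<close> is the intersection of
  the facets through it, so one of them misses y.\<close>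

lemma facet_avoiding:
  assumes v: "{v} face_of K" and y: "y \<in> K" "y \<noteq> v"
  obtains F where "F facet_of K" "v \<in> F" "y \<notin> F"
proof -
  have vA: "v \<in> positive_points"
    using v extreme_point_of_convex_hull unfolding face_of_singleton K_eq by blast
  have ext: "v \<in> K" "\<And>a b. a \<in> K \<Longrightarrow> b \<in> K \<Longrightarrow> v \<notin> open_segment a b"
    using v unfolding face_of_singleton extreme_point_of_def by auto
  obtain C where C: "polyhedron C" "K \<subseteq> C" "\<And>p. p \<in> C \<Longrightarrow> \<exists>\<epsilon>>0. \<epsilon> \<le> 1 \<and> v + \<epsilon> *\<^sub>R (p - v) \<in> K"
    using local_polyhedron[OF vA] by blast
  have "{v} face_of C"
    unfolding face_of_singleton extreme_point_of_def
  proof (intro conjI ballI notI)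
    show "v \<in> C" using C(2) ext(1) by blast
    fix a b assume ab: "a \<in> C" "b \<in> C" "v \<in> open_segment a b"
    then obtain u where u: "a \<noteq> b" "0 < u" "u < 1" "v = (1 - u) *\<^sub>R a + u *\<^sub>R b"
      unfolding in_segment by auto
    obtain \<epsilon> \<delta> where e: "0 < \<epsilon>" "v + \<epsilon> *\<^sub>R (a - v) \<in> K" "0 < \<delta>" "v + \<delta> *\<^sub>R (b - v) \<in> K"
      using C(3)[OF ab(1)] C(3)[OF ab(2)] by blast
    have d: "a - v = u *\<^sub>R (a - b)" "b - v = (1 - u) *\<^sub>R (b - a)"
      using u(4) by (auto simp: algebra_simps)
    define p q where "p = v + \<epsilon> *\<^sub>R (a - v)" and "q = v + \<delta> *\<^sub>R (b - v)"
    define s t where "s = \<epsilon> * u" and "t = \<delta> * (1 - u)"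
    have st: "0 < s" "0 < t" using e u by (auto simp: s_def t_def)
    have pq: "p = v + s *\<^sub>R (a - b)" "q = v - t *\<^sub>R (a - b)"
      unfolding p_def q_def d s_def t_def by (auto simp: algebra_simps)
    have "p \<noteq> q"
    proof
      assume "p = q"
      then have "(s + t) *\<^sub>R (a - b) = 0" unfolding pq by (simp add: algebra_simps)
      then show False using st u(1) by simp
    qed
    moreover have "v = (1 - s / (s + t)) *\<^sub>R p + (s / (s + t)) *\<^sub>R q"
    proof -
      have "(1 - s / (s + t)) *\<^sub>R p + (s / (s + t)) *\<^sub>R q
        = v + ((1 - s / (s + t)) * s - s / (s + t) * t) *\<^sub>R (a - b)"
        unfolding pq by (simp add: algebra_simps)
      also have "(1 - s / (s + t)) * s - s / (s + t) * t = 0" using st by (simp add: field_simps)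
      finally show ?thesis by simp
    qed
    ultimately have "v \<in> open_segment p q"
      unfolding in_segment using st by (intro conjI exI[of _ "s / (s + t)"]) auto
    then show False using ext(2) e unfolding p_def q_def by blast
  qed
  moreover have "{v} \<noteq> C" using y C(2) by blast
  ultimately have "{v} = \<Inter>{F. F facet_of C \<and> {v} \<subseteq> F}"
    using face_of_polyhedron[OF C(1)] by blast
  then obtain F where F: "F facet_of C" "v \<in> F" "y \<notin> F" using y(2) by blast
  have "(F \<inter> K) facet_of K"
    using F by (intro facet_of_local_polyhedron[OF vA C(2,3)]) auto
  then show ?thesis using that F ext(1) by blast
qed

text \<open>The point 2 x is interior to the segment from x to k x, which puts all larger multiples
  of x into G. Every p of the lattice in the orthant is then an endpoint of a segment with midpoint
  N x. A proper face therefore cannot contain both x and 2 x.\<close>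

lemma face_with_double_point:
  assumes G: "G face_of K" and x: "x \<in> positive_points" "x \<in> G" "2 *\<^sub>R x \<in> G"
  shows "G = K"
proof -
  have xpos: "x \<in> L" "\<And>i. 0 < x $ i" using x(1) by (auto simp: positive_points_iff)
  have mult: "real k *\<^sub>R x \<in> G" if "2 < k" for k
  proof -
    have "2 *\<^sub>R x \<in> open_segment x (real k *\<^sub>R x)"
    proof -
      have "x \<noteq> real k *\<^sub>R x"
        using that xpos(2)[of undefined] by (auto simp: vec_eq_iff intro!: exI[of _ undefined])
      moreover have "2 *\<^sub>R x = (1 - 1 / (real k - 1)) *\<^sub>R x + (1 / (real k - 1)) *\<^sub>R (real k *\<^sub>R x)"
      proof -
        define d where "d = real k - 1"
        have d: "real k = d + 1" "0 < d" using that by (auto simp: d_def)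
        have "(1 - 1 / d) + (1 / d) * (d + 1) = 2" using d(2) by (simp add: field_simps)
        then have "(1 - 1 / (real k - 1)) + (1 / (real k - 1)) * real k = 2" using d by simp
        then show ?thesis by (metis scaleR_left_distrib scaleR_scaleR)
      qed
      ultimately show ?thesis unfolding in_segment
        using that by (intro conjI exI[of _ "1 / (real k - 1)"]) auto
    qed
    moreover have "real k *\<^sub>R x \<in> K"
      using positive_points_scale[OF x(1), of k] that positive_points_subset_K by auto
    ultimately show ?thesis using G x(3) positive_points_subset_K x(1) unfolding face_of_def by blast
  qed
  have "positive_points \<subseteq> G"
  proof
    fix p assume p: "p \<in> positive_points"
    \<comment> \<open>N x exceeds p in every coordinate, hence 2 N x - p is still positive; the
      summand 3 also makes N larger than 2, as \<open>mult\<close> requires.\<close>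
    define N where "N = nat \<lceil>\<Sum>i\<in>UNIV. p $ i / x $ i\<rceil> + 3"
    have "p $ i < real N * x $ i" for i
    proof -
      have "p $ i / x $ i \<le> (\<Sum>i\<in>UNIV. p $ i / x $ i)"
        using p xpos by (intro member_le_sum[of i UNIV "\<lambda>i. p $ i / x $ i"]) (auto simp: positive_points_iff less_imp_le)
      also have "\<dots> < real N" unfolding N_def by linarith
      finally show ?thesis using xpos(2)[of i] by (simp add: field_simps)
    qed
    note pN = this
    have "0 < ((2 * real N) *\<^sub>R x - p) $ i" for i
    proof -
      have "0 < real N * x $ i" using xpos(2)[of i] by (simp add: N_def)
      with pN[of i] show ?thesis by simp
    qed
    moreover have "(2 * real N) *\<^sub>R x - p \<in> L"
      using p of_nat_scaleR_in[OF xpos(1), of "2 * N"] diff_in by (simp add: positive_points_iff)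
    ultimately have q: "(2 * real N) *\<^sub>R x - p \<in> positive_points"
      by (simp add: positive_points_iff)
    have mid: "real N *\<^sub>R x = (1/2) *\<^sub>R p + (1/2) *\<^sub>R ((2 * real N) *\<^sub>R x - p)" by (simp add: algebra_simps)
    have N: "real N *\<^sub>R x \<in> G" by (rule mult) (simp add: N_def)
    show "p \<in> G"
    proof (cases "p = (2 * real N) *\<^sub>R x - p")
      case True
      then have "real N *\<^sub>R x = (1/2) *\<^sub>R p + (1/2) *\<^sub>R p" using mid by metis
      then have "real N *\<^sub>R x = p" by (simp flip: scaleR_left_distrib)
      then show ?thesis using N by simp
    next
      case False
      then have "real N *\<^sub>R x \<in> open_segment p ((2 * real N) *\<^sub>R x - p)"
        unfolding in_segment using mid by (intro conjI exI[of _ "1/2"]) auto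
      then show ?thesis using G N p q positive_points_subset_K unfolding face_of_def by blast
    qed
  qed
  then have "K \<subseteq> G" unfolding K_eq using face_of_imp_convex[OF G] by (simp add: hull_minimal)
  then show ?thesis using face_of_imp_subset[OF G] by blast
qed

end

section \<open>Faces as hulls of their vertices, normals of facets\<close>

context irrational_unimodular_lattice
begin

lemma mixed_sign_vector:
  obtains u i j where "u \<in> L" "0 < u $ i" "u $ j < 0"
proof -
  obtain C where C: "0 < C" "\<And>p. \<exists>x\<in>L. \<forall>i. \<bar>x $ i - p $ i\<bar> \<le> C"
    using lattice_cover by blast
  obtain i j :: 'n where ij: "i \<noteq> j"
    using two_le_dim by (metis card_1_singleton_iff card_le_Suc0_iff_eq UNIV_I finite_code not_less_eq_eq numeral_2_eq_2)
  obtain x where x: "x \<in> L" "\<forall>k. \<bar>x $ k - (\<chi> k. if k = i then C + 1 else - (C + 1)) $ k\<bar> \<le> C" using C(2) by blast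
  have "0 < x $ i" "x $ j < 0" using x(2)[rule_format, of i] x(2)[rule_format, of j] ij by auto
  then show ?thesis using that x(1) by blast
qed

text \<open>A line of mixed-sign direction meets the orthant in a bounded segment, which replaces
  compactness of the face. Two lattice points of G provide such a direction unless their difference
  lies in the orthant; in that case G is all of K and every direction is available.\<close>

lemma face_direction:
  assumes G: "G face_of K" and two: "\<And>z. G \<noteq> {z}" and ne: "z \<in> G"
  obtains u i j where "\<And>s. z + s *\<^sub>R u \<in> affine hull G" "0 < u $ i" "u $ j < 0"
proof -
  have hull: "G = convex hull (positive_points \<inter> G)"
    using face_of_convex_hull_eq G unfolding K_eq by blast
  have "\<not> (\<exists>p. positive_points \<inter> G \<subseteq> {p})"
  proof
    assume "\<exists>p. positive_points \<inter> G \<subseteq> {p}"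
    then obtain p where "positive_points \<inter> G \<subseteq> {p}" by blast
    then have "G \<subseteq> {p}" using hull by (metis convex_hull_singleton hull_mono)
    then show False using two[of p] ne by blast
  qed
  then obtain p q where pq: "p \<in> positive_points" "p \<in> G" "q \<in> positive_points" "q \<in> G" "p \<noteq> q" by blast
  have dir: "z + s *\<^sub>R (b - a) \<in> affine hull G" if "a \<in> affine hull G" "b \<in> affine hull G" for a b s
    using mem_affine_3_minus[OF affine_affine_hull hull_inc[OF ne] that(2,1), of s] .
  show ?thesis
  proof (cases "\<exists>i j. 0 < (q - p) $ i \<and> (q - p) $ j < 0")
    case True
    then show ?thesis using that dir[of p q] hull_inc[of _ G] pq by blast
  next
    case False
    have d: "q - p \<in> L" "p - q \<in> L" "q - p \<noteq> 0" using pq by (auto simp: positive_points_iff diff_in)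
    then have nz: "(q - p) $ i \<noteq> 0" for i using coord_nonzero by blast
    \<comment> \<open>The point q is the midpoint of 2 p and 2 (q - p), both in K, so 2 p belongs to
      the face along with p.\<close>
    have GK: "G = K" if p: "p \<in> positive_points" "p \<in> G" and q: "q \<in> G" and u: "q - p \<in> positive_points" for p q
    proof -
      have 2: "2 *\<^sub>R p \<in> K" "2 *\<^sub>R (q - p) \<in> K"
        using positive_points_scale[OF p(1), of 2] positive_points_scale[OF u, of 2] positive_points_subset_K by auto
      have mid: "q = (1/2) *\<^sub>R (2 *\<^sub>R p) + (1/2) *\<^sub>R (2 *\<^sub>R (q - p))" by simp
      have "2 *\<^sub>R p \<in> G"
      proof (cases "2 *\<^sub>R p = 2 *\<^sub>R (q - p)")
        case True
        then have "p = q - p" by (metis scaleR_cancel_left zero_neq_numeral)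
        then have "2 *\<^sub>R p = q" by (metis scaleR_2 diff_add_cancel)
        then show ?thesis using q by simp
      next
        case False
        then have "q \<in> open_segment (2 *\<^sub>R p) (2 *\<^sub>R (q - p))"
          unfolding in_segment using mid by (intro conjI exI[of _ "1/2"]) auto
        then show ?thesis using G q 2 unfolding face_of_def by blast
      qed
      then show ?thesis using face_with_double_point[OF G p] by simp
    qed
    have "q - p \<in> positive_points \<or> p - q \<in> positive_points"
    proof (rule ccontr)
      assume neg: "\<not> (q - p \<in> positive_points \<or> p - q \<in> positive_points)"
      obtain i where i: "\<not> 0 < (q - p) $ i" using neg d(1) unfolding positive_points_iff by blast
      obtain j where j: "\<not> 0 < (p - q) $ j" using neg d(2) unfolding positive_points_iff by blast
      from i j have "(q - p) $ i < 0" "0 < (q - p) $ j" using nz[of i] nz[of j] by auto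
      then show False using False by blast
    qed
    then have "G = K" using GK[OF pq(1,2,4)] GK[OF pq(3,4,2)] by blast
    then have aff: "affine hull G = UNIV" using affine_hull_nonempty_interior[OF interior_K] by simp
    obtain u i j where "u \<in> L" "0 < u $ i" "u $ j < 0" by (rule mixed_sign_vector)
    then show ?thesis using that[of u i j] aff by simp
  qed
qed

text \<open>Induction on the dimension. A relative boundary point lies in a face of smaller
  dimension. A relative interior point lies on a segment of mixed-sign direction whose two ends,
  being extremal in G, are relative boundary points.\<close>

lemma face_subset_hull_vertices:
  assumes "G face_of K"
  shows "G \<subseteq> convex hull {v. {v} face_of K}"
  using assms
proof (induction "nat (aff_dim G + 1)" arbitrary: G rule: less_induct)
  case (less G)
  let ?V = "convex hull {v. {v} face_of K}"
  have cG: "convex G" using face_of_imp_convex[OF less.prems] .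
  have clG: "closed G" using face_of_imp_closed[OF convex_K closed_K less.prems] .
  have boundary: "z \<in> ?V" if z: "z \<in> G" "z \<notin> rel_interior G" for z
  proof -
    obtain a where a: "a \<noteq> 0" "\<And>y. y \<in> G \<Longrightarrow> a \<bullet> z \<le> a \<bullet> y" "\<And>y. y \<in> rel_interior G \<Longrightarrow> a \<bullet> z < a \<bullet> y"
      using supporting_hyperplane_rel_boundary[OF cG z] by blast
    define H where "H = G \<inter> {y. a \<bullet> y = a \<bullet> z}"
    have H: "H face_of G" unfolding H_def
      by (rule face_of_Int_supporting_hyperplane_ge[OF cG]) (use a in auto)
    have "rel_interior G \<noteq> {}" using rel_interior_eq_empty[OF cG] z by blast
    then obtain y where y: "y \<in> rel_interior G" by blast
    then have "y \<in> G" "a \<bullet> y \<noteq> a \<bullet> z" using a(3)[OF y] rel_interior_subset[of G] by auto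
    then have "H \<noteq> G" unfolding H_def by blast
    then have "aff_dim H < aff_dim G" using face_of_aff_dim_lt[OF cG H] by blast
    then have "nat (aff_dim H + 1) < nat (aff_dim G + 1)" using aff_dim_geq[of H] by simp
    then have "H \<subseteq> ?V" using face_of_trans[OF H less.prems] by (rule less.hyps)
    then show ?thesis using z by (auto simp: H_def)
  qed
  show ?case
  proof
    fix z assume z: "z \<in> G"
    show "z \<in> ?V"
    proof (cases "z \<in> rel_interior G \<and> (\<forall>p. G \<noteq> {p})")
      case False
      show ?thesis
      proof (cases "\<exists>p. G = {p}")
        case True
        then have "G = {z}" using z by auto
        then show ?thesis using less.prems by (intro hull_inc) simp
      next
        case False
        then show ?thesis using \<open>\<not> (z \<in> rel_interior G \<and> (\<forall>p. G \<noteq> {p}))\<close> boundary z by blast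
      qed
    next
      case True
      then have ns: "G \<noteq> {p}" for p by blast
      obtain u i j where u: "\<And>s. z + s *\<^sub>R u \<in> affine hull G" "0 < u $ i" "u $ j < 0"
        by (rule face_direction[OF less.prems ns z], rule that)
      define S where "S = {s. z + s *\<^sub>R u \<in> G}"
      have "closed S" unfolding S_def
        using closed_vimage[OF clG, of "\<lambda>s. z + s *\<^sub>R u"] by (simp add: vimage_def continuous_on_add continuous_on_scaleR)
      have Spos: "0 < z $ k + s * u $ k" if "s \<in> S" for s k
        using that K_pos[of "z + s *\<^sub>R u" k] face_of_imp_subset[OF less.prems] by (auto simp: S_def)
      have lo: "- (z $ i / u $ i) \<le> s" if "s \<in> S" for s
        using Spos[OF that, of i] u(2) by (simp add: field_simps)
      have up: "s \<le> z $ j / (- u $ j)" if "s \<in> S" for s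
        using Spos[OF that, of j] u(3) by (simp add: field_simps)
      have "bounded S" by (rule bounded_subset[OF bounded_closed_interval]) (use lo up in auto)
      then have "compact S" using \<open>closed S\<close> compact_eq_bounded_closed by blast
      have S0: "0 \<in> S" using z by (simp add: S_def)
      obtain s1 where s1: "s1 \<in> S" "\<And>s. s \<in> S \<Longrightarrow> s \<le> s1"
        using compact_attains_sup[OF \<open>compact S\<close>] S0 by blast
      obtain s2 where s2: "s2 \<in> S" "\<And>s. s \<in> S \<Longrightarrow> s2 \<le> s"
        using compact_attains_inf[OF \<open>compact S\<close>] S0 by blast
      have extend: "\<exists>e>0. s + e \<in> S \<and> s - e \<in> S" if "z + s *\<^sub>R u \<in> rel_interior G" for s
      proof -
        have "\<exists>e>0. cball (z + s *\<^sub>R u) e \<inter> affine hull G \<subseteq> G"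
          using that by (simp add: rel_interior_cball)
        then obtain e where e: "0 < e" "cball (z + s *\<^sub>R u) e \<inter> affine hull G \<subseteq> G"
          by (elim exE conjE)
        have un: "u \<noteq> 0" using u(2) by auto
        define d where "d = e / norm u"
        have d: "0 < d" "\<bar>d\<bar> * norm u = e" using e un by (auto simp: d_def)
        have near: "s + r \<in> S" if "\<bar>r\<bar> = d" for r
        proof -
          have "dist (z + s *\<^sub>R u) (z + (s + r) *\<^sub>R u) = norm (r *\<^sub>R u)"
            by (simp add: dist_norm scaleR_left_distrib)
          also have "\<dots> = e" using that d by simp
          finally have "z + (s + r) *\<^sub>R u \<in> cball (z + s *\<^sub>R u) e" by simp
          then have "z + (s + r) *\<^sub>R u \<in> G" by (intro subsetD[OF e(2)] IntI u(1))
          then show ?thesis by (simp add: S_def)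
        qed
        have "s + d \<in> S" "s + (- d) \<in> S" using near[of d] near[of "- d"] d(1) by simp_all
        then show ?thesis using d(1) by (intro exI[of _ d]) simp
      qed
      have V1: "z + s1 *\<^sub>R u \<in> ?V"
      proof (rule boundary)
        show "z + s1 *\<^sub>R u \<in> G" using s1(1) by (simp add: S_def)
        show "z + s1 *\<^sub>R u \<notin> rel_interior G"
        proof
          assume "z + s1 *\<^sub>R u \<in> rel_interior G"
          from extend[OF this] obtain e where "0 < e" "s1 + e \<in> S" by (elim exE conjE)
          then show False using s1(2)[of "s1 + e"] by simp
        qed
      qed
      have V2: "z + s2 *\<^sub>R u \<in> ?V"
      proof (rule boundary)
        show "z + s2 *\<^sub>R u \<in> G" using s2(1) by (simp add: S_def)
        show "z + s2 *\<^sub>R u \<notin> rel_interior G"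
        proof
          assume "z + s2 *\<^sub>R u \<in> rel_interior G"
          from extend[OF this] obtain e where "0 < e" "s2 - e \<in> S" by (elim exE conjE)
          then show False using s2(2)[of "s2 - e"] by simp
        qed
      qed
      have "z + 0 *\<^sub>R u \<in> rel_interior G" using True by simp
      from extend[OF this] obtain e where "e > 0" "0 + e \<in> S" "0 - e \<in> S" by (elim exE conjE)
      then have "s2 < 0" "0 < s1" using s1(2)[of "0 + e"] s2(2)[of "0 - e"] by simp_all
      define \<alpha> \<beta> where "\<alpha> = s1 / (s1 - s2)" and "\<beta> = - s2 / (s1 - s2)"
      have ne: "s1 - s2 > 0" using \<open>s2 < 0\<close> \<open>0 < s1\<close> by simp
      have "\<alpha> + \<beta> = (s1 + - s2) / (s1 - s2)"
        unfolding \<alpha>_def \<beta>_def by (rule add_divide_distrib[symmetric])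
      then have sum1: "\<alpha> + \<beta> = 1" using ne by simp
      have "\<alpha> * s2 = s1 * s2 / (s1 - s2)" "\<beta> * s1 = - (s1 * s2 / (s1 - s2))"
        by (simp_all add: \<alpha>_def \<beta>_def)
      then have sum0: "\<alpha> * s2 + \<beta> * s1 = 0" by simp
      have nonneg: "0 \<le> \<alpha>" "0 \<le> \<beta>" unfolding \<alpha>_def \<beta>_def using ne \<open>s2 < 0\<close> \<open>0 < s1\<close>
        by (auto intro!: divide_nonneg_pos divide_nonpos_pos)
      have "\<alpha> *\<^sub>R (z + s2 *\<^sub>R u) + \<beta> *\<^sub>R (z + s1 *\<^sub>R u) \<in> ?V"
        by (rule convexD[OF convex_convex_hull V2 V1 nonneg sum1])
      moreover have "\<alpha> *\<^sub>R (z + s2 *\<^sub>R u) + \<beta> *\<^sub>R (z + s1 *\<^sub>R u)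
        = (\<alpha> + \<beta>) *\<^sub>R z + (\<alpha> * s2 + \<beta> * s1) *\<^sub>R u"
        by (simp add: scaleR_right_distrib scaleR_left_distrib)
      ultimately show ?thesis unfolding sum1 sum0 by simp
    qed
  qed
qed

lemma vertices_face: "G face_of K \<Longrightarrow> vertices G = {v \<in> G. {v} face_of K}"
proof -
  assume "G face_of K"
  then have "{v} face_of G \<longleftrightarrow> v \<in> G \<and> {v} face_of K" for v
    using extreme_point_of_face[of G K v] unfolding face_of_singleton by argo
  then show ?thesis by (simp add: vertices_def)
qed

lemma vertex_in_positive_points: "{v} face_of K \<Longrightarrow> v \<in> positive_points"
  unfolding face_of_singleton K_eq by (rule extreme_point_of_convex_hull)

lemma face_eq_hull_vertices:
  assumes "G face_of K"
  shows "G = convex hull (vertices G)"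
proof -
  have "K = convex hull {v. {v} face_of K}"
  proof
    show "K \<subseteq> convex hull {v. {v} face_of K}"
      by (rule face_subset_hull_vertices[OF face_of_refl[OF convex_K]])
    have "{v. {v} face_of K} \<subseteq> K" by (auto dest: face_of_imp_subset)
    then show "convex hull {v. {v} face_of K} \<subseteq> K" using convex_K by (rule hull_minimal)
  qed
  then have "G face_of convex hull {v. {v} face_of K}" using assms by simp
  then have "G = convex hull ({v. {v} face_of K} \<inter> G)" by (rule face_of_convex_hull_eq)
  moreover have "{v. {v} face_of K} \<inter> G = vertices G" using vertices_face[OF assms] by auto
  ultimately show ?thesis by simp
qed

lemma facet_is_face: "F facet_of K \<Longrightarrow> F face_of K"
  by (simp add: facet_of_def)

lemma abs_det_le_facet_det:
  assumes F: "F face_of K" and g: "\<And>i. g i \<in> F"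
  shows "ennreal \<bar>det (\<chi> i. g i)\<bar> \<le> facet_det F"
proof (cases "facet_det F = \<infinity>")
  case False
  then obtain M where M: "facet_det F = ennreal M" "0 \<le> M" by (cases "facet_det F") auto
  have "\<bar>det (\<chi> i. f i)\<bar> \<le> M" if "range f \<subseteq> vertices F" for f
    using abs_det_le_det_sum[OF that] M by (simp add: facet_det_def)
  then have "\<bar>det (\<chi> i. g i)\<bar> \<le> M"
  proof (rule abs_det_convex_hull_le)
    show "g i \<in> convex hull (vertices F)" for i
      using g[of i] by (subst face_eq_hull_vertices[OF F, symmetric])
  qed
  then show ?thesis using M by simp
qed simp

lemma facet_det_bound:
  assumes "F face_of K" "\<And>i. g i \<in> F" "facet_det F \<le> ennreal D"
  shows "\<bar>det (\<chi> i. g i)\<bar> \<le> max D 0"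
proof -
  have "ennreal \<bar>det (\<chi> i. g i)\<bar> \<le> ennreal (max D 0)"
    using abs_det_le_facet_det[OF assms(1,2)] assms(3) ennreal_leI[of D "max D 0"]
    by (meson max.cobounded1 order_trans)
  then show ?thesis by simp
qed

text \<open>If the affine hull of F contained the origin, it would be a linear space and contain 2 x
  for a lattice point x of F, forcing F = K. So adjoining the origin raises the dimension to
  n.\<close>

lemma facet_points_span:
  assumes F: "F facet_of K"
  shows "span (positive_points \<inter> F) = UNIV"
proof -
  have face: "F face_of K" "F \<noteq> {}" "aff_dim F = int CARD('n) - 1"
    using F aff_dim_K by (auto simp: facet_of_def)
  have hull: "F = convex hull (positive_points \<inter> F)"
    using face_of_convex_hull_eq face(1) unfolding K_eq by blast
  have "positive_points \<inter> F \<noteq> {}"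
  proof
    assume "positive_points \<inter> F = {}"
    then have "F = convex hull {}" using hull by simp
    then show False using face(2) by simp
  qed
  then obtain x where x: "x \<in> positive_points" "x \<in> F" by blast
  have "0 \<notin> affine hull F"
  proof
    assume 0: "0 \<in> affine hull F"
    then have "affine hull F = span F" by (rule affine_hull_span_0)
    moreover have "2 *\<^sub>R x \<in> span F" using x(2) by (intro span_scale span_base)
    moreover have "2 *\<^sub>R x \<in> K" using positive_points_scale[OF x(1), of 2] positive_points_subset_K by auto
    ultimately have "2 *\<^sub>R x \<in> F" using face_of_imp_eq_affine_Int[OF convex_K face(1)] by blast
    then have "F = K" using face_with_double_point[OF face(1) x] by simp
    then show False using face(3) aff_dim_K by simp
  qed
  then have "aff_dim (insert 0 F) = int DIM(real^'n)" using aff_dim_insert[of 0 F] face(3) by simp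
  then have "affine hull (insert 0 F) = UNIV" using aff_dim_eq_full[of "insert 0 F"] by simp
  moreover have "affine hull (insert 0 F) \<subseteq> span F"
    using affine_hull_subset_span[of "insert 0 F"] by simp
  moreover have "F \<subseteq> span (positive_points \<inter> F)"
    using convex_hull_subset_span[of "positive_points \<inter> F"] hull by simp
  then have "span F \<subseteq> span (positive_points \<inter> F)" by (rule span_minimal[OF _ subspace_span])
  ultimately show ?thesis by blast
qed

text \<open>A hyperplane separating F from the interior of K supports K along F. Its value c is
  nonnegative since 2 x lies in K for x in F, and nonzero since F spans the space; it can thus be
  scaled to 1.\<close>

lemma facet_normal:
  assumes F: "F facet_of K"
  obtains b where "\<And>p. p \<in> F \<Longrightarrow> b \<bullet> p = 1" "\<And>p. p \<in> K \<Longrightarrow> 1 \<le> b \<bullet> p"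
proof -
  have face: "F face_of K" "F \<noteq> {}" "F \<noteq> K" using F aff_dim_K by (auto simp: facet_of_def)
  have "F \<inter> interior K = {}" using face_of_disjoint_interior face by blast
  then obtain a c where a: "a \<noteq> 0" "\<And>x. x \<in> F \<Longrightarrow> a \<bullet> x \<le> c" "\<And>x. x \<in> interior K \<Longrightarrow> c \<le> a \<bullet> x"
    using separating_hyperplane_sets[of F "interior K"] face interior_K face_of_imp_convex[OF face(1)] convex_interior[OF convex_K]
    by blast
  have "closure (interior K) \<subseteq> {x. c \<le> a \<bullet> x}"
    using a(3) by (intro closure_minimal closed_halfspace_ge) auto
  then have aK: "c \<le> a \<bullet> x" if "x \<in> K" for x
    using that convex_closure_interior[OF convex_K interior_K] closure_subset[of K] by auto
  then have aF: "a \<bullet> x = c" if "x \<in> F" for x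
    using a(2)[OF that] that face_of_imp_subset[OF face(1)] by (auto intro: antisym)
  obtain x where x: "x \<in> positive_points" "x \<in> F"
  proof -
    have "positive_points \<inter> F \<noteq> {}"
    proof
      assume "positive_points \<inter> F = {}"
      then have "a \<in> {0}" using facet_points_span[OF F] by simp
      then show False using a(1) by simp
    qed
    then show ?thesis using that by blast
  qed
  have "2 *\<^sub>R x \<in> K" using positive_points_scale[OF x(1), of 2] positive_points_subset_K by auto
  then have "0 \<le> c" using aK[of "2 *\<^sub>R x"] aF[OF x(2)] by simp
  moreover have "c \<noteq> 0"
  proof
    assume "c = 0"
    then have "positive_points \<inter> F \<subseteq> {x. a \<bullet> x = 0}" using aF by auto
    then have "span (positive_points \<inter> F) \<subseteq> {x. a \<bullet> x = 0}" by (intro span_minimal subspace_hyperplane)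
    then have "a \<in> {x. a \<bullet> x = 0}" unfolding facet_points_span[OF F] by blast
    then have "a \<bullet> a = 0" by simp
    then show False using a(1) by simp
  qed
  ultimately have c: "0 < c" by simp
  show ?thesis
  proof
    show "(inverse c *\<^sub>R a) \<bullet> p = 1" if "p \<in> F" for p using aF[OF that] c by simp
    show "1 \<le> (inverse c *\<^sub>R a) \<bullet> p" if "p \<in> K" for p using aK[OF that] c by (simp add: field_simps)
  qed
qed

text \<open>The exposed face of b is proper, so a strictly larger exposed face would leave F at
  least two dimensions below K.\<close>

lemma facet_normal_mem:
  assumes F: "F facet_of K" and b: "\<And>p. p \<in> F \<Longrightarrow> b \<bullet> p = 1" "\<And>p. p \<in> K \<Longrightarrow> 1 \<le> b \<bullet> p"
    and p: "p \<in> K" "b \<bullet> p = 1"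
  shows "p \<in> F"
proof (rule ccontr)
  assume "p \<notin> F"
  define G where "G = K \<inter> {y. b \<bullet> y = 1}"
  have G: "G face_of K" unfolding G_def
    by (rule face_of_Int_supporting_hyperplane_ge[OF convex_K]) (use b in auto)
  have "F \<subseteq> G" using b(1) face_of_imp_subset[OF facet_is_face[OF F]] by (auto simp: G_def)
  then have "F face_of G" using face_of_subset[OF facet_is_face[OF F]] face_of_imp_subset[OF G] by blast
  moreover have "F \<noteq> G" using p \<open>p \<notin> F\<close> by (auto simp: G_def)
  ultimately have "aff_dim F < aff_dim G" by (rule face_of_aff_dim_lt[OF face_of_imp_convex[OF G]])
  moreover have "b \<noteq> 0" using p(2) by auto
  then have "G \<noteq> K" using K_not_in_hyperplane[of b 1] by (auto simp: G_def)
  then have "aff_dim G < aff_dim K" by (rule face_of_aff_dim_lt[OF convex_K G])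
  ultimately show False using F by (simp add: facet_of_def)
qed

lemma facet_basis:
  assumes "F facet_of K"
  obtains g where "\<And>i. g i \<in> positive_points \<inter> F" "det (\<chi> i. g i) \<noteq> 0"
proof -
  obtain B where B: "B \<subseteq> positive_points \<inter> F" "independent B" "positive_points \<inter> F \<subseteq> span B"
    using maximal_independent_subset by blast
  then have "span B = UNIV"
    using facet_points_span[OF assms] span_minimal[OF B(3) subspace_span] by blast
  then obtain g where g: "bij_betw g (UNIV::'n set) B" "det (\<chi> i. g i) \<noteq> 0"
    by (rule enum_basis[OF B(2)])
  then have "g i \<in> positive_points \<inter> F" for i using B(1) by (auto simp: bij_betw_def)
  with g(2) that show ?thesis by blast
qed

text \<open>In a basis of lattice points of F, the value \<open>b \<bullet> y\<close> is the sum of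
  the coefficients of y. By Cramer's rule it is an integer divided by a determinant of size at most
  D.\<close>

lemma facet_normal_lattice_value:
  assumes F: "F facet_of K" "facet_det F \<le> ennreal D" and b: "\<And>p. p \<in> F \<Longrightarrow> b \<bullet> p = 1"
  shows "1 \<le> D" and "y \<in> L \<Longrightarrow> 0 < b \<bullet> y \<Longrightarrow> 1 / D \<le> b \<bullet> y"
proof -
  obtain g where g: "\<And>i. g i \<in> positive_points \<inter> F" "det (\<chi> i. g i) \<noteq> 0"
    using facet_basis[OF F(1)] by blast
  have gL: "g i \<in> L" for i using g(1) positive_points_iff by blast
  have ge: "1 \<le> \<bar>det (\<chi> i. g i)\<bar>" using abs_det_ge_1[of g] gL g(2) by blast
  have le: "\<bar>det (\<chi> i. g i)\<bar> \<le> max D 0"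
    using facet_det_bound[OF facet_is_face[OF F(1)] _ F(2), of g] g(1) by blast
  show D: "1 \<le> D" using ge le by linarith
  then have le: "\<bar>det (\<chi> i. g i)\<bar> \<le> D" using le by simp
  assume y: "y \<in> L" "0 < b \<bullet> y"
  obtain c where c: "y = (\<Sum>i\<in>UNIV. c i *\<^sub>R g i)" using det_nz_expand[OF g(2)] by blast
  have "b \<bullet> y = (\<Sum>i\<in>UNIV. c i)" unfolding c using b g(1) by (simp add: inner_sum_right)
  then have "(b \<bullet> y) * det (\<chi> i. g i) = (\<Sum>i\<in>UNIV. det (\<chi> j. (g(i := y)) j))"
    using det_replace_row[OF c] by (simp add: sum_distrib_right)
  also have "\<dots> \<in> \<int>" using gL y(1) by (intro Ints_sum det_integer) auto
  finally obtain k where k: "(b \<bullet> y) * det (\<chi> i. g i) = of_int k" by (auto elim: Ints_cases)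
  then have "k \<noteq> 0" using y(2) g(2) by auto
  then have "1 \<le> \<bar>(b \<bullet> y) * det (\<chi> i. g i)\<bar>" unfolding k by linarith
  then have "1 \<le> (b \<bullet> y) * \<bar>det (\<chi> i. g i)\<bar>" using y(2) by (simp add: abs_mult)
  also have "\<dots> \<le> (b \<bullet> y) * D" using le y(2) by (intro mult_left_mono) auto
  finally show "1 / D \<le> b \<bullet> y" using D by (simp add: field_simps)
qed

end

section \<open>Positive norm minimum\<close>

context irrational_unimodular_lattice
begin

text \<open>If the box with half-widths \<open>v $ i\<close> were too large, it would contain a
  nonzero lattice point x by Minkowski's theorem, and v would be the midpoint of v + x and v -
  x.\<close>

lemma vertex_prod_bounded:
  obtains M where "0 < M" "\<And>v. {v} face_of K \<Longrightarrow> (\<Prod>i\<in>UNIV. v $ i) \<le> M"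
proof -
  obtain M where M: "0 < M"
    "\<And>l. (\<And>i. 0 < l i) \<Longrightarrow> M < (\<Prod>i\<in>UNIV. l i) \<Longrightarrow> \<exists>x\<in>L. x \<noteq> 0 \<and> (\<forall>i. \<bar>x $ i\<bar> < l i)"
    using minkowski_box by metis
  have "(\<Prod>i\<in>UNIV. v $ i) \<le> M" if v: "{v} face_of K" for v
  proof (rule ccontr)
    assume "\<not> (\<Prod>i\<in>UNIV. v $ i) \<le> M"
    have vA: "v \<in> L" "\<And>i. 0 < v $ i"
      using vertex_in_positive_points[OF v] by (auto simp: positive_points_iff)
    obtain x where x: "x \<in> L" "x \<noteq> 0" "\<forall>i. \<bar>x $ i\<bar> < v $ i"
      using M(2)[of "($) v"] vA(2) \<open>\<not> _ \<le> M\<close> by fastforce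
    have "0 < (v + x) $ i \<and> 0 < (v - x) $ i" for i using x(3)[rule_format, of i] by auto
    then have "v + x \<in> K" "v - x \<in> K" using add_in diff_in vA(1) x(1) by (auto intro!: in_K)
    moreover have "v \<in> open_segment (v + x) (v - x)"
    proof -
      have "v + x \<noteq> v - x"
      proof
        assume "v + x = v - x"
        then have "2 *\<^sub>R x = 0" by (simp add: scaleR_2 algebra_simps)
        then show False using x(2) by simp
      qed
      moreover have "v = (1 - 1/2) *\<^sub>R (v + x) + (1/2) *\<^sub>R (v - x)" by (simp add: vec_eq_iff field_simps)
      ultimately show ?thesis unfolding in_segment by (intro conjI exI[of _ "1/2"]) auto
    qed
    ultimately show False using v unfolding face_of_singleton extreme_point_of_def by blast
  qed
  then show ?thesis using that M(1) by blast
qed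

lemma norm_min_pos_iff:
  "norm_min L > 0 \<longleftrightarrow> (\<exists>c>0. \<forall>x\<in>L. x \<noteq> 0 \<longrightarrow> c \<le> \<bar>\<Prod>i\<in>UNIV. x $ i\<bar>)"
proof
  assume pos: "norm_min L > 0"
  have "norm_min L \<le> \<bar>\<Prod>i\<in>UNIV. x $ i\<bar>" if "x \<in> L" "x \<noteq> 0" for x
    unfolding norm_min_def by (rule cINF_lower) (use that in \<open>auto intro!: bdd_belowI2[of _ 0]\<close>)
  with pos show "\<exists>c>0. \<forall>x\<in>L. x \<noteq> 0 \<longrightarrow> c \<le> \<bar>\<Prod>i\<in>UNIV. x $ i\<bar>" by blast
next
  assume "\<exists>c>0. \<forall>x\<in>L. x \<noteq> 0 \<longrightarrow> c \<le> \<bar>\<Prod>i\<in>UNIV. x $ i\<bar>"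
  then obtain c where c: "0 < c" "\<forall>x\<in>L. x \<noteq> 0 \<longrightarrow> c \<le> \<bar>\<Prod>i\<in>UNIV. x $ i\<bar>" by blast
  obtain y where y: "y \<in> positive_points" by (rule positive_points_nonempty)
  then have "y \<in> L - {0}" by (simp add: positive_points_def)
  then have "c \<le> norm_min L" unfolding norm_min_def using c(2) by (intro cINF_greatest) auto
  with c(1) show "norm_min L > 0" by simp
qed

end

locale positive_norm_lattice = irrational_unimodular_lattice L
  for L :: "(real^'n::finite) set" +
  fixes c :: real
  assumes c_pos: "0 < c" and norm_ge: "x \<in> L \<Longrightarrow> x \<noteq> 0 \<Longrightarrow> c \<le> \<bar>\<Prod>i\<in>UNIV. x $ i\<bar>"
begin

text \<open>If the lattice points of the box lie in a hyperplane, the box can be thinned in all coordinate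
  directions but one; Minkowski's theorem then gives a point of small norm.\<close>

lemma box_spans:
  obtains T where "0 < T" "\<And>t. (\<And>i. 0 < t i) \<Longrightarrow> (\<Prod>i\<in>UNIV. t i) = T \<Longrightarrow> span (lattice_box t) = UNIV"
proof -
  obtain M where M: "0 < M"
    "\<And>l. (\<And>i. 0 < l i) \<Longrightarrow> M < (\<Prod>i\<in>UNIV. l i) \<Longrightarrow> \<exists>x\<in>L. x \<noteq> 0 \<and> (\<forall>i. \<bar>x $ i\<bar> < l i)"
    using minkowski_box by metis
  define N where "N = real CARD('n)"
  have N: "1 \<le> N" using two_le_dim by (simp add: N_def)
  \<comment> \<open>The first bound gives \<open>\<rho> \<le> 1\<close>, so the thinned box lies in
    the original one. The second makes the final estimate \<open>N * \<rho> * (2 * (M + 1))\<close>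
    at most c / 2.\<close>
  define \<rho> where "\<rho> = min (1 / (2 * N)) (c / (4 * N * (M + 1)))"
  have \<rho>: "0 < \<rho>" using N M(1) c_pos by (simp add: \<rho>_def)
  have "\<rho> \<le> 1 / (2 * N)" "\<rho> \<le> c / (4 * N * (M + 1))" by (simp_all add: \<rho>_def)
  then have \<rho>1: "\<rho> * (2 * N) \<le> 1" and \<rho>2: "\<rho> * (4 * N * (M + 1)) \<le> c"
    using N M(1) by (simp_all add: pos_le_divide_eq)
  have "1 / (2 * N) \<le> 1" using N by simp
  then have \<rho>le: "\<rho> \<le> 1" using \<open>\<rho> \<le> 1 / (2 * N)\<close> by linarith
  \<comment> \<open>Chosen so that thinning all directions but one by \<open>\<rho>\<close> and
    halving the remaining one leaves volume M + 1, just enough for Minkowski's theorem.\<close>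
  define T where "T = 2 * (M + 1) / \<rho> ^ (CARD('n) - 1)"
  have T: "0 < T" using M(1) \<rho> by (simp add: T_def)
  have \<rho>T: "\<rho> ^ (CARD('n) - 1) * T = 2 * (M + 1)" using \<rho> by (simp add: T_def)
  have "span (lattice_box t) = UNIV" if t: "\<And>i. 0 < t i" and tT: "(\<Prod>i\<in>UNIV. t i) = T" for t
  proof (rule ccontr)
    assume "span (lattice_box t) \<noteq> UNIV"
    then obtain u where u: "u \<noteq> 0" "span (lattice_box t) \<subseteq> {x. u \<bullet> x = 0}"
      using span_not_univ_subset_hyperplane[of "lattice_box t"] by auto
    \<comment> \<open>The direction k with the largest \<open>\<bar>u $ k\<bar> * t k\<close> is
      left unthinned. The equation \<open>u \<bullet> x = 0\<close> then makes coordinate k small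
      too, since all other terms are small.\<close>
    define f where "f i = \<bar>u $ i\<bar> * t i" for i
    have "Max (range f) \<in> range f" by (rule Max_in) auto
    then obtain k where fk: "Max (range f) = f k" by blast
    have "f i \<le> f k" for i unfolding fk[symmetric] by (rule Max_ge) auto
    then have k: "\<And>i. \<bar>u $ i\<bar> * t i \<le> \<bar>u $ k\<bar> * t k" unfolding f_def .
    have uk: "0 < \<bar>u $ k\<bar>"
    proof -
      obtain i where "u $ i \<noteq> 0" using u(1) by (auto simp: vec_eq_iff)
      then have "0 < \<bar>u $ i\<bar> * t i" using t[of i] by simp
      then have "0 < \<bar>u $ k\<bar> * t k" using k[of i] by linarith
      then show ?thesis by (cases "u $ k = 0") auto
    qed
    define l where "l i = (if i = k then t k / 2 else \<rho> * t i)" for i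
    have l: "0 < l i" for i using t \<rho> by (simp add: l_def)
    have split: "(\<Prod>i\<in>UNIV. f i) = f k * (\<Prod>i\<in>UNIV - {k}. f i)" for f :: "'n \<Rightarrow> real"
      by (rule prod.remove) auto
    have lrest: "(\<Prod>i\<in>UNIV - {k}. l i) = \<rho> ^ (CARD('n) - 1) * (\<Prod>i\<in>UNIV - {k}. t i)"
    proof -
      have "(\<Prod>i\<in>UNIV - {k}. l i) = (\<Prod>i\<in>UNIV - {k}. \<rho> * t i)" by (intro prod.cong) (auto simp: l_def)
      also have "\<dots> = (\<Prod>i\<in>UNIV - {k}. \<rho>) * (\<Prod>i\<in>UNIV - {k}. t i)" by (rule prod.distrib)
      also have "(\<Prod>i\<in>UNIV - {k}. \<rho>) = \<rho> ^ (CARD('n) - 1)" by (simp add: card_Diff_singleton)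
      finally show ?thesis .
    qed
    have trest: "t k * (\<Prod>i\<in>UNIV - {k}. t i) = T" using split[of t] tT by simp
    have "(\<Prod>i\<in>UNIV. l i) = (\<rho> ^ (CARD('n) - 1) * (t k * (\<Prod>i\<in>UNIV - {k}. t i))) / 2"
      unfolding split[of l] lrest by (simp add: l_def)
    also have "\<dots> = M + 1" unfolding trest \<rho>T by simp
    finally have lM: "M < (\<Prod>i\<in>UNIV. l i)" by simp
    obtain x where x: "x \<in> L" "x \<noteq> 0" "\<forall>i. \<bar>x $ i\<bar> < l i" using M(2)[OF l lM] by blast
    have lt: "l i \<le> t i" for i
      using t[of i] t[of k] \<rho>le mult_right_mono[of \<rho> 1 "t i"] by (auto simp: l_def)
    have "\<bar>x $ i\<bar> \<le> t i" for i using x(3)[rule_format, of i] lt[of i] by linarith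
    then have "x \<in> lattice_box t" unfolding lattice_box_def using x(1) by blast
    then have "u \<bullet> x = 0" using u(2) span_base by blast
    then have "u $ k * x $ k = - (\<Sum>i\<in>UNIV - {k}. u $ i * x $ i)"
      using sum.remove[of UNIV k "\<lambda>i. u $ i * x $ i"] by (simp add: inner_vec_def)
    then have "\<bar>u $ k\<bar> * \<bar>x $ k\<bar> = \<bar>\<Sum>i\<in>UNIV - {k}. u $ i * x $ i\<bar>"
      by (metis abs_minus_cancel abs_mult)
    also have "\<dots> \<le> (\<Sum>i\<in>UNIV - {k}. \<bar>u $ i\<bar> * \<bar>x $ i\<bar>)"
      by (metis (no_types, lifting) abs_mult sum.cong sum_abs)
    also have "\<dots> \<le> (\<Sum>i\<in>UNIV - {k}. \<rho> * (\<bar>u $ k\<bar> * t k))"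
    proof (rule sum_mono)
      fix i assume "i \<in> UNIV - {k}"
      then have "\<bar>x $ i\<bar> \<le> \<rho> * t i" using x(3)[rule_format, of i] by (simp add: l_def)
      then have "\<bar>u $ i\<bar> * \<bar>x $ i\<bar> \<le> \<bar>u $ i\<bar> * (\<rho> * t i)" by (intro mult_left_mono) auto
      also have "\<dots> = \<rho> * (\<bar>u $ i\<bar> * t i)" by simp
      also have "\<dots> \<le> \<rho> * (\<bar>u $ k\<bar> * t k)" using k \<rho> by (intro mult_left_mono) auto
      finally show "\<bar>u $ i\<bar> * \<bar>x $ i\<bar> \<le> \<rho> * (\<bar>u $ k\<bar> * t k)" .
    qed
    also have "\<dots> = real (CARD('n) - 1) * (\<rho> * (\<bar>u $ k\<bar> * t k))" by (simp add: card_Diff_singleton)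
    also have "\<dots> \<le> N * (\<rho> * (\<bar>u $ k\<bar> * t k))"
      using t[of k] \<rho> by (intro mult_right_mono) (auto simp: N_def)
    also have "\<dots> = \<bar>u $ k\<bar> * (N * \<rho> * t k)" by simp
    finally have xk: "\<bar>x $ k\<bar> \<le> N * \<rho> * t k" using uk by simp
    have "\<bar>\<Prod>i\<in>UNIV. x $ i\<bar> = \<bar>x $ k\<bar> * (\<Prod>i\<in>UNIV - {k}. \<bar>x $ i\<bar>)"
      using split[of "\<lambda>i. \<bar>x $ i\<bar>"] by (simp add: abs_prod)
    also have "\<dots> \<le> (N * \<rho> * t k) * (\<Prod>i\<in>UNIV - {k}. l i)"
      using xk x(3) N \<rho> t[of k] by (intro mult_mono prod_mono prod_nonneg) (auto intro: less_imp_le)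
    also have "\<dots> = (N * \<rho>) * (\<rho> ^ (CARD('n) - 1) * (t k * (\<Prod>i\<in>UNIV - {k}. t i)))"
      unfolding lrest by simp
    also have "\<dots> = \<rho> * (4 * N * (M + 1)) / 2" unfolding trest \<rho>T by simp
    also have "\<dots> < c" using \<rho>2 c_pos by linarith
    finally show False using norm_ge[OF x(1,2)] by simp
  qed
  with T that show ?thesis by blast
qed

text \<open>The box is shrunk by n and then to volume exactly T, where its lattice points span the
  space; rounding coefficients in such a spanning set costs back the factor n.\<close>

lemma covering:
  obtains C where "0 < C"
    "\<And>p t. (\<And>i. 0 < t i) \<Longrightarrow> C \<le> (\<Prod>i\<in>UNIV. t i) \<Longrightarrow> \<exists>x\<in>L. \<forall>i. \<bar>x $ i - p $ i\<bar> \<le> t i"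
proof -
  obtain T where T: "0 < T"
    "\<And>t. (\<And>i. 0 < t i) \<Longrightarrow> (\<Prod>i\<in>UNIV. t i) = T \<Longrightarrow> span (lattice_box t) = UNIV"
    using box_spans by metis
  define N where "N = real CARD('n)"
  have N: "0 < N" by (simp add: N_def)
  have "\<exists>x\<in>L. \<forall>i. \<bar>x $ i - p $ i\<bar> \<le> t i"
    if t: "\<And>i. 0 < t i" and vol: "T * N ^ CARD('n) \<le> (\<Prod>i\<in>UNIV. t i)" for p and t :: "'n \<Rightarrow> real"
  proof -
    let ?P = "\<Prod>i\<in>UNIV. t i"
    have P: "0 < ?P" using t by (simp add: prod_pos)
    define \<gamma> where "\<gamma> = root CARD('n) (T * N ^ CARD('n) / ?P)"
    have q: "0 < T * N ^ CARD('n) / ?P" "T * N ^ CARD('n) / ?P \<le> 1"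
      using T(1) N P vol by (simp_all add: pos_divide_le_eq)
    have \<gamma>: "0 < \<gamma>" "\<gamma> \<le> 1" "\<gamma> ^ CARD('n) = T * N ^ CARD('n) / ?P"
      using q by (simp_all add: \<gamma>_def)
    define s where "s i = (\<gamma> / N) * t i" for i
    have s: "0 < s i" for i using \<gamma> N t by (simp add: s_def)
    have "(\<Prod>i\<in>UNIV. s i) = (\<Prod>i\<in>(UNIV::'n set). \<gamma> / N) * ?P" unfolding s_def by (rule prod.distrib)
    also have "(\<Prod>i\<in>(UNIV::'n set). \<gamma> / N) = (\<gamma> / N) ^ CARD('n)" by (rule prod_constant)
    also have "(\<gamma> / N) ^ CARD('n) * ?P = T"
    proof -
      have "(T * A / B) / A * B = T" if "A \<noteq> 0" "B \<noteq> 0" for A B :: real using that by simp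
      then show ?thesis unfolding power_divide \<gamma>(3) using N P by (simp del: prod_zero_iff)
    qed
    finally have "span (lattice_box s) = UNIV" by (intro T(2) s)
    then have "p \<in> span (lattice_box s)" by simp
    then obtain x where x: "x \<in> L" "\<And>i. \<bar>x $ i - p $ i\<bar> \<le> N * s i"
      unfolding N_def by (rule lattice_near_span) (use s in \<open>auto intro: less_imp_le\<close>)
    have "N * s i \<le> t i" for i using \<gamma> N t[of i] mult_right_mono[of \<gamma> 1 "t i"] by (simp add: s_def)
    with x show ?thesis using order_trans by blast
  qed
  then show ?thesis using that[of "T * N ^ CARD('n)"] T(1) N by simp
qed

text \<open>Two lattice points are taken near the quarter and three-quarter points of the box, in
  each coordinate ordered by the sign of \<open>a $ i\<close>. Every term of
  \<open>a \<bullet> (w - z)\<close> is then at least \<open>\<bar>a $ i\<bar> * s i / 4\<close>, so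
  no cancellation occurs.\<close>

lemma box_separated_points:
  obtains C where "0 < C"
    "\<And>o' s a. (\<And>i. 0 < s i) \<Longrightarrow> C \<le> (\<Prod>i\<in>UNIV. s i) \<Longrightarrow> a \<noteq> 0 \<Longrightarrow>
      \<exists>z\<in>L. \<exists>w\<in>L. a \<bullet> z \<noteq> a \<bullet> w \<and>
        (\<forall>i. o' $ i < z $ i \<and> z $ i < o' $ i + s i \<and> o' $ i < w $ i \<and> w $ i < o' $ i + s i)"
proof -
  obtain C where C: "0 < C"
    "\<And>p t. (\<And>i. 0 < t i) \<Longrightarrow> C \<le> (\<Prod>i\<in>UNIV. t i) \<Longrightarrow> \<exists>x\<in>L. \<forall>i. \<bar>x $ i - p $ i\<bar> \<le> t i"
    using covering by metis
  have "\<exists>z\<in>L. \<exists>w\<in>L. a \<bullet> z \<noteq> a \<bullet> w \<and>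
        (\<forall>i. o' $ i < z $ i \<and> z $ i < o' $ i + s i \<and> o' $ i < w $ i \<and> w $ i < o' $ i + s i)"
    if s: "\<And>i. 0 < s i" and vol: "8 ^ CARD('n) * C \<le> (\<Prod>i\<in>UNIV. s i)" and a: "a \<noteq> 0" for o' s a
  proof -
    define p where "p = (\<chi> i. o' $ i + (if 0 \<le> a $ i then 1/4 else 3/4) * s i)"
    define q where "q = (\<chi> i. o' $ i + (if 0 \<le> a $ i then 3/4 else 1/4) * s i)"
    have "(\<Prod>i\<in>UNIV. s i / 8) = (\<Prod>i\<in>UNIV. s i) / 8 ^ CARD('n)" by (simp add: prod_dividef)
    moreover have "C \<le> (\<Prod>i\<in>UNIV. s i) / 8 ^ CARD('n)" using vol by (simp add: pos_le_divide_eq mult.commute)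
    ultimately have v: "C \<le> (\<Prod>i\<in>UNIV. s i / 8)" by simp
    obtain z where z: "z \<in> L" "\<forall>i. \<bar>z $ i - p $ i\<bar> \<le> s i / 8" using C(2)[of "\<lambda>i. s i / 8" p] s v by auto
    obtain w where w: "w \<in> L" "\<forall>i. \<bar>w $ i - q $ i\<bar> \<le> s i / 8" using C(2)[of "\<lambda>i. s i / 8" q] s v by auto
    have bounds: "o' $ i < z $ i \<and> z $ i < o' $ i + s i \<and> o' $ i < w $ i \<and> w $ i < o' $ i + s i" for i
    proof -
      define p' q' where "p' = o' $ i + (1/4) * s i" and "q' = o' $ i + (3/4) * s i"
      have "\<bar>z $ i - p'\<bar> \<le> s i / 8 \<and> \<bar>w $ i - q'\<bar> \<le> s i / 8 \<or> \<bar>z $ i - q'\<bar> \<le> s i / 8 \<and> \<bar>w $ i - p'\<bar> \<le> s i / 8"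
        using z(2)[rule_format, of i] w(2)[rule_format, of i]
        by (cases "0 \<le> a $ i") (simp_all add: p_def q_def p'_def q'_def)
      then show ?thesis using s[of i] unfolding p'_def q'_def abs_le_iff by linarith
    qed
    have trm: "\<bar>a $ i\<bar> * (s i / 4) \<le> a $ i * (w $ i - z $ i)" for i
    proof (cases "0 \<le> a $ i")
      case True
      then have "s i / 4 \<le> w $ i - z $ i"
        using z(2)[rule_format, of i] w(2)[rule_format, of i] unfolding abs_le_iff by (simp add: p_def q_def)
      then have "a $ i * (s i / 4) \<le> a $ i * (w $ i - z $ i)" using True by (rule mult_left_mono)
      then show ?thesis using True by simp
    next
      case False
      then have "s i / 4 \<le> z $ i - w $ i"
        using z(2)[rule_format, of i] w(2)[rule_format, of i] unfolding abs_le_iff by (simp add: p_def q_def)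
      then have "\<bar>a $ i\<bar> * (s i / 4) \<le> \<bar>a $ i\<bar> * (z $ i - w $ i)" by (rule mult_left_mono) simp
      also have "\<dots> = a $ i * (w $ i - z $ i)" using False by (simp add: algebra_simps)
      finally show ?thesis .
    qed
    obtain k where "a $ k \<noteq> 0" using a by (auto simp: vec_eq_iff)
    then have "0 < (\<Sum>i\<in>UNIV. \<bar>a $ i\<bar> * (s i / 4))"
      using s by (intro sum_pos2[of UNIV k]) (auto simp: less_imp_le)
    also have "\<dots> \<le> (\<Sum>i\<in>UNIV. a $ i * (w $ i - z $ i))" by (intro sum_mono trm)
    also have "\<dots> = a \<bullet> w - a \<bullet> z" by (simp add: inner_vec_def right_diff_distrib sum_subtractf)
    finally show ?thesis using z(1) w(1) bounds by (intro bexI[of _ z] bexI[of _ w]) auto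
  qed
  then show ?thesis using that[of "8 ^ CARD('n) * C"] C(1) by simp
qed

text \<open>The box with half-widths \<open>H * x i\<close> is cut into cells of sides
  \<open>\<delta> * x i\<close>. Two lattice points in one cell would differ by a vector of norm at
  most \<open>\<delta> * C < c\<close>, so V has boundedly many points, and each determinant is
  bounded by the volume of the box.\<close>

lemma det_sum_bounded:
  assumes H: "0 \<le> H" and C: "0 < C"
  obtains D where "\<And>V x. V \<subseteq> L \<Longrightarrow> (\<And>w i. w \<in> V \<Longrightarrow> \<bar>w $ i\<bar> \<le> H * x i) \<Longrightarrow> (\<And>i. 0 < x i) \<Longrightarrow>
    (\<Prod>i\<in>UNIV. x i) \<le> C \<Longrightarrow> det_sum V \<le> ennreal D"
proof -
  define \<delta> where "\<delta> = min 1 (c / (2 * C))"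
  have \<delta>: "0 < \<delta>" "\<delta> \<le> 1" using c_pos C by (simp_all add: \<delta>_def)
  have "\<delta> \<le> c / (2 * C)" by (simp add: \<delta>_def)
  then have \<delta>C: "\<delta> * C < c" using C c_pos by (simp add: field_simps)
  define m where "m = \<lceil>H / \<delta>\<rceil> + 1"
  define P where "P = PiE (UNIV::'n set) (\<lambda>_. {-m..m})"
  define E where "E = fact CARD('n) * H ^ CARD('n) * C"
  have E: "0 \<le> E" using H C by (simp add: E_def)
  have fP: "finite P" unfolding P_def by (intro finite_PiE) auto
  have "det_sum V \<le> ennreal (2 ^ card P * E)"
    if V: "V \<subseteq> L" and box: "\<And>w i. w \<in> V \<Longrightarrow> \<bar>w $ i\<bar> \<le> H * x i" and x: "\<And>i. 0 < x i"
      and vol: "(\<Prod>i\<in>UNIV. x i) \<le> C" for V and x :: "'n \<Rightarrow> real"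
  proof -
    define f where "f w i = \<lfloor>w $ i / (\<delta> * x i)\<rfloor>" for w :: "real^'n" and i
    have "f ` V \<subseteq> P"
    proof (rule image_subsetI)
      fix w assume w: "w \<in> V"
      have "f w i \<in> {-m..m}" for i
      proof -
        have "\<bar>w $ i / (\<delta> * x i)\<bar> = \<bar>w $ i\<bar> / (\<delta> * x i)" using \<delta>(1) x[of i] by (simp add: abs_mult)
        also have "\<dots> \<le> H * x i / (\<delta> * x i)"
          using box[OF w, of i] \<delta>(1) x[of i] by (intro divide_right_mono) auto
        also have "\<dots> = H / \<delta>" using x[of i] by simp
        finally have "\<bar>w $ i / (\<delta> * x i)\<bar> \<le> H / \<delta>" .
        then have "w $ i / (\<delta> * x i) \<le> H / \<delta>" "- (w $ i / (\<delta> * x i)) \<le> H / \<delta>" by (simp_all only: abs_le_iff)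
        moreover have "H / \<delta> \<le> of_int \<lceil>H / \<delta>\<rceil>" by (rule le_of_int_ceiling)
        ultimately have "real_of_int (f w i) \<le> of_int m" "real_of_int (- m) \<le> of_int (f w i)"
          unfolding f_def m_def by (simp_all, linarith+)
        then show ?thesis unfolding of_int_le_iff by simp
      qed
      then show "f w \<in> P" unfolding P_def by auto
    qed
    moreover have "inj_on f V"
    proof (rule inj_onI, rule ccontr)
      fix v w assume vw: "v \<in> V" "w \<in> V" "f v = f w" "v \<noteq> w"
      have "\<bar>(v - w) $ i\<bar> \<le> \<delta> * x i" for i
      proof -
        have "\<lfloor>v $ i / (\<delta> * x i)\<rfloor> = \<lfloor>w $ i / (\<delta> * x i)\<rfloor>" using vw(3) unfolding f_def by meson
        then have "\<bar>v $ i / (\<delta> * x i) - w $ i / (\<delta> * x i)\<bar> < 1" by linarith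
        then have "\<bar>(v $ i - w $ i) / (\<delta> * x i)\<bar> < 1" by (simp add: diff_divide_distrib)
        then have "\<bar>v $ i - w $ i\<bar> / (\<delta> * x i) < 1" using \<delta>(1) x[of i] by (simp add: abs_mult)
        then show ?thesis using \<delta>(1) x[of i] by (simp add: pos_divide_less_eq)
      qed
      then have "\<bar>\<Prod>i\<in>UNIV. (v - w) $ i\<bar> \<le> (\<Prod>i\<in>UNIV. \<delta> * x i)"
        unfolding abs_prod by (intro prod_mono) auto
      also have "\<dots> = \<delta> ^ CARD('n) * (\<Prod>i\<in>UNIV. x i)" by (simp add: prod.distrib)
      also have "\<dots> \<le> \<delta> * C"
      proof (rule mult_mono)
        show "\<delta> ^ CARD('n) \<le> \<delta>" using \<delta> two_le_dim power_decreasing[of 1 "CARD('n)" \<delta>] by simp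
      qed (use \<delta> vol x in \<open>auto intro: prod_nonneg less_imp_le\<close>)
      also have "\<dots> < c" by (rule \<delta>C)
      finally show False using norm_ge[of "v - w"] vw V diff_in by auto
    qed
    ultimately have fin: "finite V" and cV: "card V \<le> card P"
      using fP by (auto intro: inj_on_finite card_inj_on_le)
    let ?S = "{S. S \<subseteq> V \<and> card S = CARD('n)}"
    have finS: "finite ?S" using fin by simp
    have "card ?S \<le> card (Pow V)" using fin by (intro card_mono) auto
    also have "\<dots> = 2 ^ card V" using fin by (simp add: card_Pow)
    also have "\<dots> \<le> 2 ^ card P" using cV by (intro power_increasing) auto
    finally have cS: "card ?S \<le> 2 ^ card P" .
    have each: "abs_det S \<le> E" if "S \<in> ?S" for S
    proof -
      have "finite S" using that fin finite_subset by blast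
      moreover have "card (UNIV::'n set) = card S" using that by simp
      ultimately have "\<exists>g. bij_betw g (UNIV::'n set) S" by (intro finite_same_card_bij) simp_all
      then obtain g where g: "bij_betw g (UNIV::'n set) S" by blast
      have "g i \<in> V" for i using g that by (auto simp: bij_betw_def)
      then have "\<bar>det (\<chi> i. g i)\<bar> \<le> fact CARD('n) * (\<Prod>i\<in>(UNIV::'n set). H) * (\<Prod>j\<in>UNIV. x j)"
        using box H x by (intro abs_det_le) (auto intro: less_imp_le)
      also have "\<dots> \<le> E" unfolding E_def using vol H by (simp add: mult_left_mono)
      finally show ?thesis using abs_det_eq[OF g] by simp
    qed
    have "det_sum V = (\<Sum>S\<in>?S. ennreal (abs_det S))" unfolding det_sum_def by (rule infsum_finite[OF finS])
    also have "\<dots> \<le> (\<Sum>S\<in>?S. ennreal E)" using each by (intro sum_mono ennreal_leI)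
    also have "\<dots> = ennreal (real (card ?S) * E)" using E by (simp add: ennreal_mult ennreal_of_nat_eq_real_of_nat)
    also have "\<dots> \<le> ennreal (2 ^ card P * E)"
    proof (intro ennreal_leI mult_right_mono E)
      have "real (card ?S) \<le> real (2 ^ card P)" using cS by (simp only: of_nat_le_iff)
      then show "real (card ?S) \<le> 2 ^ card P" by simp
    qed
    finally show ?thesis .
  qed
  with that show ?thesis by blast
qed

lemma midpoint_face:
  assumes "F face_of K" "p \<in> positive_points" "q \<in> positive_points" "(1/2) *\<^sub>R (p + q) \<in> F"
  shows "p \<in> F"
proof -
  have pq: "p \<in> K" "q \<in> K" using assms positive_points_subset_K by auto
  have mid: "(1/2) *\<^sub>R (p + q) = (1 - 1/2) *\<^sub>R p + (1/2) *\<^sub>R q" by (simp add: scaleR_right_distrib)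
  show ?thesis
  proof (cases "p = q")
    case True
    then show ?thesis using assms(4) by (simp flip: scaleR_2)
  next
    case False
    then have "(1/2) *\<^sub>R (p + q) \<in> open_segment p q"
      unfolding in_segment using mid by (intro conjI exI[of _ "1/2"]) auto
    then show ?thesis using assms(1,4) pq unfolding face_of_def by blast
  qed
qed

text \<open>One lattice point x of the facet serves as the unit of length. For every lattice point w
  of F the box spanned by the origin and x + w has bounded volume, since otherwise it would contain
  two lattice points of F with different values of the normal b. As the product of the coordinates
  of x is at least c, every coordinate of w is at most C / c times that of x.\<close>

lemma facets_bounded: "\<exists>D. \<forall>F. F facet_of K \<longrightarrow> facet_det F \<le> ennreal D"
proof -
  obtain C where C: "0 < C"
    "\<And>o' s a. (\<And>i. 0 < s i) \<Longrightarrow> C \<le> (\<Prod>i\<in>UNIV. s i) \<Longrightarrow> a \<noteq> 0 \<Longrightarrow>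
      \<exists>z\<in>L. \<exists>w\<in>L. a \<bullet> z \<noteq> a \<bullet> w \<and>
        (\<forall>i. o' $ i < z $ i \<and> z $ i < o' $ i + s i \<and> o' $ i < w $ i \<and> w $ i < o' $ i + s i)"
    using box_separated_points by metis
  have Cc: "0 \<le> C / c" using C(1) c_pos by simp
  obtain D where D: "\<And>V x. V \<subseteq> L \<Longrightarrow> (\<And>w i. w \<in> V \<Longrightarrow> \<bar>w $ i\<bar> \<le> C / c * x i) \<Longrightarrow> (\<And>i. 0 < x i) \<Longrightarrow>
    (\<Prod>i\<in>UNIV. x i) \<le> C \<Longrightarrow> det_sum V \<le> ennreal D"
    using det_sum_bounded[OF Cc C(1)] by metis
  have "facet_det F \<le> ennreal D" if F: "F facet_of K" for F
  proof -
    have face: "F face_of K" using facet_is_face[OF F] .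
    obtain b where b: "\<And>p. p \<in> F \<Longrightarrow> b \<bullet> p = 1" by (rule facet_normal[OF F]) blast
    obtain g where g: "\<And>i::'n. g i \<in> positive_points \<inter> F" by (rule facet_basis[OF F]) blast
    define x where "x = g undefined"
    have x: "x \<in> positive_points" "x \<in> F" using g[of undefined] by (auto simp: x_def)
    then have xpos: "0 < x $ i" "x \<in> L" for i by (auto simp: positive_points_iff)
    have bnz: "b \<noteq> 0" using b[OF x(2)] by auto
    have prod: "(\<Prod>i\<in>UNIV. x $ i + w $ i) < C" if w: "w \<in> positive_points" "w \<in> F" for w
    proof (rule ccontr)
      assume big: "\<not> (\<Prod>i\<in>UNIV. x $ i + w $ i) < C"
      have wpos: "0 < w $ i" "w \<in> L" for i using w by (auto simp: positive_points_iff)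
      have inF: "z \<in> F" if z: "z \<in> L" "\<forall>i. 0 < z $ i \<and> z $ i < x $ i + w $ i" for z
      proof (rule midpoint_face[OF face])
        show "z \<in> positive_points" using z by (simp add: positive_points_iff)
        show "x + w - z \<in> positive_points"
          using z add_in diff_in xpos wpos by (simp add: positive_points_iff)
        have "(1/2) *\<^sub>R x + (1/2) *\<^sub>R w \<in> F"
          by (rule convexD[OF face_of_imp_convex[OF face] x(2) w(2)]) auto
        then show "(1/2) *\<^sub>R (z + (x + w - z)) \<in> F" by (simp add: scaleR_right_distrib)
      qed
      have "\<exists>z\<in>L. \<exists>y\<in>L. b \<bullet> z \<noteq> b \<bullet> y \<and>
        (\<forall>i. 0 $ i < z $ i \<and> z $ i < 0 $ i + (x $ i + w $ i) \<and> 0 $ i < y $ i \<and> y $ i < 0 $ i + (x $ i + w $ i))"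
        using C(2)[of "\<lambda>i. x $ i + w $ i" b 0] xpos wpos big bnz by (simp add: add_pos_pos)
      then obtain z y where zy: "z \<in> L" "y \<in> L" "b \<bullet> z \<noteq> b \<bullet> y"
        "\<forall>i. 0 < z $ i \<and> z $ i < x $ i + w $ i" "\<forall>i. 0 < y $ i \<and> y $ i < x $ i + w $ i" by auto
      then show False using b inF by metis
    qed
    have vol: "(\<Prod>i\<in>UNIV. x $ i) \<le> C"
    proof -
      have "(\<Prod>i\<in>UNIV. x $ i) \<le> (\<Prod>i\<in>UNIV. x $ i + x $ i)"
        using xpos by (intro prod_mono) (auto intro: less_imp_le)
      then show ?thesis using prod[OF x] by simp
    qed
    have "\<bar>w $ i\<bar> \<le> C / c * x $ i" if w: "w \<in> positive_points" "w \<in> F" for w i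
    proof -
      have wpos: "0 < w $ i" for i using w by (auto simp: positive_points_iff)
      let ?R = "\<Prod>j\<in>UNIV - {i}. x $ j"
      have R: "0 < ?R" using xpos by (simp add: prod_pos)
      have "c \<le> (\<Prod>i\<in>UNIV. x $ i)"
        using norm_ge[OF xpos(2)] xpos(1) by (auto simp: vec_eq_iff abs_prod less_imp_le) (metis less_irrefl)
      also have "\<dots> = x $ i * ?R" by (rule prod.remove) auto
      finally have "w $ i * c \<le> x $ i * (w $ i * ?R)"
        using wpos[of i] by (simp add: mult.left_commute mult_left_mono)
      also have "w $ i * ?R \<le> (x $ i + w $ i) * (\<Prod>j\<in>UNIV - {i}. x $ j + w $ j)"
        using xpos wpos by (intro mult_mono prod_mono) (auto intro: less_imp_le prod_nonneg add_nonneg_nonneg)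
      also have "\<dots> = (\<Prod>j\<in>UNIV. x $ j + w $ j)" by (rule prod.remove[symmetric]) auto
      also have "\<dots> \<le> C" using prod[OF w] by simp
      finally have "w $ i * c \<le> x $ i * C" using xpos(1)[of i] by (simp add: mult_left_mono)
      then show ?thesis using wpos[of i] c_pos by (simp add: field_simps)
    qed
    then show ?thesis unfolding facet_det_def
      using vertices_face[OF face] vertex_in_positive_points xpos vol
      by (intro D[of "vertices F" "($) x"]) (auto simp: positive_points_iff)
  qed
  then show ?thesis by blast
qed

end

section \<open>Primitive vectors along edges\<close>

context irrational_unimodular_lattice
begin

lemma finite_fractions:
  assumes "r \<noteq> 0"
  shows "finite {q. 0 < q \<and> q \<le> 1 \<and> q *\<^sub>R r \<in> L}"
proof -
  define S where "S = {q. 0 < q \<and> q \<le> 1 \<and> q *\<^sub>R r \<in> L}"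
  define R where "R = (\<Sum>i\<in>UNIV. \<bar>r $ i\<bar>)"
  have "(\<lambda>q. q *\<^sub>R r) ` S \<subseteq> {x \<in> L. \<forall>i. \<bar>x $ i\<bar> \<le> R}"
  proof (rule image_subsetI, intro CollectI conjI allI)
    fix q i assume q: "q \<in> S"
    then show "q *\<^sub>R r \<in> L" by (simp add: S_def)
    have "\<bar>(q *\<^sub>R r) $ i\<bar> = q * \<bar>r $ i\<bar>" using q by (simp add: S_def abs_mult)
    also have "\<dots> \<le> 1 * \<bar>r $ i\<bar>" using q by (intro mult_right_mono) (auto simp: S_def)
    also have "\<dots> \<le> R" unfolding R_def using member_le_sum[of i UNIV "\<lambda>i. \<bar>r $ i\<bar>"] by simp
    finally show "\<bar>(q *\<^sub>R r) $ i\<bar> \<le> R" .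
  qed
  then have "finite ((\<lambda>q. q *\<^sub>R r) ` S)" using finite_bounded finite_subset by blast
  moreover have "inj_on (\<lambda>q. q *\<^sub>R r) S" using assms by (auto simp: inj_on_def)
  ultimately have "finite S" by (rule finite_imageD)
  then show ?thesis by (simp add: S_def)
qed

text \<open>A fractional part of s would give a least positive g < 1 with g r in the lattice.
  Division of 1 by g leaves no remainder by minimality, so r is k times g r, and primitivity forces
  g = 1.\<close>

lemma primitive_multiple:
  assumes r: "primitive_in L r" and s: "s *\<^sub>R r \<in> L"
  shows "s \<in> \<int>"
proof (rule ccontr)
  assume "s \<notin> \<int>"
  have rL: "r \<in> L" "r \<noteq> 0" using r by (auto simp: primitive_in_def)
  define S where "S = {q. 0 < q \<and> q \<le> 1 \<and> q *\<^sub>R r \<in> L}"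
  have fin: "finite S" unfolding S_def by (rule finite_fractions[OF rL(2)])
  have "1 \<in> S" using rL by (simp add: S_def)
  define g where "g = Min S"
  have g: "g \<in> S" "\<And>q. q \<in> S \<Longrightarrow> g \<le> q" using fin \<open>1 \<in> S\<close> by (auto simp: g_def intro!: Min_in)
  have gpos: "0 < g" "g *\<^sub>R r \<in> L" using g(1) by (auto simp: S_def)
  have "frac s *\<^sub>R r = s *\<^sub>R r - of_int \<lfloor>s\<rfloor> *\<^sub>R r" by (simp add: frac_def scaleR_left_diff_distrib)
  also have "\<dots> \<in> L" by (intro diff_in s of_int_scaleR_in rL)
  finally have "frac s \<in> S" using \<open>s \<notin> \<int>\<close> frac_gt_0_iff[of s] frac_lt_1[of s] by (simp add: S_def)
  then have g1: "g < 1" using g(2) frac_lt_1[of s] by (meson le_less_trans)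
  define k where "k = \<lfloor>1 / g\<rfloor>"
  define h where "h = 1 - of_int k * g"
  have k: "of_int k \<le> 1 / g" "1 / g < of_int k + 1" unfolding k_def by linarith+
  have h: "0 \<le> h" "h < g" using k gpos(1) by (simp_all add: h_def field_simps)
  have "h *\<^sub>R r = r - of_int k *\<^sub>R (g *\<^sub>R r)" by (simp add: h_def scaleR_left_diff_distrib)
  also have "\<dots> \<in> L" by (intro diff_in of_int_scaleR_in rL gpos)
  finally have "h \<in> S" if "h \<noteq> 0" using that h g1 by (simp add: S_def)
  then have "h = 0" using g(2) h(2) by fastforce
  then have "r = of_int k *\<^sub>R (g *\<^sub>R r)" by (simp add: h_def)
  then have "\<bar>k\<bar> = 1" using r gpos(2) unfolding primitive_in_def by blast
  then have "1 = g" using \<open>h = 0\<close> gpos(1) by (auto simp: h_def abs_if split: if_splits)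
  then show False using g1 by simp
qed

text \<open>The issue is that a primitive vector might overshoot the edge. The edge is the hull of
  its lattice points, so one of them lies at parameter s > 0; since s is an integer, v + r comes no
  later than that point.\<close>

lemma star_vector_facts:
  assumes v: "{v} face_of K" and r: "r \<in> star_vectors L K v"
  obtains E where "E face_of K" "v \<in> E" "v + r \<in> E" "v + r \<in> positive_points"
    "\<And>p. p \<in> E \<Longrightarrow> \<exists>s. p = v + s *\<^sub>R r"
proof -
  obtain E t where E: "E edge_of K" "v \<in> E" "0 < t" "v + t *\<^sub>R r \<in> E" and prim: "primitive_in L r"
    using r unfolding star_vectors_def by blast
  have rL: "r \<in> L" "r \<noteq> 0" using prim by (auto simp: primitive_in_def)
  have vA: "v \<in> positive_points" by (rule vertex_in_positive_points[OF v])
  have face: "E face_of K" "aff_dim E = 1" using E(1) by (auto simp: edge_of_def)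
  have line: "\<exists>s. p = v + s *\<^sub>R r" if "p \<in> E" for p
  proof -
    have ne: "v \<noteq> v + t *\<^sub>R r" using E(3) rL(2) by simp
    have "{v, v + t *\<^sub>R r} \<subseteq> E" using E by simp
    moreover have "aff_dim {v, v + t *\<^sub>R r} = aff_dim E" using ne face(2) by (simp add: aff_dim_2)
    ultimately have "affine hull {v, v + t *\<^sub>R r} = affine hull E" using aff_dim_eq_full_gen by blast
    then have "p \<in> affine hull {v, v + t *\<^sub>R r}" using that hull_inc by auto
    then obtain u where "p = v + u *\<^sub>R (v + t *\<^sub>R r - v)" unfolding affine_hull_2_alt by auto
    then have "p = v + (u * t) *\<^sub>R r" by simp
    then show ?thesis by blast
  qed
  have hull: "E = convex hull (positive_points \<inter> E)"
    using face_of_convex_hull_eq[of E positive_points] face(1) unfolding K_eq by simp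
  have "\<exists>y\<in>positive_points \<inter> E. r \<bullet> (v + t *\<^sub>R r) \<le> r \<bullet> y"
  proof (rule ccontr)
    assume "\<not> (\<exists>y\<in>positive_points \<inter> E. r \<bullet> (v + t *\<^sub>R r) \<le> r \<bullet> y)"
    then have "positive_points \<inter> E \<subseteq> {y. r \<bullet> y < r \<bullet> (v + t *\<^sub>R r)}" by (auto simp: not_le)
    then have "convex hull (positive_points \<inter> E) \<subseteq> {y. r \<bullet> y < r \<bullet> (v + t *\<^sub>R r)}"
      by (intro hull_minimal convex_halfspace_lt)
    then show False using E(4) hull by blast
  qed
  then obtain y where y: "y \<in> positive_points" "y \<in> E" "r \<bullet> (v + t *\<^sub>R r) \<le> r \<bullet> y" by blast
  obtain s where s: "y = v + s *\<^sub>R r" using line[OF y(2)] by blast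
  have rr: "0 < r \<bullet> r" using rL(2) by simp
  have "t * (r \<bullet> r) \<le> s * (r \<bullet> r)" using y(3) unfolding s by (simp add: inner_add_right)
  then have "t \<le> s" using rr by simp
  then have spos: "0 < s" using E(3) by simp
  have "y - v \<in> L" using y(1) vA by (intro diff_in) (auto simp: positive_points_iff)
  then have "s *\<^sub>R r \<in> L" unfolding s by simp
  then have "s \<in> \<int>" by (rule primitive_multiple[OF prim])
  then obtain k where "s = of_int k" by (rule Ints_cases)
  then have s1: "1 \<le> s" using spos by simp
  have "(1 - 1 / s) *\<^sub>R v + (1 / s) *\<^sub>R y \<in> E"
    using s1 by (intro convexD[OF face_of_imp_convex[OF face(1)] E(2) y(2)]) auto
  moreover have "(1 - 1 / s) *\<^sub>R v + (1 / s) *\<^sub>R y = v + r"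
    using s1 unfolding s by (simp add: algebra_simps)
  ultimately have vr: "v + r \<in> E" by simp
  then have "v + r \<in> L \<inter> K" using face_of_imp_subset[OF face(1)] add_in rL(1) vA by (auto simp: positive_points_iff)
  then have "v + r \<in> positive_points" using positive_points_eq_K by blast
  with that face(1) E(2) vr line show ?thesis by blast
qed

end

context positive_norm_lattice
begin

text \<open>The midpoint argument is applied to v and v + r with the box from -v to v + r. If it
  were too large, it would contain two lattice points separated by a functional orthogonal to r,
  while each such z has v + z on the edge and is parallel to r. Here v is the unit of
  length.\<close>

lemma stars_bounded: "\<exists>D. \<forall>v. {v} face_of K \<longrightarrow> star_det L K v \<le> ennreal D"
proof -
  obtain C where C: "0 < C"
    "\<And>o' s a. (\<And>i. 0 < s i) \<Longrightarrow> C \<le> (\<Prod>i\<in>UNIV. s i) \<Longrightarrow> a \<noteq> 0 \<Longrightarrow>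
      \<exists>z\<in>L. \<exists>w\<in>L. a \<bullet> z \<noteq> a \<bullet> w \<and>
        (\<forall>i. o' $ i < z $ i \<and> z $ i < o' $ i + s i \<and> o' $ i < w $ i \<and> w $ i < o' $ i + s i)"
    using box_separated_points by metis
  obtain M where M: "0 < M" "\<And>v. {v} face_of K \<Longrightarrow> (\<Prod>i\<in>UNIV. v $ i) \<le> M"
    using vertex_prod_bounded by metis
  have Cc: "0 \<le> C / c" using C(1) c_pos by simp
  obtain D where D: "\<And>V x. V \<subseteq> L \<Longrightarrow> (\<And>w i. w \<in> V \<Longrightarrow> \<bar>w $ i\<bar> \<le> (C / c + 2) * x i) \<Longrightarrow> (\<And>i. 0 < x i) \<Longrightarrow>
    (\<Prod>i\<in>UNIV. x i) \<le> M \<Longrightarrow> det_sum V \<le> ennreal D"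
    using det_sum_bounded[of "C / c + 2" M] Cc M(1) by (metis add_nonneg_nonneg zero_le_numeral)
  have "star_det L K v \<le> ennreal D" if v: "{v} face_of K" for v
    unfolding star_det_def
  proof (rule D)
    have vA: "v \<in> L" "\<And>i. 0 < v $ i"
      using vertex_in_positive_points[OF v] by (auto simp: positive_points_iff)
    show "star_vectors L K v \<subseteq> L" by (auto simp: star_vectors_def primitive_in_def)
    show "0 < v $ i" for i by (rule vA(2))
    show "(\<Prod>i\<in>UNIV. v $ i) \<le> M" by (rule M(2)[OF v])
    fix r i assume r: "r \<in> star_vectors L K v"
    obtain E where E: "E face_of K" "v \<in> E" "v + r \<in> E" "v + r \<in> positive_points"
      "\<And>p. p \<in> E \<Longrightarrow> \<exists>s. p = v + s *\<^sub>R r"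
      using star_vector_facts[OF v r] by metis
    have rL: "r \<in> L" using r by (auto simp: star_vectors_def primitive_in_def)
    have vr: "0 < v $ i + r $ i" for i using E(4) by (auto simp: positive_points_iff)
    have prod: "(\<Prod>i\<in>UNIV. r $ i + 2 * v $ i) < C"
    proof (rule ccontr)
      assume big: "\<not> (\<Prod>i\<in>UNIV. r $ i + 2 * v $ i) < C"
      obtain a where a: "a \<noteq> 0" "a \<bullet> r = 0"
        using orthogonal_to_vector_exists[of r] two_le_dim by (auto simp: orthogonal_def inner_commute)
      have zero: "a \<bullet> z = 0" if z: "z \<in> L" "\<forall>i. - v $ i < z $ i \<and> z $ i < v $ i + r $ i" for z
      proof -
        have z': "0 < v $ i + z $ i" "0 < v $ i + r $ i - z $ i" for i using z(2)[rule_format, of i] by auto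
        have "v + z \<in> E"
        proof (rule midpoint_face[OF E(1)])
          show "v + z \<in> positive_points" using z(1) vA(1) z' by (simp add: positive_points_iff add_in)
          show "v + r - z \<in> positive_points"
            using z(1) vA(1) rL z' by (simp add: positive_points_iff add_in diff_in)
          have "(1/2) *\<^sub>R v + (1/2) *\<^sub>R (v + r) \<in> E"
            by (rule convexD[OF face_of_imp_convex[OF E(1)] E(2,3)]) auto
          then show "(1/2) *\<^sub>R (v + z + (v + r - z)) \<in> E" by (simp add: scaleR_right_distrib)
        qed
        then obtain s where "v + z = v + s *\<^sub>R r" using E(5) by blast
        then show ?thesis using a(2) by simp
      qed
      have "\<exists>z\<in>L. \<exists>y\<in>L. a \<bullet> z \<noteq> a \<bullet> y \<and>
        (\<forall>i. (- v) $ i < z $ i \<and> z $ i < (- v) $ i + (r $ i + 2 * v $ i) \<and>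
             (- v) $ i < y $ i \<and> y $ i < (- v) $ i + (r $ i + 2 * v $ i))"
      proof (rule C(2)[OF _ _ a(1)])
        show "0 < r $ i + 2 * v $ i" for i using vr[of i] vA(2)[of i] by simp
      qed (use big in simp)
      then obtain z y where zy: "z \<in> L" "y \<in> L" "a \<bullet> z \<noteq> a \<bullet> y"
        "\<forall>i. - v $ i < z $ i \<and> z $ i < v $ i + r $ i" "\<forall>i. - v $ i < y $ i \<and> y $ i < v $ i + r $ i" by auto
      then show False using zero by metis
    qed
    let ?R = "\<Prod>j\<in>UNIV - {i}. v $ j"
    have "c \<le> \<bar>\<Prod>i\<in>UNIV. v $ i\<bar>"
    proof (rule norm_ge[OF vA(1)])
      show "v \<noteq> 0" using vA(2)[of i] by auto
    qed
    also have "\<dots> = (\<Prod>i\<in>UNIV. v $ i)" using vA(2) by (simp add: prod_nonneg less_imp_le)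
    also have "\<dots> = v $ i * ?R" by (rule prod.remove) auto
    finally have cR: "c \<le> v $ i * ?R" .
    have pos: "0 < r $ i + 2 * v $ i" using vr[of i] vA(2)[of i] by simp
    have "(r $ i + 2 * v $ i) * c \<le> (r $ i + 2 * v $ i) * (v $ i * ?R)"
      using cR pos by (intro mult_left_mono) auto
    also have "\<dots> = v $ i * ((r $ i + 2 * v $ i) * ?R)" by simp
    also have "\<dots> \<le> v $ i * ((r $ i + 2 * v $ i) * (\<Prod>j\<in>UNIV - {i}. r $ j + 2 * v $ j))"
    proof (intro mult_left_mono prod_mono conjI)
      fix j show "v $ j \<le> r $ j + 2 * v $ j" using vr[of j] by simp
      show "0 \<le> v $ j" using vA(2)[of j] by simp
    qed (use pos vA(2)[of i] in auto)
    also have "(r $ i + 2 * v $ i) * (\<Prod>j\<in>UNIV - {i}. r $ j + 2 * v $ j) = (\<Prod>j\<in>UNIV. r $ j + 2 * v $ j)"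
      by (rule prod.remove[symmetric]) auto
    also have "v $ i * \<dots> \<le> v $ i * C" using prod vA(2)[of i] by (intro mult_left_mono) auto
    finally have "r $ i + 2 * v $ i \<le> C / c * v $ i" using c_pos by (simp add: field_simps)
    moreover have "0 \<le> C / c * v $ i" using Cc vA(2)[of i] by (intro mult_nonneg_nonneg) auto
    ultimately show "\<bar>r $ i\<bar> \<le> (C / c + 2) * v $ i"
      using vr[of i] vA(2)[of i] by (simp add: distrib_right abs_le_iff)
  qed
  then show ?thesis by blast
qed

end

section \<open>Conic combinations and generators of the edge star\<close>

lemma convex_cone_hull_insert_decompose:
  assumes "x \<in> convex_cone hull (insert g S)"
  obtains \<alpha> p where "0 \<le> \<alpha>" "p \<in> convex_cone hull S" "x = \<alpha> *\<^sub>R g + p"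
proof -
  define W where "W = {x. \<exists>\<alpha>\<ge>0. \<exists>p\<in>convex_cone hull S. x = \<alpha> *\<^sub>R g + p}"
  have "convex_cone W"
    unfolding convex_cone_iff
  proof (intro conjI ballI allI impI)
    show "0 \<in> W" unfolding W_def
      by (intro CollectI exI[of _ 0] conjI bexI[of _ 0]) (auto simp: convex_cone_hull_contains_0)
  next
    fix x y assume "x \<in> W" "y \<in> W"
    then obtain \<alpha> p \<beta> q where h: "0 \<le> \<alpha>" "p \<in> convex_cone hull S" "x = \<alpha> *\<^sub>R g + p"
      "0 \<le> \<beta>" "q \<in> convex_cone hull S" "y = \<beta> *\<^sub>R g + q" unfolding W_def by blast
    have "x + y = (\<alpha> + \<beta>) *\<^sub>R g + (p + q)" using h by (simp add: algebra_simps)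
    moreover have "p + q \<in> convex_cone hull S" using h by (intro convex_cone_hull_add)
    moreover have "0 \<le> \<alpha> + \<beta>" using h by simp
    ultimately show "x + y \<in> W" unfolding W_def by blast
  next
    fix x and k :: real assume "x \<in> W" "0 \<le> k"
    then obtain \<alpha> p where h: "0 \<le> \<alpha>" "p \<in> convex_cone hull S" "x = \<alpha> *\<^sub>R g + p" unfolding W_def by blast
    have "k *\<^sub>R x = (k * \<alpha>) *\<^sub>R g + k *\<^sub>R p" using h by (simp add: algebra_simps)
    moreover have "k *\<^sub>R p \<in> convex_cone hull S" using h \<open>0 \<le> k\<close> by (intro convex_cone_hull_mul)
    moreover have "0 \<le> k * \<alpha>" using h \<open>0 \<le> k\<close> by simp
    ultimately show "k *\<^sub>R x \<in> W" unfolding W_def by blast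
  qed
  moreover have "insert g S \<subseteq> W"
  proof -
    have "g = 1 *\<^sub>R g + 0" by simp
    then have "g \<in> W" unfolding W_def using convex_cone_hull_contains_0 zero_le_one by blast
    moreover have "s \<in> W" if "s \<in> S" for s
    proof -
      have "s = 0 *\<^sub>R g + s" by simp
      then show ?thesis unfolding W_def using that hull_inc[of s S convex_cone] by (metis (mono_tags, lifting) mem_Collect_eq order_refl)
    qed
    ultimately show ?thesis by blast
  qed
  ultimately have "convex_cone hull (insert g S) \<subseteq> W" by (simp add: hull_minimal)
  then show ?thesis using assms that unfolding W_def by blast
qed

lemma conic_combination:
  assumes R: "finite R" and u: "u \<in> convex_cone hull R"
  obtains \<nu> where "\<And>r. r \<in> R \<Longrightarrow> 0 \<le> \<nu> r" "u = (\<Sum>r\<in>R. \<nu> r *\<^sub>R r)"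
proof -
  have "\<exists>\<nu>. (\<forall>r\<in>R. 0 \<le> \<nu> r) \<and> u = (\<Sum>r\<in>R. \<nu> r *\<^sub>R r)"
    using R u
  proof (induction R arbitrary: u)
    case empty
    then show ?case by simp
  next
    case (insert g R)
    obtain \<alpha> p where ap: "0 \<le> \<alpha>" "p \<in> convex_cone hull R" "u = \<alpha> *\<^sub>R g + p"
      by (rule convex_cone_hull_insert_decompose[OF insert.prems])
    obtain \<nu> where \<nu>: "\<forall>r\<in>R. 0 \<le> \<nu> r" "p = (\<Sum>r\<in>R. \<nu> r *\<^sub>R r)" using insert.IH[OF ap(2)] by blast
    have "(\<Sum>r\<in>R. (\<nu>(g := \<alpha>)) r *\<^sub>R r) = p"
      unfolding \<nu>(2) using insert.hyps by (intro sum.cong) auto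
    then have "u = (\<Sum>r\<in>insert g R. (\<nu>(g := \<alpha>)) r *\<^sub>R r)" using ap(3) insert.hyps by simp
    then show ?case using \<nu>(1) ap(1) by (intro exI[of _ "\<nu>(g := \<alpha>)"]) auto
  qed
  then show ?thesis using that by blast
qed

context irrational_unimodular_lattice
begin

lemma primitive_exists:
  assumes "g \<in> L" "g \<noteq> 0"
  obtains r q where "primitive_in L r" "0 < q" "r = q *\<^sub>R g"
proof -
  define S where "S = {q. 0 < q \<and> q \<le> 1 \<and> q *\<^sub>R g \<in> L}"
  have fin: "finite S" unfolding S_def by (rule finite_fractions[OF assms(2)])
  have "1 \<in> S" using assms by (simp add: S_def)
  define q where "q = Min S"
  have q: "q \<in> S" "\<And>q'. q' \<in> S \<Longrightarrow> q \<le> q'" using fin \<open>1 \<in> S\<close> by (auto simp: q_def intro!: Min_in)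
  have qpos: "0 < q" "q \<le> 1" "q *\<^sub>R g \<in> L" using q(1) by (auto simp: S_def)
  have "primitive_in L (q *\<^sub>R g)"
    unfolding primitive_in_def
  proof (intro conjI ballI allI impI)
    fix s k assume s: "s \<in> L" "q *\<^sub>R g = of_int k *\<^sub>R s"
    have k0: "k \<noteq> 0" using s(2) qpos assms(2) by auto
    have "(q / \<bar>of_int k\<bar>) *\<^sub>R g = (1 / \<bar>of_int k\<bar>) *\<^sub>R (of_int k *\<^sub>R s)" using s(2) by (metis scaleR_scaleR times_divide_eq_left mult_1)
    also have "\<dots> = (of_int k / \<bar>of_int k\<bar>) *\<^sub>R s" by simp
    also have "\<dots> \<in> L"
    proof (cases "0 < k")
      case True then show ?thesis using s(1) by simp
    next
      case False
      then have "of_int k / \<bar>of_int k\<bar> = (-1::real)" using k0 by simp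
      then show ?thesis using uminus_in[OF s(1)] by simp
    qed
    finally have "(q / \<bar>of_int k\<bar>) *\<^sub>R g \<in> L" .
    moreover have k1: "1 \<le> \<bar>real_of_int k\<bar>" using k0 by linarith
    then have "0 < q / \<bar>of_int k\<bar>" "q / \<bar>of_int k\<bar> \<le> 1"
      using qpos by (auto simp: divide_le_eq)
    ultimately have "q / \<bar>of_int k\<bar> \<in> S" by (simp add: S_def)
    then have "q \<le> q / \<bar>of_int k\<bar>" by (rule q(2))
    then have "q * \<bar>of_int k\<bar> \<le> q * 1" using k1 by (simp add: pos_le_divide_eq)
    then have "\<bar>real_of_int k\<bar> \<le> 1" using qpos(1) by (simp only: mult_le_cancel_left_pos)
    then show "\<bar>k\<bar> = 1" using k0 by linarith
  qed (use qpos assms in auto)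
  then show ?thesis using that qpos(1) by blast
qed

text \<open>Admissible steps along both c and -c would put v inside a segment of K.\<close>

lemma tangent_cone_pointed:
  assumes v: "{v} face_of K" and c: "c \<in> convex_cone hull ((\<lambda>y. y - v) ` positive_points)"
    "- c \<in> convex_cone hull ((\<lambda>y. y - v) ` positive_points)"
  shows "c = 0"
proof (rule ccontr)
  assume "c \<noteq> 0"
  have vA: "v \<in> positive_points" by (rule vertex_in_positive_points[OF v])
  obtain \<epsilon> \<delta> where e: "0 < \<epsilon>" "v + \<epsilon> *\<^sub>R c \<in> K" "0 < \<delta>" "v + \<delta> *\<^sub>R (- c) \<in> K"
    using tangent_direction[OF vA c(1)] tangent_direction[OF vA c(2)] by blast
  define u where "u = \<epsilon> / (\<epsilon> + \<delta>)"
  have u: "0 < u" "u < 1" using e by (auto simp: u_def)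
  have "(1 - u) * \<epsilon> - u * \<delta> = 0" using e by (simp add: u_def field_simps)
  moreover have "(1 - u) *\<^sub>R (v + \<epsilon> *\<^sub>R c) + u *\<^sub>R (v + \<delta> *\<^sub>R (- c))
      = v + ((1 - u) * \<epsilon> - u * \<delta>) *\<^sub>R c"
    by (simp add: algebra_simps)
  ultimately have "(1 - u) *\<^sub>R (v + \<epsilon> *\<^sub>R c) + u *\<^sub>R (v + \<delta> *\<^sub>R (- c)) = v" by simp
  moreover have "v + \<epsilon> *\<^sub>R c \<noteq> v + \<delta> *\<^sub>R (- c)"
  proof
    assume "v + \<epsilon> *\<^sub>R c = v + \<delta> *\<^sub>R (- c)"
    then have "(\<epsilon> + \<delta>) *\<^sub>R c = 0" by (simp add: algebra_simps)
    then show False using e \<open>c \<noteq> 0\<close> by simp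
  qed
  ultimately have "v \<in> open_segment (v + \<epsilon> *\<^sub>R c) (v + \<delta> *\<^sub>R (- c))"
    unfolding in_segment using u by (intro conjI exI[of _ u]) auto
  then show False using v e unfolding face_of_singleton extreme_point_of_def by blast
qed

text \<open>The members of a minimal generating set of the tangent cone span its extreme rays, which are
  the directions of the edges.\<close>

lemma star_generators:
  assumes v: "{v} face_of K"
  obtains R where "finite R" "R \<subseteq> star_vectors L K v"
    "\<And>y. y \<in> positive_points \<Longrightarrow> y - v \<in> convex_cone hull R"
proof -
  have vA: "v \<in> positive_points" by (rule vertex_in_positive_points[OF v])
  have vK: "v \<in> K" using vA positive_points_subset_K by blast
  let ?T = "convex_cone hull ((\<lambda>y. y - v) ` positive_points)"
  define P where "P G \<longleftrightarrow> finite G \<and> G \<subseteq> (\<lambda>y. y - v) ` positive_points \<and>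
    (\<lambda>y. y - v) ` positive_points \<subseteq> convex_cone hull G" for G
  obtain Y where Y: "finite Y" "Y \<subseteq> positive_points"
    "\<And>y. y \<in> positive_points \<Longrightarrow> y - v \<in> convex_cone hull ((\<lambda>y. y - v) ` Y)"
    using tangent_cone_finite[OF vA] by blast
  have "P ((\<lambda>y. y - v) ` Y)" unfolding P_def using Y by auto
  then obtain G where G: "P G" "\<And>H. P H \<Longrightarrow> card G \<le> card H"
    using ex_has_least_nat[of P _ card] by metis
  have Gf: "finite G" "G \<subseteq> (\<lambda>y. y - v) ` positive_points"
    and Gc: "(\<lambda>y. y - v) ` positive_points \<subseteq> convex_cone hull G" using G(1) by (auto simp: P_def)
  have GT: "convex_cone hull G \<subseteq> ?T" using Gf(2) by (rule hull_mono)
  have irredundant: "g \<notin> convex_cone hull (G - {g})" if g: "g \<in> G" for g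
  proof
    assume a: "g \<in> convex_cone hull (G - {g})"
    have "G \<subseteq> convex_cone hull (G - {g})"
      using a hull_inc[of _ "G - {g}" convex_cone] by blast
    then have "convex_cone hull G \<subseteq> convex_cone hull (G - {g})"
      using convex_cone_convex_cone_hull by (rule hull_minimal)
    then have "P (G - {g})" using Gf Gc unfolding P_def by blast
    then have "card G \<le> card (G - {g})" by (rule G(2))
    then show False using g Gf(1) card_Diff1_less[of G g] by simp
  qed
  have KC: "y - v \<in> convex_cone hull G" if "y \<in> K" for y
  proof -
    have "K \<subseteq> (+) v ` (convex_cone hull G)"
      unfolding K_eq
    proof (rule hull_minimal)
      show "positive_points \<subseteq> (+) v ` (convex_cone hull G)"
      proof
        fix y assume "y \<in> positive_points"
        then have "y - v \<in> convex_cone hull G" using Gc by blast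
        then show "y \<in> (+) v ` (convex_cone hull G)" by (intro image_eqI[of _ _ "y - v"]) auto
      qed
      show "convex ((+) v ` (convex_cone hull G))" by (intro convex_translation convex_convex_cone_hull)
    qed
    then show ?thesis using that by auto
  qed
  have star: "\<exists>r q. r \<in> star_vectors L K v \<and> 0 < q \<and> r = q *\<^sub>R g" if g: "g \<in> G" for g
  proof -
    obtain y where y: "y \<in> positive_points" "g = y - v" using Gf(2) g by blast
    have g0: "g \<noteq> 0" using irredundant[OF g] convex_cone_hull_contains_0 by metis
    have gL: "g \<in> L" using y vA by (auto simp: positive_points_iff intro: diff_in)
    obtain r q where r: "primitive_in L r" "0 < q" "r = q *\<^sub>R g" using primitive_exists[OF gL g0] by blast
    define E where "E = K \<inter> (\<lambda>s. v + s *\<^sub>R g) ` {0..}"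
    have "E face_of K"
      unfolding face_of_def
    proof (intro conjI ballI impI)
      show "E \<subseteq> K" by (simp add: E_def)
      have "(\<lambda>s. v + s *\<^sub>R g) ` {0..} = (+) v ` ((\<lambda>s. s *\<^sub>R g) ` {0..})" by (simp add: image_image)
      moreover have "convex ((\<lambda>s. s *\<^sub>R g) ` {0..})" by (rule convex_linear_image) (auto intro: linearI simp: scaleR_left_distrib)
      ultimately have "convex ((\<lambda>s. v + s *\<^sub>R g) ` {0..})" using convex_translation by metis
      then show "convex E" unfolding E_def by (intro convex_Int convex_K)
    next
      have key: "a \<in> E" "b \<in> E"
        if ab: "a \<in> K" "b \<in> K" and x: "x \<in> E" "x = (1 - u) *\<^sub>R a + u *\<^sub>R b" and u: "0 < u" "u < 1" for a b x u
      proof -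
        let ?H = "convex_cone hull (G - {g})"
        have insG: "insert g (G - {g}) = G" using g by blast
        obtain \<alpha> p where ap: "0 \<le> \<alpha>" "p \<in> ?H" "a - v = \<alpha> *\<^sub>R g + p"
          using convex_cone_hull_insert_decompose[of "a - v" g "G - {g}"] KC[OF ab(1)] insG by metis
        obtain \<beta> q where bq: "0 \<le> \<beta>" "q \<in> ?H" "b - v = \<beta> *\<^sub>R g + q"
          using convex_cone_hull_insert_decompose[of "b - v" g "G - {g}"] KC[OF ab(2)] insG by metis
        obtain s where s: "0 \<le> s" "x = v + s *\<^sub>R g" using x(1) unfolding E_def by auto
        \<comment> \<open>Comparing coefficients of g: if m were positive, g would be redundant
          among the generators. Otherwise both remainders p and q are annihilated by pointedness,
          and a and b lie on the ray of g.\<close>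
        define m where "m = s - (1 - u) * \<alpha> - u * \<beta>"
        have "a = v + \<alpha> *\<^sub>R g + p" "b = v + \<beta> *\<^sub>R g + q" using ap(3) bq(3) by (auto simp: algebra_simps)
        then have eq: "m *\<^sub>R g = (1 - u) *\<^sub>R p + u *\<^sub>R q"
          using x(2) s(2) unfolding m_def by (simp add: algebra_simps)
        have pq: "(1 - u) *\<^sub>R p \<in> ?H" "u *\<^sub>R q \<in> ?H"
          using ap(2) bq(2) u by (auto intro!: convex_cone_hull_mul)
        have HG: "?H \<subseteq> convex_cone hull G" by (rule hull_mono) auto
        have "m \<le> 0"
        proof (rule ccontr)
          assume "\<not> m \<le> 0"
          then have "g = (1 / m) *\<^sub>R ((1 - u) *\<^sub>R p + u *\<^sub>R q)" unfolding eq[symmetric] by simp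
          also have "\<dots> \<in> ?H"
            by (rule convex_cone_hull_mul[OF convex_cone_hull_add[OF pq]]) (use \<open>\<not> m \<le> 0\<close> in simp)
          finally show False using irredundant[OF g] by blast
        qed
        then have "(- m) *\<^sub>R g \<in> convex_cone hull G"
          by (intro convex_cone_hull_mul[OF hull_inc[OF g]]) simp
        then have mT: "(- m) *\<^sub>R g \<in> ?T" using GT by blast
        have pqT: "(1 - u) *\<^sub>R p \<in> ?T" "u *\<^sub>R q \<in> ?T" using pq HG GT by blast+
        have "(- m) *\<^sub>R g + u *\<^sub>R q \<in> ?T" "(- m) *\<^sub>R g + (1 - u) *\<^sub>R p \<in> ?T"
          using convex_cone_hull_add[OF mT pqT(2)] convex_cone_hull_add[OF mT pqT(1)] by simp_all
        moreover have "(- m) *\<^sub>R g + u *\<^sub>R q = - ((1 - u) *\<^sub>R p)" "(- m) *\<^sub>R g + (1 - u) *\<^sub>R p = - (u *\<^sub>R q)"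
          unfolding scaleR_minus_left eq by simp_all
        ultimately have "(1 - u) *\<^sub>R p = 0" "u *\<^sub>R q = 0"
          using tangent_cone_pointed[OF v pqT(1)] tangent_cone_pointed[OF v pqT(2)] by simp_all
        then have "p = 0" "q = 0" using u by auto
        then have "a = v + \<alpha> *\<^sub>R g" "b = v + \<beta> *\<^sub>R g" using ap(3) bq(3) by (auto simp: algebra_simps)
        then show "a \<in> E" "b \<in> E" using ab ap(1) bq(1) unfolding E_def by auto
      qed
      fix a b x assume "a \<in> K" "b \<in> K" "x \<in> E" "x \<in> open_segment a b"
      then show "a \<in> E" "b \<in> E" using key unfolding in_segment by metis+
    qed
    moreover have vE: "v \<in> E" unfolding E_def using vK by (auto intro!: image_eqI[of _ _ 0])
    moreover have yE: "y \<in> E" unfolding E_def using y positive_points_subset_K by (auto intro!: image_eqI[of _ _ 1])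
    moreover have "aff_dim E = 1"
    proof -
      have "v \<noteq> y" using g0 y(2) by auto
      have "{v, y} \<subseteq> E" using vE yE by simp
      then have "1 \<le> aff_dim E" using aff_dim_subset[of "{v, y}" E] \<open>v \<noteq> y\<close> by (simp add: aff_dim_2)
      moreover have "E \<subseteq> affine hull {v, y}" unfolding E_def affine_hull_2_alt y(2) by auto
      then have "aff_dim E \<le> aff_dim {v, y}" by (metis aff_dim_affine_hull aff_dim_subset)
      then have "aff_dim E \<le> 1" using \<open>v \<noteq> y\<close> by (simp add: aff_dim_2)
      ultimately show ?thesis by simp
    qed
    ultimately have "E edge_of K" "v \<in> E" by (auto simp: edge_of_def)
    moreover have "v + (1 / q) *\<^sub>R r \<in> E" using r(2,3) y(2) yE by simp
    ultimately have "r \<in> star_vectors L K v"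
      unfolding star_vectors_def using r(1,2) by (intro CollectI conjI exI[of _ E] exI[of _ "1 / q"]) auto
    with r show ?thesis by blast
  qed
  then obtain \<rho> q where \<rho>: "\<And>g. g \<in> G \<Longrightarrow> \<rho> g \<in> star_vectors L K v" "\<And>g. g \<in> G \<Longrightarrow> 0 < q g"
    "\<And>g. g \<in> G \<Longrightarrow> \<rho> g = q g *\<^sub>R g" by metis
  have "G \<subseteq> convex_cone hull (\<rho> ` G)"
  proof
    fix g assume g: "g \<in> G"
    have "(1 / q g) *\<^sub>R \<rho> g \<in> convex_cone hull (\<rho> ` G)"
      using g \<rho>(2)[OF g] by (intro convex_cone_hull_mul hull_inc) auto
    then show "g \<in> convex_cone hull (\<rho> ` G)" using \<rho>(2,3)[OF g] by simp
  qed
  then have "convex_cone hull G \<subseteq> convex_cone hull (\<rho> ` G)"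
    using convex_cone_convex_cone_hull by (rule hull_minimal)
  then have "\<And>y. y \<in> positive_points \<Longrightarrow> y - v \<in> convex_cone hull (\<rho> ` G)" using Gc by blast
  with \<rho>(1) Gf(1) that[of "\<rho> ` G"] show ?thesis by blast
qed

end

section \<open>Edge stars with bounded determinants\<close>

context irrational_unimodular_lattice
begin

lemma positive_shift:
  assumes "v \<in> positive_points" "u \<in> L"
  obtains N where "0 < N" "of_nat N *\<^sub>R v + u \<in> positive_points"
proof -
  have vpos: "0 < v $ i" for i using assms(1) by (simp add: positive_points_iff)
  have "\<forall>i. \<exists>m::nat. \<bar>u $ i\<bar> / v $ i < real m" using reals_Archimedean2 by blast
  then obtain m :: "'n \<Rightarrow> nat" where m: "\<And>i. \<bar>u $ i\<bar> / v $ i < real (m i)" by metis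
  define N where "N = Suc (sum m UNIV)"
  have "0 < real N * v $ i + u $ i" for i
  proof -
    have "m i \<le> sum m UNIV" by (rule member_le_sum) auto
    then have "\<bar>u $ i\<bar> / v $ i < real N" using m[of i] unfolding N_def by linarith
    then have "\<bar>u $ i\<bar> < real N * v $ i" using vpos[of i] by (simp add: divide_less_eq)
    then show ?thesis by linarith
  qed
  moreover have "of_nat N *\<^sub>R v + u \<in> L"
    using assms by (intro add_in of_nat_scaleR_in) (auto simp: positive_points_iff)
  ultimately have "of_nat N *\<^sub>R v + u \<in> positive_points" by (simp add: positive_points_iff)
  then show ?thesis using that[of N] unfolding N_def by simp
qed

lemma star_vector_in:
  assumes "{v} face_of K" "r \<in> star_vectors L K v"
  shows "r \<in> L" "r \<noteq> 0" "v + r \<in> positive_points" "r \<in> convex_cone hull ((\<lambda>y. y - v) ` positive_points)"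
proof -
  show "r \<in> L" "r \<noteq> 0" using assms(2) by (auto simp: star_vectors_def primitive_in_def)
  show *: "v + r \<in> positive_points" using star_vector_facts[OF assms] by metis
  show "r \<in> convex_cone hull ((\<lambda>y. y - v) ` positive_points)"
    by (rule hull_inc, rule image_eqI[of _ _ "v + r"]) (use * in simp_all)
qed

text \<open>The cone contains 2 v - v = v, and every lattice vector enters the orthant after adding
  a multiple of v, so its difference with v lies in the cone.\<close>

lemma span_star_generators:
  assumes v: "v \<in> positive_points" and "finite R"
    and gen: "\<And>y. y \<in> positive_points \<Longrightarrow> y - v \<in> convex_cone hull R"
  shows "span R = UNIV"
proof -
  have cone: "convex_cone hull R \<subseteq> span R"
  proof
    fix u assume "u \<in> convex_cone hull R"
    then obtain \<nu> where "u = (\<Sum>r\<in>R. \<nu> r *\<^sub>R r)" using conic_combination[OF \<open>finite R\<close>] by metis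
    moreover have "(\<Sum>r\<in>R. \<nu> r *\<^sub>R r) \<in> span R" by (intro span_sum span_scale span_base)
    ultimately show "u \<in> span R" by simp
  qed
  have "2 *\<^sub>R v \<in> positive_points" using positive_points_scale[OF v, of 2] by simp
  then have "2 *\<^sub>R v - v \<in> span R" using gen cone by blast
  then have vs: "v \<in> span R" by (simp add: scaleR_2)
  have "L \<subseteq> span R"
  proof
    fix u assume "u \<in> L"
    then obtain N where "of_nat N *\<^sub>R v + u \<in> positive_points" using positive_shift[OF v] by blast
    then have "(of_nat N *\<^sub>R v + u) - v \<in> span R" using gen cone by blast
    then have *: "(of_nat N *\<^sub>R v + u) - v \<in> span R" .
    have "((of_nat N *\<^sub>R v + u) - v) + (v - of_nat N *\<^sub>R v) \<in> span R"
      by (intro span_add[OF *] span_diff span_scale vs)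
    then show "u \<in> span R" by simp
  qed
  then have "span L \<subseteq> span R" by (rule span_minimal) simp
  then show ?thesis using span_L by blast
qed

text \<open>A facet through v that misses v + \<open>g k\<close> has a normal b with value 1 at v,
  nonnegative on all edge vectors and at least 1 / D on \<open>g k\<close>. Evaluating b on the
  representation of v isolates \<open>c k\<close>.\<close>

lemma star_coefficient_le:
  assumes v: "{v} face_of K" and D: "\<And>F. F facet_of K \<Longrightarrow> facet_det F \<le> ennreal D"
    and I: "finite I" and g: "\<And>i. i \<in> I \<Longrightarrow> g i \<in> star_vectors L K v"
    and c: "\<And>i. i \<in> I \<Longrightarrow> 0 \<le> c i" "v = (\<Sum>i\<in>I. c i *\<^sub>R g i)" and k: "k \<in> I"
  shows "c k \<le> D"
proof -
  have AK: "v + g i \<in> K" if "i \<in> I" for i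
    using star_vector_in(3)[OF v g[OF that]] positive_points_subset_K by blast
  obtain F where F: "F facet_of K" "v \<in> F" "v + g k \<notin> F"
    using facet_avoiding[OF v AK[OF k]] star_vector_in(2)[OF v g[OF k]] by auto
  obtain b where b: "\<And>p. p \<in> F \<Longrightarrow> b \<bullet> p = 1" "\<And>p. p \<in> K \<Longrightarrow> 1 \<le> b \<bullet> p" using facet_normal[OF F(1)] by blast
  have bv: "b \<bullet> v = 1" using b(1) F(2) by blast
  have nonneg: "0 \<le> b \<bullet> g i" if "i \<in> I" for i using b(2)[OF AK[OF that]] bv by (simp add: inner_add_right)
  have "b \<bullet> g k \<noteq> 0"
  proof
    assume "b \<bullet> g k = 0"
    then have "b \<bullet> (v + g k) = 1" using bv by (simp add: inner_add_right)
    then have "v + g k \<in> F" using facet_normal_mem[OF F(1) b AK[OF k]] by blast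
    then show False using F(3) by blast
  qed
  then have pos: "0 < b \<bullet> g k" using nonneg[OF k] by simp
  have D1: "1 \<le> D" and low: "1 / D \<le> b \<bullet> g k"
    using facet_normal_lattice_value[OF F(1) D[OF F(1)] b(1)] star_vector_in(1)[OF v g[OF k]] pos by blast+
  have "c k * (1 / D) \<le> c k * (b \<bullet> g k)" using low c(1)[OF k] by (rule mult_left_mono)
  also have "\<dots> \<le> (\<Sum>i\<in>I. c i * (b \<bullet> g i))"
    by (rule member_le_sum[OF k]) (use I c nonneg in auto)
  also have "\<dots> = b \<bullet> (\<Sum>i\<in>I. c i *\<^sub>R g i)" by (simp add: inner_sum_right)
  also have "\<dots> = 1" using c(2) bv by simp
  finally show ?thesis using D1 by (simp add: field_simps)
qed

text \<open>A version of Caratheodory's theorem in which a prescribed generator j keeps a positive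
  coefficient: among such representations of v one of least support is independent and can be
  completed to a basis from R.\<close>

lemma star_simplicial_representation:
  assumes v: "{v} face_of K" and R: "finite R" "R \<subseteq> star_vectors L K v"
    and gen: "\<And>y. y \<in> positive_points \<Longrightarrow> y - v \<in> convex_cone hull R" and j: "j \<in> R"
  obtains g c k where "\<And>i. g i \<in> R" "det (\<chi> i. g i) \<noteq> 0" "g k = j" "0 < c k" "\<And>i. 0 \<le> c i"
    "v = (\<Sum>i\<in>UNIV. c i *\<^sub>R g i)"
proof -
  have vA: "v \<in> positive_points" by (rule vertex_in_positive_points[OF v])
  have facts: "r \<in> L" "r \<noteq> 0" "r \<in> convex_cone hull ((\<lambda>y. y - v) ` positive_points)" if "r \<in> R" for r
    using star_vector_in[OF v] R(2) that by blast+
  define Q where "Q \<nu> \<longleftrightarrow> (\<forall>r\<in>R. 0 \<le> \<nu> r) \<and> v = (\<Sum>r\<in>R. \<nu> r *\<^sub>R r) \<and> 0 < \<nu> j" for \<nu> :: "real^'n \<Rightarrow> real"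
  define N where "N \<nu> = card {r \<in> R. \<nu> r \<noteq> 0}" for \<nu> :: "real^'n \<Rightarrow> real"
  have "\<exists>\<nu>. Q \<nu>"
  proof -
    \<comment> \<open>A large multiple of v remains in the cone after subtracting j, so j occurs
      with positive weight in that multiple.\<close>
    have "v - j \<in> L" using vA facts(1)[OF j] by (auto simp: positive_points_iff intro: diff_in)
    then obtain M where M: "0 < M" "of_nat M *\<^sub>R v + (v - j) \<in> positive_points" using positive_shift[OF vA] by blast
    have "of_nat M *\<^sub>R v + (v - j) - v \<in> convex_cone hull R" by (rule gen[OF M(2)])
    then have "of_nat M *\<^sub>R v - j \<in> convex_cone hull R" by (simp add: algebra_simps)
    then obtain \<mu> where \<mu>: "\<And>r. r \<in> R \<Longrightarrow> 0 \<le> \<mu> r" "of_nat M *\<^sub>R v - j = (\<Sum>r\<in>R. \<mu> r *\<^sub>R r)"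
      using conic_combination[OF R(1)] by metis
    have "(\<Sum>r\<in>R. (\<mu> r + (if r = j then 1 else 0)) *\<^sub>R r) = (\<Sum>r\<in>R. \<mu> r *\<^sub>R r) + (\<Sum>r\<in>R. if r = j then r else 0)"
      unfolding sum.distrib[symmetric] by (rule sum.cong) (auto simp: scaleR_left_distrib)
    also have "\<dots> = of_nat M *\<^sub>R v" unfolding \<mu>(2)[symmetric] using j R(1) by simp
    finally have "v = (1 / of_nat M) *\<^sub>R (\<Sum>r\<in>R. (\<mu> r + (if r = j then 1 else 0)) *\<^sub>R r)" using M(1) by simp
    also have "\<dots> = (\<Sum>r\<in>R. ((\<mu> r + (if r = j then 1 else 0)) / of_nat M) *\<^sub>R r)"
      by (simp add: scaleR_sum_right)
    finally have "Q (\<lambda>r. (\<mu> r + (if r = j then 1 else 0)) / of_nat M)"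
      unfolding Q_def using M(1) \<mu>(1) j by (auto intro!: divide_nonneg_nonneg divide_pos_pos add_nonneg_nonneg add_nonneg_pos)
    then show ?thesis by blast
  qed
  then obtain \<nu> where \<nu>: "Q \<nu>" "\<And>\<mu>. Q \<mu> \<Longrightarrow> N \<nu> \<le> N \<mu>" using ex_has_least_nat[of Q _ N] by metis
  define S where "S = {r \<in> R. \<nu> r \<noteq> 0}"
  have S: "finite S" "S \<subseteq> R" "j \<in> S" using R(1) \<nu>(1) j by (auto simp: S_def Q_def)
  have \<nu>pos: "0 < \<nu> r" if "r \<in> S" for r using that \<nu>(1) unfolding S_def Q_def by force
  have vS: "v = (\<Sum>r\<in>S. \<nu> r *\<^sub>R r)"
  proof -
    have "v = (\<Sum>r\<in>R. \<nu> r *\<^sub>R r)" using \<nu>(1) by (simp add: Q_def)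
    also have "\<dots> = (\<Sum>r\<in>S. \<nu> r *\<^sub>R r)" unfolding S_def by (rule sum.mono_neutral_right) (use R(1) in auto)
    finally show ?thesis .
  qed
  have "independent S"
  proof
    assume "dependent S"
    then obtain d0 where d0: "\<exists>r\<in>S. d0 r \<noteq> 0" "(\<Sum>r\<in>S. d0 r *\<^sub>R r) = 0"
      using dependent_finite[OF S(1)] by auto
    \<comment> \<open>The sign is chosen so that moving along -d never lowers the weight of
      j.\<close>
    define d where "d r = (if d0 j \<le> 0 then d0 r else - d0 r)" for r
    have d: "\<exists>r\<in>S. d r \<noteq> 0" "d j \<le> 0" using d0(1) by (auto simp: d_def)
    have dsum: "(\<Sum>r\<in>S. d r *\<^sub>R r) = 0"
      using d0(2) by (cases "d0 j \<le> 0") (simp_all add: d_def sum_negf)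
    \<comment> \<open>With all coefficients of one sign, the relation would exhibit a nonzero vector
      and its negative in the tangent cone, contrary to pointedness. A positive coefficient is what
      makes some weight reach 0 when moving along -d.\<close>
    have "\<exists>r\<in>S. 0 < d r"
    proof (rule ccontr)
      assume "\<not> ?thesis"
      then have neg: "\<And>r. r \<in> S \<Longrightarrow> d r \<le> 0" by force
      obtain r0 where r0: "r0 \<in> S" "d r0 < 0" using d(1) neg by force
      let ?T = "convex_cone hull ((\<lambda>y. y - v) ` positive_points)"
      have inT: "(- d r) *\<^sub>R r \<in> ?T" if "r \<in> S" for r
        using facts(3)[of r] S(2) that neg[OF that] by (intro convex_cone_hull_mul) auto
      have "0 = d r0 *\<^sub>R r0 + (\<Sum>r\<in>S - {r0}. d r *\<^sub>R r)" using dsum sum.remove[OF S(1) r0(1), of "\<lambda>r. d r *\<^sub>R r"] by simp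
      then have "- ((- d r0) *\<^sub>R r0) = (\<Sum>r\<in>S - {r0}. (- d r) *\<^sub>R r)" by (simp add: sum_negf eq_neg_iff_add_eq_0)
      also have "\<dots> \<in> ?T" using inT by (intro sum_in_convex_cone_hull) auto
      finally have "(- d r0) *\<^sub>R r0 = 0" using tangent_cone_pointed[OF v inT[OF r0(1)]] by blast
      then show False using r0 facts(2) S(2) by auto
    qed
    then obtain r1 where r1: "r1 \<in> S" "0 < d r1" by blast
    define P where "P = {r \<in> S. 0 < d r}"
    have P: "finite P" "P \<noteq> {}" using S(1) r1 by (auto simp: P_def)
    define t where "t = Min ((\<lambda>r. \<nu> r / d r) ` P)"
    have "t \<in> (\<lambda>r. \<nu> r / d r) ` P" unfolding t_def using P by (intro Min_in) auto
    then obtain r2 where r2: "r2 \<in> P" "t = \<nu> r2 / d r2" by blast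
    have t0: "0 \<le> t" using r2 \<nu>pos[of r2] by (auto simp: P_def)
    define \<mu> where "\<mu> r = (if r \<in> S then \<nu> r - t * d r else 0)" for r
    have \<mu>nn: "0 \<le> \<mu> r" for r
    proof (cases "r \<in> P")
      case True
      then have "t \<le> \<nu> r / d r" unfolding t_def using P(1) by (intro Min_le) auto
      then show ?thesis using True by (auto simp: \<mu>_def P_def field_simps)
    next
      case False
      show ?thesis
      proof (cases "r \<in> S")
        case True
        then have "d r \<le> 0" using False by (auto simp: P_def)
        then have "t * d r \<le> 0" using t0 by (rule mult_nonneg_nonpos[rotated])
        then show ?thesis using \<nu>pos[OF True] True by (simp add: \<mu>_def)
      qed (simp add: \<mu>_def)
    qed
    have "(\<Sum>r\<in>R. \<mu> r *\<^sub>R r) = (\<Sum>r\<in>S. \<mu> r *\<^sub>R r)"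
      by (rule sum.mono_neutral_right) (use R(1) S(2) in \<open>auto simp: \<mu>_def\<close>)
    also have "\<dots> = (\<Sum>r\<in>S. \<nu> r *\<^sub>R r) - t *\<^sub>R (\<Sum>r\<in>S. d r *\<^sub>R r)"
      unfolding scaleR_sum_right sum_subtractf[symmetric]
      by (rule sum.cong) (auto simp: \<mu>_def scaleR_left_diff_distrib)
    also have "\<dots> = v" using vS dsum by simp
    finally have "(\<Sum>r\<in>R. \<mu> r *\<^sub>R r) = v" .
    moreover have "0 < \<mu> j"
    proof -
      have "t * d j \<le> 0" using t0 d(2) by (rule mult_nonneg_nonpos)
      then show ?thesis using \<nu>pos[OF S(3)] S(3) by (simp add: \<mu>_def)
    qed
    ultimately have "Q \<mu>" unfolding Q_def using \<mu>nn by simp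
    then have "card S \<le> N \<mu>" using \<nu>(2) unfolding N_def S_def by blast
    moreover have "{r \<in> R. \<mu> r \<noteq> 0} \<subset> S"
    proof -
      have "\<mu> r2 = 0" "r2 \<in> S" using r2 by (auto simp: \<mu>_def P_def)
      moreover have "{r \<in> R. \<mu> r \<noteq> 0} \<subseteq> S" by (auto simp: \<mu>_def split: if_splits)
      ultimately show ?thesis by blast
    qed
    then have "N \<mu> < card S" unfolding N_def by (rule psubset_card_mono[OF S(1)])
    ultimately show False by simp
  qed
  then obtain B where B: "S \<subseteq> B" "B \<subseteq> R" "independent B" "R \<subseteq> span B"
    using maximal_independent_subset_extend[OF S(2)] by blast
  have "span R \<subseteq> span B" using B(4) by (rule span_minimal) simp
  then have "span B = UNIV" using span_star_generators[OF vA R(1) gen] by blast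
  then obtain g :: "'n \<Rightarrow> real^'n" where g: "bij_betw g UNIV B" "det (\<chi> i. g i) \<noteq> 0" using enum_basis[OF B(3)] by blast
  have gB: "g i \<in> B" for i using g(1) by (auto simp: bij_betw_def)
  obtain k where k: "g k = j" using g(1) S(3) B(1) unfolding bij_betw_def by blast
  have fB: "finite B" using B(2) R(1) by (rule finite_subset)
  have "(\<Sum>i\<in>UNIV. \<nu> (g i) *\<^sub>R g i) = (\<Sum>r\<in>B. \<nu> r *\<^sub>R r)"
    using sum.reindex_bij_betw[OF g(1), of "\<lambda>r. \<nu> r *\<^sub>R r"] by simp
  also have "\<dots> = (\<Sum>r\<in>S. \<nu> r *\<^sub>R r)"
    by (rule sum.mono_neutral_right) (use fB B(1,2) in \<open>auto simp: S_def\<close>)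
  finally have "v = (\<Sum>i\<in>UNIV. \<nu> (g i) *\<^sub>R g i)" using vS by simp
  moreover have "0 \<le> \<nu> (g i)" for i using \<nu>(1) gB B(2) unfolding Q_def by blast
  moreover have "0 < \<nu> (g k)" using \<nu>(1) k by (simp add: Q_def)
  moreover have "g i \<in> R" for i using gB B(2) by blast
  ultimately show ?thesis using that[of g k "\<lambda>i. \<nu> (g i)"] g(2) k by blast
qed

text \<open>Replacing row k by v shows that \<open>c k\<close> times the determinant of g is a
  nonzero integer, so \<open>c k\<close> is at least 1 / D. The other coefficients are at most D,
  and edge vectors are bounded below by -v because v + r is positive. Solving the representation of
  v for j bounds j from above.\<close>

lemma star_generator_coordinates:
  fixes D :: real
  assumes v: "{v} face_of K" and D: "\<And>F. F facet_of K \<Longrightarrow> facet_det F \<le> ennreal D"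
    and S: "star_det L K v \<le> ennreal D" and D1: "1 \<le> D"
    and R: "finite R" "R \<subseteq> star_vectors L K v"
    and gen: "\<And>y. y \<in> positive_points \<Longrightarrow> y - v \<in> convex_cone hull R" and j: "j \<in> R"
  shows "\<bar>j $ l\<bar> \<le> D * (1 + CARD('n) * D) * v $ l"
proof -
  obtain g c k where g: "\<And>i. g i \<in> R" "det (\<chi> i. g i) \<noteq> 0" "g k = j" and c: "0 < c k" "\<And>i. 0 \<le> c i"
    and veq: "v = (\<Sum>i\<in>UNIV. c i *\<^sub>R g i)"
    using star_simplicial_representation[OF v R gen j] by metis
  have vA: "v \<in> positive_points" by (rule vertex_in_positive_points[OF v])
  then have vl: "v \<in> L" "0 < v $ l" by (auto simp: positive_points_iff)
  have gs: "g i \<in> star_vectors L K v" for i using g(1) R(2) by blast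
  have cD: "c i \<le> D" for i
    by (rule star_coefficient_le[OF v D, of UNIV g]) (use gs c(2) veq in auto)
  have gl: "- (v $ l) \<le> g i $ l" for i
  proof -
    have "v + g i \<in> positive_points" by (rule star_vector_in(3)[OF v gs])
    then have "0 < (v + g i) $ l" unfolding positive_points_iff by blast
    then show ?thesis by simp
  qed
  have det1: "1 \<le> c k * \<bar>det (\<chi> i. g i)\<bar>"
  proof -
    have "det (\<chi> i. (g(k := v)) i) = c k * det (\<chi> i. g i)" by (rule det_replace_row[OF veq])
    moreover from this have "1 \<le> \<bar>det (\<chi> i. (g(k := v)) i)\<bar>"
      using c(1) g(2) vl(1) star_vector_in(1)[OF v gs] by (intro abs_det_ge_1) auto
    ultimately show ?thesis using c(1) by (simp add: abs_mult)
  qed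
  have "ennreal \<bar>det (\<chi> i. g i)\<bar> \<le> ennreal D"
    using abs_det_le_det_sum[of g "star_vectors L K v"] gs S unfolding star_det_def by (meson image_subsetI order_trans)
  then have "\<bar>det (\<chi> i. g i)\<bar> \<le> D" using D1 by (simp add: ennreal_le_iff)
  then have "c k * \<bar>det (\<chi> i. g i)\<bar> \<le> c k * D" using c(1) by (intro mult_left_mono) auto
  then have ckD: "1 \<le> c k * D" using det1 by linarith
  have "c k * j $ l + (\<Sum>i\<in>UNIV - {k}. c i * g i $ l) = v $ l"
    using sum.remove[of UNIV k "\<lambda>i. c i * g i $ l"] g(3) arg_cong[OF veq, of "\<lambda>x. x $ l"] by (simp add: sum_component)
  moreover have "- (CARD('n) * D * v $ l) \<le> (\<Sum>i\<in>UNIV - {k}. c i * g i $ l)"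
  proof -
    have "- (CARD('n) * D * v $ l) \<le> (\<Sum>i\<in>UNIV - {k}. - (D * v $ l))"
      using D1 vl(2) mult_right_mono[of "real (CARD('n) - 1)" "real CARD('n)" "D * v $ l"] by (simp add: card_Diff_singleton mult.assoc)
    also have "\<dots> \<le> (\<Sum>i\<in>UNIV - {k}. c i * g i $ l)"
    proof (rule sum_mono)
      fix i
      have "c i * (- (v $ l)) \<le> c i * g i $ l" using gl c(2) by (rule mult_left_mono)
      moreover have "c i * v $ l \<le> D * v $ l" using cD vl(2) by (intro mult_right_mono) auto
      ultimately show "- (D * v $ l) \<le> c i * g i $ l" by simp
    qed
    finally show ?thesis .
  qed
  ultimately have up: "c k * j $ l \<le> (1 + CARD('n) * D) * v $ l" by (simp add: algebra_simps)
  have X: "1 \<le> D * (1 + CARD('n) * D)"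
    using mult_mono[of 1 D 1 "1 + CARD('n) * D"] D1 by simp
  have "j $ l \<le> D * (1 + CARD('n) * D) * v $ l"
  proof (cases "0 \<le> j $ l")
    case True
    then have "1 * (j $ l) \<le> c k * D * (j $ l)" using ckD by (intro mult_right_mono)
    also have "\<dots> = D * (c k * j $ l)" by simp
    also have "\<dots> \<le> D * ((1 + CARD('n) * D) * v $ l)" using up D1 by (intro mult_left_mono) auto
    finally show ?thesis by simp
  next
    case False
    have "0 \<le> D * (1 + CARD('n) * D) * v $ l"
      by (rule mult_nonneg_nonneg) (use X vl(2) in linarith)+
    then show ?thesis using False by linarith
  qed
  moreover have "- (D * (1 + CARD('n) * D) * v $ l) \<le> j $ l"
    using gl[of k] mult_right_mono[OF X, of "v $ l"] vl(2) unfolding g(3) by linarith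
  ultimately show ?thesis unfolding abs_le_iff by linarith
qed

text \<open>Since b is nonnegative on the edge vectors at v, lattice points of F use only those with
  \<open>b \<bullet> r = 0\<close>. Hence v and the points v + r of F span the space, and by
  Cramer's rule p has coefficients of size at most D in a basis chosen among them.\<close>

lemma facet_coordinates:
  fixes D M :: real
  assumes F: "F facet_of K" "v \<in> F" "facet_det F \<le> ennreal D" and v: "{v} face_of K"
    and R: "finite R" "R \<subseteq> star_vectors L K v" "\<And>r i. r \<in> R \<Longrightarrow> \<bar>r $ i\<bar> \<le> M * v $ i" and M: "0 \<le> M"
    and gen: "\<And>y. y \<in> positive_points \<Longrightarrow> y - v \<in> convex_cone hull R" and p: "p \<in> F"
  shows "\<bar>p $ l\<bar> \<le> CARD('n) * D * (1 + M) * v $ l"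
proof -
  have vA: "v \<in> positive_points" by (rule vertex_in_positive_points[OF v])
  then have vl: "v \<in> L" "\<And>i. 0 < v $ i" by (auto simp: positive_points_iff)
  have FK: "F face_of K" by (rule facet_is_face[OF F(1)])
  obtain b where b: "\<And>p. p \<in> F \<Longrightarrow> b \<bullet> p = 1" "\<And>p. p \<in> K \<Longrightarrow> 1 \<le> b \<bullet> p" using facet_normal[OF F(1)] by blast
  have D1: "1 \<le> D" using facet_normal_lattice_value(1)[OF F(1,3) b(1)] by blast
  have bv: "b \<bullet> v = 1" using b(1) F(2) by blast
  have RK: "v + r \<in> K" "r \<in> L" "v + r \<in> positive_points" if "r \<in> R" for r
    using star_vector_in[OF v] R(2) that positive_points_subset_K by blast+
  have br: "0 \<le> b \<bullet> r" if "r \<in> R" for r using b(2)[OF RK(1)[OF that]] bv by (simp add: inner_add_right)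
  define W where "W = insert v ((\<lambda>r. v + r) ` {r \<in> R. b \<bullet> r = 0})"
  have WF: "w \<in> F" "w \<in> L" "\<bar>w $ i\<bar> \<le> (1 + M) * v $ i" if "w \<in> W" for w i
  proof -
    have "w = v \<or> (\<exists>r\<in>R. b \<bullet> r = 0 \<and> w = v + r)" using that by (auto simp: W_def)
    then show "w \<in> F" "w \<in> L" "\<bar>w $ i\<bar> \<le> (1 + M) * v $ i"
    proof -
      assume a: "w = v \<or> (\<exists>r\<in>R. b \<bullet> r = 0 \<and> w = v + r)"
      show "w \<in> F" using a F(2) facet_normal_mem[OF F(1) b RK(1)] bv by (auto simp: inner_add_right)
      show "w \<in> L" using a vl(1) RK(2) by (auto intro: add_in)
      have "0 \<le> M * v $ i" using M vl(2)[of i] by simp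
      then show "\<bar>w $ i\<bar> \<le> (1 + M) * v $ i"
        using a
      proof (elim disjE bexE conjE)
        assume "w = v" then show ?thesis using \<open>0 \<le> M * v $ i\<close> vl(2)[of i] by (simp add: algebra_simps)
      next
        fix r assume "r \<in> R" "w = v + r"
        then show ?thesis using R(3)[of r i] vl(2)[of i] unfolding abs_le_iff by (simp add: algebra_simps)
      qed
    qed
  qed
  have "positive_points \<inter> F \<subseteq> span W"
  proof
    fix y assume y: "y \<in> positive_points \<inter> F"
    then obtain \<mu> where \<mu>: "\<And>r. r \<in> R \<Longrightarrow> 0 \<le> \<mu> r" "y - v = (\<Sum>r\<in>R. \<mu> r *\<^sub>R r)"
      using conic_combination[OF R(1) gen] by (metis IntD1)
    have "(\<Sum>r\<in>R. \<mu> r * (b \<bullet> r)) = b \<bullet> (y - v)" unfolding \<mu>(2) by (simp add: inner_sum_right)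
    also have "\<dots> = 0" using b(1) y bv by (simp add: inner_diff_right)
    finally have sum0: "(\<Sum>r\<in>R. \<mu> r * (b \<bullet> r)) = 0" .
    have "\<forall>r\<in>R. \<mu> r * (b \<bullet> r) = 0"
      by (rule iffD1[OF sum_nonneg_eq_0_iff[OF R(1)] sum0]) (intro mult_nonneg_nonneg \<mu>(1) br)
    then have zero: "\<mu> r = 0 \<or> b \<bullet> r = 0" if "r \<in> R" for r using that by simp
    have vW: "v \<in> span W" by (rule span_base) (simp add: W_def)
    have "\<mu> r *\<^sub>R r \<in> span W" if r: "r \<in> R" for r
    proof (cases "b \<bullet> r = 0")
      case True
      then have "v + r \<in> span W" using r by (intro span_base) (auto simp: W_def)
      then have "(v + r) - v \<in> span W" using vW by (rule span_diff)
      then show ?thesis by (simp add: span_scale)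
    qed (use zero[OF r] in \<open>simp add: span_zero\<close>)
    then have "y - v \<in> span W" unfolding \<mu>(2) by (rule span_sum)
    then have "(y - v) + v \<in> span W" using vW by (rule span_add)
    then show "y \<in> span W" by simp
  qed
  then have "span (positive_points \<inter> F) \<subseteq> span W" by (rule span_minimal) simp
  then have "span W = UNIV" using facet_points_span[OF F(1)] by blast
  moreover obtain B where B: "B \<subseteq> W" "independent B" "W \<subseteq> span B" using maximal_independent_subset[of W] by blast
  ultimately have "span B = UNIV" using span_minimal[OF B(3)] by auto
  then obtain g :: "'n \<Rightarrow> real^'n" where g: "bij_betw g UNIV B" "det (\<chi> i. g i) \<noteq> 0" using enum_basis[OF B(2)] by blast
  have gW: "g i \<in> W" for i using g(1) B(1) by (auto simp: bij_betw_def)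
  obtain \<alpha> where \<alpha>: "p = (\<Sum>i\<in>UNIV. \<alpha> i *\<^sub>R g i)" using det_nz_expand[OF g(2)] by blast
  have \<alpha>D: "\<bar>\<alpha> k\<bar> \<le> D" for k
  proof -
    have "\<bar>\<alpha> k\<bar> * 1 \<le> \<bar>\<alpha> k\<bar> * \<bar>det (\<chi> i. g i)\<bar>"
      using abs_det_ge_1[of g] g(2) WF(2)[OF gW] by (intro mult_left_mono) auto
    also have "\<dots> = \<bar>det (\<chi> i. (g(k := p)) i)\<bar>" using det_replace_row[OF \<alpha>, of k] by (simp add: abs_mult)
    also have "\<dots> \<le> max D 0" by (rule facet_det_bound[OF FK _ F(3)]) (use WF(1)[OF gW] p in auto)
    finally show ?thesis using D1 by simp
  qed
  have "\<bar>p $ l\<bar> \<le> (\<Sum>i\<in>UNIV. \<bar>\<alpha> i * g i $ l\<bar>)" unfolding \<alpha> by (simp add: sum_component sum_abs)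
  also have "\<dots> \<le> (\<Sum>i\<in>(UNIV::'n set). D * ((1 + M) * v $ l))"
    unfolding abs_mult by (intro sum_mono mult_mono \<alpha>D WF(3)[OF gW]) (use D1 in auto)
  finally show ?thesis by (simp add: mult.assoc)
qed

end

section \<open>Rays meeting the sail\<close>

context irrational_unimodular_lattice
begin

text \<open>Caratheodory's theorem writes z with at most n + 1 vertices, one of which has weight at
  least 1 / (n + 1); all coordinates being positive, the other summands only help.\<close>

lemma vertex_below:
  assumes F: "F face_of K" and z: "z \<in> F"
  obtains v where "{v} face_of K" "v \<in> F" "\<And>i. v $ i \<le> (CARD('n) + 1) * z $ i"
proof -
  have "z \<in> convex hull (vertices F)" using z face_eq_hull_vertices[OF F] by metis
  then obtain S u where S: "finite S" "S \<subseteq> vertices F" "card S \<le> DIM(real^'n) + 1"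
    and u: "\<And>x. x \<in> S \<Longrightarrow> 0 \<le> u x" "sum u S = 1" and zS: "(\<Sum>v\<in>S. u v *\<^sub>R v) = z"
    unfolding convex_hull_caratheodory by blast
  have "\<exists>v\<in>S. 1 / (CARD('n) + 1) \<le> u v"
  proof (rule ccontr)
    assume "\<not> ?thesis"
    then have less: "\<And>v. v \<in> S \<Longrightarrow> u v < 1 / (CARD('n) + 1)" by force
    have "0 < card S" using u(2) S(1) by (auto simp: card_gt_0_iff)
    then have "sum u S < of_nat (card S) * (1 / (CARD('n) + 1))" using less by (intro sum_bounded_above_strict)
    also have "\<dots> \<le> 1" using S(3) by (simp add: divide_le_eq)
    finally show False using u(2) by simp
  qed
  then obtain v where v: "v \<in> S" "1 / (CARD('n) + 1) \<le> u v" by blast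
  have vert: "w \<in> F" "{w} face_of K" if "w \<in> S" for w using S(2) that unfolding vertices_face[OF F] by auto
  have pos: "0 < w $ i" if "w \<in> S" for w i
    using vert(1)[OF that] face_of_imp_subset[OF F] K_pos by blast
  have "v $ i \<le> (CARD('n) + 1) * z $ i" for i
  proof -
    have "1 / (CARD('n) + 1) * v $ i \<le> u v * v $ i" using v(2) pos[OF v(1), of i] by (intro mult_right_mono) auto
    also have "\<dots> \<le> (\<Sum>w\<in>S. u w * w $ i)"
    proof (rule member_le_sum[OF v(1) _ S(1)])
      fix w assume "w \<in> S - {v}"
      then show "0 \<le> u w * w $ i" using u(1) pos[of w i] by simp
    qed
    also have "\<dots> = z $ i" unfolding zS[symmetric] by (simp add: sum_component)
    finally show ?thesis by (simp add: field_simps)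
  qed
  then show ?thesis using that vert[OF v(1)] by blast
qed

text \<open>The first point z of the closed set K on the ray is a boundary point and has a
  supporting hyperplane. Since z need not be a lattice point, the facet is obtained at a vertex of
  the exposed face instead; it contains all points of K on that hyperplane.\<close>

lemma facet_on_ray:
  assumes \<tau>: "\<And>i. 0 < \<tau> $ i"
  obtains s F where "0 < s" "s *\<^sub>R \<tau> \<in> F" "F facet_of K"
proof -
  define T where "T = {s. s *\<^sub>R \<tau> \<in> K}"
  have "T = (\<lambda>s. s *\<^sub>R \<tau>) -` K" by (auto simp: T_def)
  then have "closed T" by (auto intro!: closed_vimage closed_K continuous_intros)
  have pos: "0 < s" if "s \<in> T" for s
  proof -
    have "0 < s * \<tau> $ i" for i using K_pos[of "s *\<^sub>R \<tau>" i] that unfolding T_def by simp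
    then show ?thesis using \<tau> zero_less_mult_pos2 by blast
  qed
  obtain x where x: "x \<in> positive_points" by (rule positive_points_nonempty)
  have "(\<Sum>i\<in>UNIV. x $ i / \<tau> $ i) *\<^sub>R \<tau> \<in> K"
  proof (rule K_upward)
    show "x \<in> K" using x positive_points_subset_K by blast
    fix i
    have "x $ i / \<tau> $ i \<le> (\<Sum>i\<in>UNIV. x $ i / \<tau> $ i)"
      by (rule member_le_sum) (use x \<tau> in \<open>auto simp: positive_points_iff less_imp_le\<close>)
    then show "x $ i \<le> ((\<Sum>i\<in>UNIV. x $ i / \<tau> $ i) *\<^sub>R \<tau>) $ i" using \<tau>[of i] by (simp add: divide_le_eq)
  qed
  then have ne: "T \<noteq> {}" by (auto simp: T_def)
  have bdd: "bdd_below T" using pos by (intro bdd_belowI[of _ 0]) (auto intro: less_imp_le)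
  define s where "s = Inf T"
  have "s \<in> T" unfolding s_def by (rule closed_contains_Inf[OF ne bdd \<open>closed T\<close>])
  define z where "z = s *\<^sub>R \<tau>"
  have z: "z \<in> K" using \<open>s \<in> T\<close> by (simp add: T_def z_def)
  have "z \<notin> interior K"
  proof
    assume "z \<in> interior K"
    then obtain e where e: "0 < e" "ball z e \<subseteq> K" by (auto simp: mem_interior)
    have "\<tau> \<noteq> 0" using \<tau> by (metis less_irrefl zero_index)
    define d where "d = e / (2 * norm \<tau>)"
    have d: "0 < d" "d * norm \<tau> < e" using e(1) \<open>\<tau> \<noteq> 0\<close> by (auto simp: d_def field_simps)
    have "dist z ((s - d) *\<^sub>R \<tau>) < e"
      using d by (simp add: z_def dist_norm scaleR_left_diff_distrib)
    then have "(s - d) *\<^sub>R \<tau> \<in> K" using e(2) by auto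
    then have "s \<le> s - d" unfolding s_def by (intro cInf_lower bdd) (simp add: T_def)
    then show False using d(1) by simp
  qed
  then have "z \<notin> rel_interior K" using interior_rel_interior_gen[of K] interior_K by (metis rel_interior_nonempty_interior)
  then obtain a where a: "a \<noteq> 0" "\<And>y. y \<in> K \<Longrightarrow> a \<bullet> z \<le> a \<bullet> y"
    using supporting_hyperplane_rel_boundary[OF convex_K z, of thesis] by blast
  define G where "G = K \<inter> {y. a \<bullet> y = a \<bullet> z}"
  have G: "G face_of K" unfolding G_def by (rule face_of_Int_supporting_hyperplane_ge[OF convex_K]) (rule a(2))
  have zG: "z \<in> G" using z by (simp add: G_def)
  obtain v where v: "{v} face_of K" "v \<in> G" using vertex_below[OF G zG, of thesis] by blast
  then have av: "a \<bullet> v = a \<bullet> z" by (simp add: G_def)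
  have "a \<bullet> v \<le> a \<bullet> y" if "y \<in> positive_points" for y
    using a(2) positive_points_subset_K that unfolding av by blast
  then obtain F where F: "F facet_of K" "\<And>y. y \<in> K \<Longrightarrow> a \<bullet> y = a \<bullet> v \<Longrightarrow> y \<in> F"
    using facet_through[OF vertex_in_positive_points[OF v(1)] a(1)] by blast
  have "z \<in> F" using F(2)[OF z] av by simp
  then show ?thesis using that[of s F] F(1) pos[OF \<open>s \<in> T\<close>] by (simp add: z_def)
qed

text \<open>Every direction meets the sail in a point of some facet, comparable with a vertex \<open>v\<close> of
  that facet.  In units of \<open>v\<close>, all edge vectors at \<open>v\<close> have bounded coordinates, so that the
  integrality of their determinants bounds the product of the coordinates of \<open>v\<close> from below.\<close>

theorem norm_bounded_below_of_facets_and_stars: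
  assumes facets: "\<And>F. F facet_of K \<Longrightarrow> facet_det F \<le> ennreal D0"
    and stars: "\<And>v. {v} face_of K \<Longrightarrow> star_det L K v \<le> ennreal D0"
  shows "\<exists>c>0. \<forall>x\<in>L. x \<noteq> 0 \<longrightarrow> c \<le> \<bar>\<Prod>i\<in>UNIV. x $ i\<bar>"
proof -
  define D where "D = max D0 1"
  have D1: "1 \<le> D" by (simp add: D_def)
  have "ennreal D0 \<le> ennreal D" by (rule ennreal_leI) (simp add: D_def)
  then have facet: "\<And>F. F facet_of K \<Longrightarrow> facet_det F \<le> ennreal D"
    and star: "\<And>v. {v} face_of K \<Longrightarrow> star_det L K v \<le> ennreal D"
    using facets stars by (meson order_trans)+
  define n where "n = real CARD('n)"
  have n0: "0 < n" by (simp add: n_def)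
  define M where "M = D * (1 + n * D)"
  have M1: "1 \<le> M" using mult_mono[of 1 D 1 "1 + n * D"] D1 n0 by (simp add: M_def)
  define C where "C = n * D * (1 + M)"
  have C0: "0 < C" using D1 n0 M1 by (simp add: C_def)
  obtain P where P: "0 < P" "\<And>v. {v} face_of K \<Longrightarrow> (\<Prod>i\<in>UNIV. v $ i) \<le> P" using vertex_prod_bounded by blast
  define W where "W = fact CARD('n) * M ^ CARD('n)"
  have W0: "0 < W" using M1 by (simp add: W_def)
  \<comment> \<open>\<open>inverse W\<close> bounds the product of the coordinates of v from below,
    and the factor \<open>(n + 1) * (C * W * P)\<close> compares each coordinate of v with that of
    y.\<close>
  define c where "c = inverse W / ((n + 1) * (C * W * P)) ^ CARD('n)"
  have "c \<le> \<bar>\<Prod>i\<in>UNIV. y $ i\<bar>" if y: "y \<in> L" "y \<noteq> 0" for y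
  proof -
    define \<tau> where "\<tau> = (\<chi> i. \<bar>y $ i\<bar>)"
    have \<tau>0: "0 < \<tau> $ i" for i using coord_nonzero[OF y] by (simp add: \<tau>_def)
    obtain s F where s: "0 < s" "s *\<^sub>R \<tau> \<in> F" and F: "F facet_of K" using facet_on_ray[of \<tau>] \<tau>0 by blast
    obtain v where v: "{v} face_of K" "v \<in> F" "\<And>i. v $ i \<le> (CARD('n) + 1) * (s *\<^sub>R \<tau>) $ i"
      using vertex_below[OF facet_is_face[OF F] s(2)] by blast
    have vA: "v \<in> positive_points" by (rule vertex_in_positive_points[OF v(1)])
    then have v0: "0 < v $ i" for i by (simp add: positive_points_iff)
    obtain R where R: "finite R" "R \<subseteq> star_vectors L K v"
      and gen: "\<And>y. y \<in> positive_points \<Longrightarrow> y - v \<in> convex_cone hull R" using star_generators[OF v(1)] by blast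
    have RM: "\<bar>r $ i\<bar> \<le> M * v $ i" if "r \<in> R" for r i
      using star_generator_coordinates[OF v(1) facet star[OF v(1)] D1 R gen that, of i] unfolding M_def n_def .
    have "\<bar>(s *\<^sub>R \<tau>) $ i\<bar> \<le> C * v $ i" for i
      using facet_coordinates[OF F v(2) facet[OF F] v(1) R RM _ gen s(2), of i] M1 unfolding C_def n_def by simp
    then have yv: "\<bar>y $ i\<bar> \<le> C / s * v $ i" for i
      using s(1) by (simp add: \<tau>_def abs_mult field_simps)
    obtain B where B: "B \<subseteq> R" "independent B" "R \<subseteq> span B" using maximal_independent_subset[of R] by blast
    have "span R \<subseteq> span B" using B(3) by (rule span_minimal) simp
    then have "span B = UNIV" using span_star_generators[OF vA R(1) gen] by blast
    then obtain g :: "'n \<Rightarrow> real^'n" where g: "bij_betw g UNIV B" "det (\<chi> i. g i) \<noteq> 0" using enum_basis[OF B(2)] by blast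
    have gR: "g i \<in> R" for i using g(1) B(1) by (auto simp: bij_betw_def)
    have gL: "g i \<in> L" for i using star_vector_in(1)[OF v(1)] gR R(2) by blast
    have V0: "0 < (\<Prod>i\<in>UNIV. v $ i)" by (intro prod_pos) (simp add: v0)
    have "\<bar>det (\<chi> i. g i)\<bar> \<le> fact CARD('n) * (\<Prod>i\<in>(UNIV::'n set). M) * (\<Prod>i\<in>UNIV. v $ i)"
      by (rule abs_det_le) (use RM gR M1 v0 in \<open>auto intro: less_imp_le\<close>)
    then have "1 \<le> W * (\<Prod>i\<in>UNIV. v $ i)" using abs_det_ge_1[of g] gL g(2) by (simp add: W_def)
    then have vlow: "inverse W \<le> (\<Prod>i\<in>UNIV. v $ i)" using W0 by (simp add: field_simps)
    obtain \<alpha> where \<alpha>: "y = (\<Sum>i\<in>UNIV. \<alpha> i *\<^sub>R g i)" using det_nz_expand[OF g(2)] by blast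
    have "\<exists>k. \<alpha> k \<noteq> 0"
    proof (rule ccontr)
      assume "\<not> ?thesis"
      then have "(\<Sum>i\<in>UNIV. \<alpha> i *\<^sub>R g i) = 0" by simp
      with \<alpha> y(2) show False by metis
    qed
    then obtain k where k: "\<alpha> k \<noteq> 0" by blast
    \<comment> \<open>Row k is y, with coordinates at most C / s times those of v; the other rows
      are edge vectors. The determinant is a nonzero integer, which bounds s from above.\<close>
    define h where "h i = (if i = k then C / s else M)" for i
    have h0: "0 \<le> h i" for i using C0 s(1) M1 by (simp add: h_def)
    have "det (\<chi> i. (g(k := y)) i) \<noteq> 0" using det_replace_row[OF \<alpha>, of k] k g(2) by simp
    then have "1 \<le> \<bar>det (\<chi> i. (g(k := y)) i)\<bar>" by (rule abs_det_ge_1[rotated]) (simp add: gL y(1))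
    also have "\<dots> \<le> fact CARD('n) * (\<Prod>i\<in>UNIV. h i) * (\<Prod>i\<in>UNIV. v $ i)"
      by (rule abs_det_le) (use RM gR yv h0 v0 in \<open>auto simp: h_def intro: less_imp_le\<close>)
    also have "(\<Prod>i\<in>UNIV. h i) \<le> C / s * M ^ CARD('n)"
    proof -
      have "(\<Prod>i\<in>UNIV. h i) = h k * (\<Prod>i\<in>UNIV - {k}. h i)" by (rule prod.remove) auto
      also have "(\<Prod>i\<in>UNIV - {k}. h i) = M ^ card (UNIV - {k})" by (simp add: h_def)
      also have "h k * M ^ card (UNIV - {k}) \<le> h k * M ^ CARD('n)"
        using M1 h0[of k] by (intro mult_left_mono power_increasing card_mono) auto
      finally show ?thesis by (simp add: h_def)
    qed
    also have "fact CARD('n) * (C / s * M ^ CARD('n)) * (\<Prod>i\<in>UNIV. v $ i) = C / s * W * (\<Prod>i\<in>UNIV. v $ i)"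
      by (simp add: W_def)
    also have "\<dots> \<le> C / s * W * P" using P(2)[OF v(1)] C0 s(1) W0 by (intro mult_left_mono) auto
    finally have sle: "s \<le> C * W * P" using V0 s(1) by (simp add: field_simps mult_right_mono)
    have low: "v $ i / ((n + 1) * (C * W * P)) \<le> \<bar>y $ i\<bar>" for i
    proof -
      have "v $ i \<le> (n + 1) * (s * \<bar>y $ i\<bar>)" using v(3)[of i] by (simp add: n_def \<tau>_def add.commute)
      also have "\<dots> \<le> (n + 1) * (C * W * P * \<bar>y $ i\<bar>)" using sle n0 by (intro mult_left_mono mult_right_mono) auto
      finally show ?thesis using n0 C0 W0 P(1) by (simp add: divide_le_eq mult_ac)
    qed
    have "c \<le> (\<Prod>i\<in>UNIV. v $ i) / ((n + 1) * (C * W * P)) ^ CARD('n)"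
      unfolding c_def using vlow n0 C0 W0 P(1) by (intro divide_right_mono) auto
    also have "\<dots> = (\<Prod>i\<in>UNIV. v $ i / ((n + 1) * (C * W * P)))" by (simp add: prod_dividef)
    also have "\<dots> \<le> (\<Prod>i\<in>UNIV. \<bar>y $ i\<bar>)"
      using low v0 n0 C0 W0 P(1) by (intro prod_mono) (auto intro!: divide_nonneg_pos less_imp_le)
    finally show ?thesis by (simp add: abs_prod)
  qed
  moreover have "0 < c" using n0 C0 W0 P(1) by (simp add: c_def)
  ultimately show ?thesis by blast
qed

end

section \<open>Functionals on a subspace\<close>

text \<open>The norm dual to the box norm: the maximum of \<open>u \<bullet> y\<close> over all y
  with \<open>\<bar>y $ i\<bar> \<le> t i\<close>, when t is positive.\<close>

definition weighted_l1 :: "('n::finite \<Rightarrow> real) \<Rightarrow> real^'n \<Rightarrow> real" where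
  "weighted_l1 t u = (\<Sum>k\<in>UNIV. \<bar>u $ k\<bar> * t k)"

lemma weighted_l1_scale: "weighted_l1 t (c *\<^sub>R u) = \<bar>c\<bar> * weighted_l1 t u"
  unfolding weighted_l1_def sum_distrib_left by (rule sum.cong) (simp_all add: abs_mult)

lemma weighted_l1_nonneg: "(\<And>i. 0 < t i) \<Longrightarrow> 0 \<le> weighted_l1 t u"
  unfolding weighted_l1_def by (intro sum_nonneg mult_nonneg_nonneg) (simp_all add: less_imp_le)

lemma weighted_l1_pos:
  assumes "\<And>i. 0 < t i" "u \<noteq> 0"
  shows "0 < weighted_l1 t u"
proof -
  obtain i where "u $ i \<noteq> 0" using assms(2) by (auto simp: vec_eq_iff)
  then have "0 < \<bar>u $ i\<bar> * t i" using assms(1) by simp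
  also have "\<dots> \<le> weighted_l1 t u"
    unfolding weighted_l1_def using assms(1) by (intro member_le_sum) (auto simp: less_imp_le)
  finally show ?thesis .
qed

lemma weighted_l1_triangle:
  assumes "\<And>i. 0 < t i"
  shows "weighted_l1 t (u + w) \<le> weighted_l1 t u + weighted_l1 t w"
proof -
  have "\<bar>(u + w) $ k\<bar> * t k \<le> \<bar>u $ k\<bar> * t k + \<bar>w $ k\<bar> * t k" for k
    unfolding distrib_right[symmetric] vector_add_component
    using assms[of k] by (intro mult_right_mono abs_triangle_ineq) simp
  then show ?thesis unfolding weighted_l1_def sum.distrib[symmetric] by (rule sum_mono)
qed

lemma abs_inner_le_weighted_l1:
  assumes "\<And>i. \<bar>y $ i\<bar> \<le> t i"
  shows "\<bar>u \<bullet> y\<bar> \<le> weighted_l1 t u"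
proof -
  have "\<bar>u \<bullet> y\<bar> \<le> (\<Sum>i\<in>UNIV. \<bar>u $ i * y $ i\<bar>)" unfolding inner_vec_def inner_real_def by (rule sum_abs)
  also have "\<dots> \<le> weighted_l1 t u"
    unfolding weighted_l1_def abs_mult by (intro sum_mono mult_left_mono assms) auto
  finally show ?thesis .
qed

lemma orthogonal_if_bounded_above:
  assumes "subspace V" "\<And>v. v \<in> V \<Longrightarrow> u \<bullet> (x + v) \<le> b" "v \<in> V"
  shows "u \<bullet> v = 0"
proof (rule ccontr)
  assume a: "u \<bullet> v \<noteq> 0"
  define r where "r = (b - u \<bullet> x + 1) / (u \<bullet> v)"
  have "u \<bullet> (x + r *\<^sub>R v) \<le> b" using assms by (auto simp: subspace_scale)
  then show False using a by (simp add: r_def inner_add_right)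
qed

text \<open>Hahn-Banach duality: if the coset z + V missed the compact box, a separating functional
  would be bounded on the coset, hence vanish on V, and violate the assumed inequality.\<close>

lemma bounded_lift:
  fixes z :: "real^'n::finite"
  assumes V: "subspace V" and t: "\<And>i. 0 < t i" and \<rho>: "0 \<le> \<rho>"
    and bound: "\<And>u. (\<And>v. v \<in> V \<Longrightarrow> u \<bullet> v = 0) \<Longrightarrow> \<bar>u \<bullet> z\<bar> \<le> \<rho> * weighted_l1 t u"
  obtains v where "v \<in> V" "\<And>i. \<bar>(z + v) $ i\<bar> \<le> \<rho> * t i"
proof -
  define T where "T = cbox (\<chi> i. - (\<rho> * t i)) (\<chi> i. \<rho> * t i)"
  have "(+) z ` V \<inter> T \<noteq> {}"
  proof
    assume disj: "(+) z ` V \<inter> T = {}"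
    have "0 \<in> T" using \<rho> t by (auto simp: T_def mem_box_cart less_imp_le)
    then have "T \<noteq> {}" by blast
    have "convex ((+) z ` V)" by (intro convex_translation subspace_imp_convex V)
    moreover have "closed ((+) z ` V)" by (intro closed_translation closed_subspace V)
    moreover have "convex T" "compact T" by (simp_all add: T_def convex_box compact_cbox)
    ultimately obtain u b where u: "\<And>x. x \<in> (+) z ` V \<Longrightarrow> u \<bullet> x < b" "\<And>x. x \<in> T \<Longrightarrow> b < u \<bullet> x"
      using separating_hyperplane_closed_compact[OF _ _ _ _ \<open>T \<noteq> {}\<close> disj] by blast
    have "u \<bullet> v = 0" if "v \<in> V" for v
    proof (rule orthogonal_if_bounded_above[OF V _ that])
      show "u \<bullet> (z + v) \<le> b" if "v \<in> V" for v using u(1)[of "z + v"] that by simp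
    qed
    then have "\<bar>u \<bullet> z\<bar> \<le> \<rho> * weighted_l1 t u" by (rule bound)
    moreover have "u \<bullet> z < b" using u(1)[of "z + 0"] subspace_0[OF V] by auto
    moreover have "b < - (\<rho> * weighted_l1 t u)"
    proof -
      \<comment> \<open>The corner of the box at which u is smallest.\<close>
      define w where "w = (\<chi> i. - (sgn (u $ i) * \<rho> * t i))"
      have "\<rho> * t i * \<bar>sgn (u $ i)\<bar> \<le> \<rho> * t i" for i
        using \<rho> t[of i] by (simp add: abs_sgn_eq)
      then have "w \<in> T" using \<rho> t by (auto simp: T_def w_def mem_box_cart sgn_real_def less_imp_le)
      then have "b < u \<bullet> w" by (rule u(2))
      also have "u \<bullet> w = (\<Sum>i\<in>UNIV. - (\<rho> * (\<bar>u $ i\<bar> * t i)))"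
        unfolding inner_vec_def w_def by (rule sum.cong) (auto simp: sgn_real_def)
      also have "\<dots> = - (\<rho> * weighted_l1 t u)" by (simp add: weighted_l1_def sum_negf sum_distrib_left)
      finally show ?thesis .
    qed
    ultimately show False by linarith
  qed
  then obtain v where "v \<in> V" "z + v \<in> T" by blast
  moreover have "\<bar>(z + v) $ i\<bar> \<le> \<rho> * t i" for i
  proof -
    have "- (\<rho> * t i) \<le> (z + v) $ i" "(z + v) $ i \<le> \<rho> * t i"
      using \<open>z + v \<in> T\<close> unfolding T_def mem_box_cart by simp_all
    then show ?thesis by linarith
  qed
  ultimately show ?thesis using that by blast
qed

text \<open>Alternative of Farkas type: a functional separating x + V from the translated orthant is
  bounded above on the coset, hence vanishes on V, and bounded below on the orthant, hence is
  nonnegative. It is normalised at the end.\<close>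

lemma deep_point_or_functional:
  fixes x :: "real^'n::finite"
  assumes V: "subspace V" and t: "\<And>i. 0 < t i"
    and none: "\<not> (\<exists>v\<in>V. \<forall>i. c * t i \<le> (x + v) $ i)"
  obtains u where "\<And>v. v \<in> V \<Longrightarrow> u \<bullet> v = 0" "\<And>i. 0 \<le> u $ i" "weighted_l1 t u = 1" "u \<bullet> x \<le> c"
proof -
  define p where "p = (\<chi> i. c * t i)"
  define T where "T = {q. \<forall>i. p $ i \<le> q $ i}"
  have T: "convex T" "T \<noteq> {}"
  proof -
    have "T = (\<Inter>i. {q. p $ i \<le> q $ i})" by (auto simp: T_def)
    also have "\<dots> = (\<Inter>i. {q. axis i 1 \<bullet> q \<ge> p $ i})" by (simp add: inner_axis')
    finally show "convex T" by (auto intro!: convex_INT convex_halfspace_ge)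
    show "T \<noteq> {}" by (auto simp: T_def)
  qed
  have "convex ((+) x ` V)" by (intro convex_translation subspace_imp_convex V)
  moreover have "(+) x ` V \<noteq> {}" using subspace_0[OF V] by blast
  moreover have "(+) x ` V \<inter> T = {}" using none by (auto simp: T_def p_def)
  ultimately have "\<exists>a b. a \<noteq> 0 \<and> (\<forall>y\<in>(+) x ` V. a \<bullet> y \<le> b) \<and> (\<forall>y\<in>T. b \<le> a \<bullet> y)"
    by (intro separating_hyperplane_sets T)
  then obtain a b where a: "a \<noteq> 0" "\<And>y. y \<in> (+) x ` V \<Longrightarrow> a \<bullet> y \<le> b" "\<And>y. y \<in> T \<Longrightarrow> b \<le> a \<bullet> y"
    by metis
  have orth: "a \<bullet> v = 0" if "v \<in> V" for v
  proof (rule orthogonal_if_bounded_above[OF V _ that])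
    show "a \<bullet> (x + v) \<le> b" if "v \<in> V" for v using a(2)[of "x + v"] that by simp
  qed
  have ap: "b \<le> a \<bullet> p" by (rule a(3)) (simp add: T_def)
  have nonneg: "0 \<le> a $ i" for i
  proof (rule ccontr)
    assume neg: "\<not> 0 \<le> a $ i"
    define r where "r = (a \<bullet> p - b + 1) / (- a $ i)"
    have "0 \<le> r" unfolding r_def using ap neg by (intro divide_nonneg_nonneg) auto
    then have "p + r *\<^sub>R axis i 1 \<in> T" by (auto simp: T_def axis_def)
    then have "b \<le> a \<bullet> (p + r *\<^sub>R axis i 1)" by (rule a(3))
    then have "b \<le> a \<bullet> p + r * a $ i" by (simp add: inner_add_right inner_axis)
    then show False using neg by (simp add: r_def)
  qed
  have "a \<bullet> x \<le> b" using a(2)[of "x + 0"] subspace_0[OF V] by auto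
  also note ap
  also have "a \<bullet> p = c * weighted_l1 t a"
    using nonneg by (simp add: p_def inner_vec_def weighted_l1_def sum_distrib_left mult_ac)
  finally have ax: "a \<bullet> x \<le> c * weighted_l1 t a" .
  have l0: "0 < weighted_l1 t a" by (rule weighted_l1_pos[OF t a(1)])
  show ?thesis
  proof (rule that[of "(1 / weighted_l1 t a) *\<^sub>R a"])
    show "((1 / weighted_l1 t a) *\<^sub>R a) \<bullet> x \<le> c" using ax l0 by (simp add: divide_le_eq)
  qed (use orth nonneg l0 in \<open>auto simp: weighted_l1_scale\<close>)
qed

text \<open>The functional \<open>a\<close> is built up coordinate by coordinate: a coordinate that is too small is
  corrected by adding a small multiple of the functional for which that coordinate is maximal.\<close>

lemma dominating_functional:
  fixes W :: "(real^'n::finite) set"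
  assumes W: "subspace W" and t: "\<And>i. 0 < t i"
  obtains a where "a \<in> W" "weighted_l1 t a \<le> 1"
    "\<And>u i. u \<in> W \<Longrightarrow> (1/4) ^ CARD('n) * \<bar>u $ i\<bar> \<le> \<bar>a $ i\<bar> * weighted_l1 t u"
proof -
  \<comment> \<open>A maximiser of coordinate i over the compact unit ball of W.\<close>
  have top: "\<exists>w\<in>W. weighted_l1 t w \<le> 1 \<and> (\<forall>u\<in>W. \<bar>u $ i\<bar> \<le> \<bar>w $ i\<bar> * weighted_l1 t u)" for i
  proof -
    define S where "S = W \<inter> {u. weighted_l1 t u \<le> 1}"
    have "closed {u. weighted_l1 t u \<le> 1}" unfolding weighted_l1_def by (intro closed_Collect_le continuous_intros)
    then have cl: "closed S" unfolding S_def by (rule closed_Int[OF closed_subspace[OF W]])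
    have "S \<subseteq> cbox (\<chi> i. - (1 / t i)) (\<chi> i. 1 / t i)"
    proof
      fix u assume u: "u \<in> S"
      have "\<bar>u $ i\<bar> \<le> 1 / t i" for i
      proof -
        have "\<bar>u $ i\<bar> * t i \<le> weighted_l1 t u"
          unfolding weighted_l1_def using t by (intro member_le_sum) (auto simp: less_imp_le)
        then show ?thesis using u t[of i] by (simp add: S_def pos_le_divide_eq)
      qed
      then show "u \<in> cbox (\<chi> i. - (1 / t i)) (\<chi> i. 1 / t i)" unfolding mem_box_cart abs_le_iff by (simp add: minus_le_iff)
    qed
    then have "bounded S" by (rule bounded_subset[OF bounded_cbox])
    then have "compact S" using cl by (simp add: compact_eq_bounded_closed)
    moreover have "0 \<in> S" using subspace_0[OF W] by (simp add: S_def weighted_l1_def)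
    then have "S \<noteq> {}" by blast
    moreover have "continuous_on S (\<lambda>u. \<bar>u $ i\<bar>)" by (intro continuous_intros)
    ultimately have "\<exists>w\<in>S. \<forall>u\<in>S. \<bar>u $ i\<bar> \<le> \<bar>w $ i\<bar>" by (rule continuous_attains_sup)
    then obtain w where w: "w \<in> S" "\<And>u. u \<in> S \<Longrightarrow> \<bar>u $ i\<bar> \<le> \<bar>w $ i\<bar>" by blast
    have "\<bar>u $ i\<bar> \<le> \<bar>w $ i\<bar> * weighted_l1 t u" if "u \<in> W" for u
    proof (cases "u = 0")
      case False
      then have l: "0 < weighted_l1 t u" by (rule weighted_l1_pos[OF t])
      have "(1 / weighted_l1 t u) *\<^sub>R u \<in> S" using that l by (simp add: S_def weighted_l1_scale subspace_scale[OF W])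
      from w(2)[OF this] show ?thesis using l by (simp add: abs_mult divide_le_eq)
    qed (use weighted_l1_nonneg[of t 0] t in simp)
    moreover have "w \<in> W" "weighted_l1 t w \<le> 1" using w(1) unfolding S_def by simp_all
    ultimately show ?thesis by blast
  qed
  have "\<exists>a\<in>W. weighted_l1 t a \<le> 1 - (1/4) ^ card I \<and>
      (\<forall>u\<in>W. \<forall>i\<in>I. (1/4) ^ card I * \<bar>u $ i\<bar> \<le> \<bar>a $ i\<bar> * weighted_l1 t u)" if "finite I" for I
    using that
  proof (induction I)
    case empty
    show ?case using subspace_0[OF W] by (intro bexI[of _ 0]) (simp_all add: weighted_l1_def)
  next
    case (insert i I)
    \<comment> \<open>The norm bound 1 - k holds a reserve for corrections: one of them costs k / 2,
      and k / 4 is left for the next coordinate.\<close>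
    define k :: real where "k = (1/4) ^ card I"
    have k: "0 < k" "(1/4) ^ card (insert i I) = k / 4" using insert(1,2) by (simp_all add: k_def)
    obtain a where a: "a \<in> W" "weighted_l1 t a \<le> 1 - k"
      "\<And>u j. u \<in> W \<Longrightarrow> j \<in> I \<Longrightarrow> k * \<bar>u $ j\<bar> \<le> \<bar>a $ j\<bar> * weighted_l1 t u"
      using insert(3) unfolding k_def by blast
    obtain w where w: "w \<in> W" "weighted_l1 t w \<le> 1" "\<And>u. u \<in> W \<Longrightarrow> \<bar>u $ i\<bar> \<le> \<bar>w $ i\<bar> * weighted_l1 t u"
      using top by blast
    have l0: "0 \<le> weighted_l1 t u" for u by (rule weighted_l1_nonneg[OF t])
    \<comment> \<open>If coordinate i of a is below a quarter of k times that of w, adding k / 2 of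
      w leaves at least that quarter. Coordinates already treated lose at most half, because a
      dominates w there.\<close>
    define b where "b = (if k / 4 * \<bar>w $ i\<bar> \<le> \<bar>a $ i\<bar> then a else a + (k / 2) *\<^sub>R w)"
    have "b \<in> W" using a(1) w(1) W by (simp add: b_def subspace_add subspace_scale)
    moreover have "weighted_l1 t b \<le> 1 - k / 4"
    proof -
      have "weighted_l1 t (a + (k / 2) *\<^sub>R w) \<le> weighted_l1 t a + k / 2 * weighted_l1 t w"
        using weighted_l1_triangle[OF t, where u = a and w = "(k / 2) *\<^sub>R w"] k(1) by (simp add: weighted_l1_scale)
      moreover have "k / 2 * weighted_l1 t w \<le> k / 2" using mult_left_mono[OF w(2), of "k / 2"] k(1) by simp
      ultimately have "weighted_l1 t (a + (k / 2) *\<^sub>R w) \<le> 1 - k / 4" "weighted_l1 t a \<le> 1 - k / 4"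
        using a(2) k(1) by linarith+
      then show ?thesis by (simp add: b_def)
    qed
    moreover have bi: "k / 4 * \<bar>w $ i\<bar> \<le> \<bar>b $ i\<bar>"
    proof (cases "k / 4 * \<bar>w $ i\<bar> \<le> \<bar>a $ i\<bar>")
      case False
      have "k / 2 * \<bar>w $ i\<bar> = \<bar>k / 2 * w $ i\<bar>" using k(1) by (simp add: abs_mult)
      moreover have "b $ i = a $ i + k / 2 * w $ i" using False by (simp add: b_def)
      ultimately show ?thesis using False by linarith
    qed (simp add: b_def)
    have bj: "\<bar>a $ j\<bar> / 2 \<le> \<bar>b $ j\<bar>" if "j \<in> I" for j
    proof (cases "k / 4 * \<bar>w $ i\<bar> \<le> \<bar>a $ i\<bar>")
      case False
      have "k * \<bar>w $ j\<bar> \<le> \<bar>a $ j\<bar> * weighted_l1 t w" by (rule a(3)[OF w(1) that])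
      also have "\<dots> \<le> \<bar>a $ j\<bar>" using mult_left_mono[OF w(2), of "\<bar>a $ j\<bar>"] by simp
      finally have "k / 2 * \<bar>w $ j\<bar> \<le> \<bar>a $ j\<bar> / 2" by simp
      moreover have "k / 2 * \<bar>w $ j\<bar> = \<bar>k / 2 * w $ j\<bar>" using k(1) by (simp add: abs_mult)
      moreover have "b $ j = a $ j + k / 2 * w $ j" using False by (simp add: b_def)
      ultimately show ?thesis by linarith
    qed (simp add: b_def)
    have "k / 4 * \<bar>u $ j\<bar> \<le> \<bar>b $ j\<bar> * weighted_l1 t u" if u: "u \<in> W" and j: "j \<in> insert i I" for u j
    proof (cases "j = i")
      case True
      have "k / 4 * \<bar>u $ i\<bar> \<le> k / 4 * (\<bar>w $ i\<bar> * weighted_l1 t u)" using w(3)[OF u] k(1) by (intro mult_left_mono) auto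
      also have "\<dots> = (k / 4 * \<bar>w $ i\<bar>) * weighted_l1 t u" by simp
      also have "\<dots> \<le> \<bar>b $ i\<bar> * weighted_l1 t u" using bi l0 by (rule mult_right_mono)
      finally show ?thesis using True by simp
    next
      case False
      then have j: "j \<in> I" using j by simp
      have "k / 4 * \<bar>u $ j\<bar> \<le> k / 2 * \<bar>u $ j\<bar>" using k(1) by (intro mult_right_mono) auto
      also have "\<dots> \<le> \<bar>a $ j\<bar> / 2 * weighted_l1 t u" using a(3)[OF u j] by simp
      also have "\<dots> \<le> \<bar>b $ j\<bar> * weighted_l1 t u" using bj[OF j] l0 by (rule mult_right_mono)
      finally show ?thesis .
    qed
    ultimately show ?case unfolding k(2) by blast
  qed
  from this[of UNIV] obtain a where a: "a \<in> W" "weighted_l1 t a \<le> 1 - (1/4) ^ CARD('n)"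
    "\<And>u i. u \<in> W \<Longrightarrow> (1/4) ^ CARD('n) * \<bar>u $ i\<bar> \<le> \<bar>a $ i\<bar> * weighted_l1 t u" by auto
  have "(0::real) < (1/4) ^ CARD('n)" by simp
  then have "weighted_l1 t a \<le> 1" using a(2) by linarith
  then show ?thesis using that a(1,3) by blast
qed

section \<open>Lattices with many short vectors\<close>

text \<open>In a lattice of this locale the short vectors span a proper subspace \<open>V\<close>, although all
  lattice vectors outside \<open>V\<close> have a size comparable with \<open>t\<close>.\<close>

locale flat_lattice = irrational_unimodular_lattice L
  for L :: "(real^'n::finite) set" +
  fixes t :: "'n \<Rightarrow> real" and a :: "real^'n" and c0 \<kappa> \<epsilon> :: real
  assumes t_pos: "0 < t i"
    and c0: "0 < c0" "c0 \<le> 1" and \<kappa>_pos: "0 < \<kappa>"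
    and \<epsilon>: "0 < \<epsilon>" "CARD('n) * \<epsilon> \<le> c0 / 2"
    and not_spanning: "span (lattice_box t) \<noteq> UNIV"
    and spanning: "span (lattice_box (\<lambda>i. 2 * t i)) = UNIV"
    and rank: "(\<And>i. 0 < s i) \<Longrightarrow> span (lattice_box s) \<noteq> UNIV \<Longrightarrow>
      dim (span (lattice_box (\<lambda>i. c0 * s i))) \<le> dim (span (lattice_box (\<lambda>i. \<epsilon> * t i)))"
    and nontrivial: "\<exists>v\<in>lattice_box (\<lambda>i. \<epsilon> * t i). v \<noteq> 0"
    and a_orthogonal: "v \<in> span (lattice_box (\<lambda>i. \<epsilon> * t i)) \<Longrightarrow> a \<bullet> v = 0"
    and a_nonneg: "0 \<le> a $ i" and a_l1: "weighted_l1 t a \<le> 1"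
    and a_dominates: "(\<And>v. v \<in> span (lattice_box (\<lambda>i. \<epsilon> * t i)) \<Longrightarrow> u \<bullet> v = 0) \<Longrightarrow>
      \<kappa> * \<bar>u $ i\<bar> \<le> a $ i * weighted_l1 t u"
begin

definition V :: "(real^'n) set" where "V = span (lattice_box (\<lambda>i. \<epsilon> * t i))"

definition orth :: "real^'n \<Rightarrow> bool" where "orth u \<longleftrightarrow> (\<forall>v\<in>V. u \<bullet> v = 0)"

lemma subspace_V: "subspace V" by (simp add: V_def)

lemma one_le_card: "1 \<le> real CARD('n)"
  using two_le_dim by simp

lemma \<epsilon>_le: "\<epsilon> \<le> c0 / 2" "\<epsilon> \<le> 1"
proof -
  have "1 * \<epsilon> \<le> CARD('n) * \<epsilon>" using one_le_card \<epsilon>(1) by (intro mult_right_mono) auto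
  then show "\<epsilon> \<le> c0 / 2" using \<epsilon>(2) by linarith
  then show "\<epsilon> \<le> 1" using c0(2) by simp
qed

lemma a_orth: "orth a"
  using a_orthogonal by (simp add: orth_def V_def)

lemma orth_dominated: "orth u \<Longrightarrow> \<kappa> * \<bar>u $ i\<bar> \<le> a $ i * weighted_l1 t u"
  by (rule a_dominates) (simp add: orth_def V_def)

text \<open>Since \<open>\<epsilon> \<le> c0\<close>, V lies in the span at scale
  \<open>c0 * t\<close>; the rank hypothesis for t itself excludes a larger dimension there. This
  gap between the two scales is the lower bound for vectors outside V.\<close>

lemma lattice_box_subset_V: "lattice_box (\<lambda>i. c0 * t i) \<subseteq> V"
proof -
  have sub: "V \<subseteq> span (lattice_box (\<lambda>i. c0 * t i))"
    unfolding V_def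
  proof (intro span_mono lattice_box_mono mult_right_mono)
    show "\<epsilon> \<le> c0" using \<epsilon>_le(1) c0(1) by simp
  qed (simp add: t_pos less_imp_le)
  have "dim (span (lattice_box (\<lambda>i. c0 * t i))) \<le> dim V"
    unfolding V_def using not_spanning by (intro rank t_pos)
  then have "V = span (lattice_box (\<lambda>i. c0 * t i))"
    using sub subspace_V by (intro subspace_dim_equal) auto
  then show ?thesis using span_superset by blast
qed

text \<open>If a were 0, domination would kill every functional vanishing on V, although V is a
  proper subspace.\<close>

lemma a_nonzero: "a \<noteq> 0"
proof
  assume a0: "a = 0"
  have "lattice_box (\<lambda>i. \<epsilon> * t i) \<subseteq> lattice_box t"
    by (rule lattice_box_mono) (use \<epsilon> \<epsilon>_le t_pos in \<open>simp add: mult_left_le_one_le less_imp_le\<close>)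
  then have "V \<subseteq> span (lattice_box t)" unfolding V_def by (rule span_mono)
  then have "span V \<noteq> UNIV" using not_spanning unfolding V_def span_span by blast
  then have "span V \<subset> span UNIV" by auto
  then obtain u where u: "u \<noteq> 0" "\<And>v. v \<in> span V \<Longrightarrow> orthogonal u v"
    using orthogonal_to_subspace_exists_gen by blast
  then have "orth u" by (auto simp: orth_def orthogonal_def span_base)
  then have "\<kappa> * \<bar>u $ i\<bar> \<le> 0" for i using orth_dominated[of u i] a0 by simp
  then have "u $ i = 0" for i using \<kappa>_pos by (simp add: mult_le_0_iff)
  then show False using u(1) by (simp add: vec_eq_iff)
qed

lemma a_positive: assumes "x \<in> positive_points" shows "0 < a \<bullet> x"
proof -
  have x: "0 < x $ i" for i using assms by (simp add: positive_points_iff)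
  have "0 < weighted_l1 (\<lambda>i. x $ i) a" by (rule weighted_l1_pos[OF x a_nonzero])
  then show ?thesis using a_nonneg by (simp add: weighted_l1_def inner_vec_def)
qed

text \<open>Domination turns a bound on the single value \<open>a \<bullet> x\<close> into a bound
  on the box norm at x of every functional vanishing on V.\<close>

lemma weighted_l1_point:
  assumes x: "x \<in> positive_points" "a \<bullet> x \<le> \<beta>" and u: "orth u"
  shows "weighted_l1 (\<lambda>i. x $ i) u \<le> \<beta> / \<kappa> * weighted_l1 t u"
proof -
  have "\<kappa> * weighted_l1 (\<lambda>i. x $ i) u = (\<Sum>k\<in>UNIV. \<kappa> * \<bar>u $ k\<bar> * x $ k)"
    by (simp add: weighted_l1_def sum_distrib_left mult.assoc)
  also have "\<dots> \<le> (\<Sum>k\<in>UNIV. a $ k * weighted_l1 t u * x $ k)"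
    using x(1) by (intro sum_mono mult_right_mono orth_dominated u) (auto simp: positive_points_iff less_imp_le)
  also have "\<dots> = (a \<bullet> x) * weighted_l1 t u"
    unfolding inner_vec_def sum_distrib_right by (rule sum.cong) simp_all
  also have "\<dots> \<le> \<beta> * weighted_l1 t u" using x(2) weighted_l1_nonneg[OF t_pos] by (intro mult_right_mono)
  finally show ?thesis using \<kappa>_pos by (simp add: field_simps)
qed

lemma round_in_V:
  assumes "v \<in> V"
  obtains w where "w \<in> L" "w \<in> V" "\<And>i. \<bar>w $ i - v $ i\<bar> \<le> CARD('n) * \<epsilon> * t i"
proof -
  have "0 \<le> \<epsilon> * t i" for i using \<epsilon>(1) t_pos[of i] by simp
  then obtain w where "w \<in> L" "w \<in> V" "\<And>i. \<bar>w $ i - v $ i\<bar> \<le> CARD('n) * (\<epsilon> * t i)"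
    using lattice_near_span[of v "\<lambda>i. \<epsilon> * t i"] assms unfolding V_def by metis
  then show ?thesis using that[of w] by (simp add: mult.assoc)
qed

text \<open>A point with \<open>a \<bullet> x \<le> \<beta>\<close> is bounded modulo V by duality,
  and moving it along lattice vectors of V leaves its value of a unchanged. The values below
  \<open>\<beta>\<close> are thus attained on a finite set of lattice points, no longer necessarily
  in the orthant.\<close>

lemma minimizer:
  obtains x where "x \<in> positive_points" "a \<bullet> x \<le> 4 * CARD('n) + 1" "\<And>y. y \<in> positive_points \<Longrightarrow> a \<bullet> x \<le> a \<bullet> y"
proof -
  define n where "n = real CARD('n)"
  define \<beta> where "\<beta> = 4 * n + 1"
  have n: "1 \<le> n" using one_le_card by (simp add: n_def)
  \<comment> \<open>Rounding p to the lattice within 2 n t leaves coordinates between t and (4 n +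
    1) t; this is the origin of \<open>\<beta>\<close>.\<close>
  define p where "p = (\<chi> i. (2 * n + 1) * t i)"
  have "p \<in> span (lattice_box (\<lambda>i. 2 * t i))" "\<And>i. 0 \<le> 2 * t i" using spanning t_pos by (simp_all add: less_imp_le)
  then obtain x0 where x0: "x0 \<in> L" "\<And>i. \<bar>x0 $ i - p $ i\<bar> \<le> n * (2 * t i)"
    unfolding n_def by (rule lattice_near_span) metis
  have x0b: "t i \<le> x0 $ i" "x0 $ i \<le> \<beta> * t i" for i
  proof -
    have "p $ i = 2 * (n * t i) + t i" by (simp add: p_def algebra_simps)
    moreover have "n * (2 * t i) = 2 * (n * t i)" "\<beta> * t i = 4 * (n * t i) + t i" by (simp_all add: \<beta>_def algebra_simps)
    ultimately show "t i \<le> x0 $ i" "x0 $ i \<le> \<beta> * t i" using x0(2)[of i] by linarith+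
  qed
  have "0 < x0 $ i" for i using x0b(1)[of i] t_pos[of i] by linarith
  then have x0A: "x0 \<in> positive_points" using x0(1) by (simp add: positive_points_iff)
  have "a \<bullet> x0 \<le> (\<Sum>k\<in>UNIV. a $ k * (\<beta> * t k))"
    unfolding inner_vec_def inner_real_def by (intro sum_mono mult_left_mono x0b a_nonneg)
  also have "\<dots> = \<beta> * weighted_l1 t a" using a_nonneg by (simp add: weighted_l1_def sum_distrib_left mult_ac)
  also have "\<dots> \<le> \<beta> * 1" using a_l1 n by (intro mult_left_mono) (simp_all add: \<beta>_def)
  finally have x0\<beta>: "a \<bullet> x0 \<le> \<beta>" by simp
  define S where "S = {x \<in> positive_points. a \<bullet> x \<le> \<beta>}"
  define r where "r = (\<Sum>i\<in>UNIV. (\<beta> / \<kappa> + n * \<epsilon>) * t i)"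
  have pos: "0 \<le> \<beta> / \<kappa> + n * \<epsilon>" using n \<kappa>_pos \<epsilon>(1) by (auto simp: \<beta>_def intro!: add_nonneg_nonneg)
  have "a \<bullet> x \<in> (\<lambda>x. a \<bullet> x) ` {x \<in> L. \<forall>i. \<bar>x $ i\<bar> \<le> r}" if x: "x \<in> S" for x
  proof -
    have xA: "x \<in> positive_points" "a \<bullet> x \<le> \<beta>" using x by (simp_all add: S_def)
    have bnd: "\<bar>u \<bullet> x\<bar> \<le> \<beta> / \<kappa> * weighted_l1 t u" if u: "\<And>v. v \<in> V \<Longrightarrow> u \<bullet> v = 0" for u
    proof -
      have "\<bar>u \<bullet> x\<bar> \<le> weighted_l1 (\<lambda>i. x $ i) u"
        by (rule abs_inner_le_weighted_l1) (use xA(1) in \<open>simp add: positive_points_iff less_imp_le\<close>)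
      also have "\<dots> \<le> \<beta> / \<kappa> * weighted_l1 t u"
        by (rule weighted_l1_point[OF xA]) (use u in \<open>simp add: orth_def\<close>)
      finally show ?thesis .
    qed
    have "0 \<le> \<beta> / \<kappa>" using n \<kappa>_pos by (simp add: \<beta>_def)
    then obtain v where v: "v \<in> V" "\<And>i. \<bar>(x + v) $ i\<bar> \<le> \<beta> / \<kappa> * t i"
      using bounded_lift[OF subspace_V t_pos _ bnd] by blast
    obtain w where w: "w \<in> L" "w \<in> V" "\<And>i. \<bar>w $ i - v $ i\<bar> \<le> n * \<epsilon> * t i"
      using round_in_V[OF v(1)] unfolding n_def by metis
    have "\<bar>(x + w) $ i\<bar> \<le> r" for i
    proof -
      have "\<bar>(x + w) $ i\<bar> \<le> (\<beta> / \<kappa> + n * \<epsilon>) * t i"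
        using v(2)[of i] w(3)[of i] unfolding distrib_right vector_add_component by linarith
      also have "\<dots> \<le> r" unfolding r_def using pos t_pos by (intro member_le_sum) (auto simp: less_imp_le)
      finally show ?thesis .
    qed
    moreover have "x + w \<in> L" using xA(1) w(1) by (intro add_in) (simp_all add: positive_points_iff)
    moreover have "a \<bullet> x = a \<bullet> (x + w)" using w(2) a_orth by (simp add: orth_def inner_add_right)
    ultimately show ?thesis by (intro image_eqI[of _ _ "x + w"]) simp_all
  qed
  then have "(\<lambda>x. a \<bullet> x) ` S \<subseteq> (\<lambda>x. a \<bullet> x) ` {x \<in> L. \<forall>i. \<bar>x $ i\<bar> \<le> r}" by (rule image_subsetI)
  then have fin: "finite ((\<lambda>x. a \<bullet> x) ` S)" by (rule finite_subset) (intro finite_imageI finite_bounded)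
  have ne: "(\<lambda>x. a \<bullet> x) ` S \<noteq> {}" using x0A x0\<beta> by (auto simp: S_def)
  have "Min ((\<lambda>x. a \<bullet> x) ` S) \<in> (\<lambda>x. a \<bullet> x) ` S" using fin ne by (rule Min_in)
  then obtain x where x: "x \<in> S" "Min ((\<lambda>x. a \<bullet> x) ` S) = a \<bullet> x" by blast
  have "a \<bullet> x \<le> a \<bullet> y" if "y \<in> positive_points" for y
  proof (cases "a \<bullet> y \<le> \<beta>")
    case True
    then have "a \<bullet> y \<in> (\<lambda>x. a \<bullet> x) ` S" using that by (simp add: S_def)
    then show ?thesis using Min_le[OF fin] x(2) by metis
  next
    case False
    then show ?thesis using x(1) by (simp add: S_def)
  qed
  moreover have "a \<bullet> x \<le> 4 * CARD('n) + 1" using x(1) by (simp add: S_def \<beta>_def n_def)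
  moreover have "x \<in> positive_points" using x(1) by (simp add: S_def)
  ultimately show ?thesis using that by blast
qed

text \<open>Otherwise the rank hypothesis would make V the span of the lattice points in the box
  with half-widths \<open>x $ i + \<epsilon> * t i\<close>. That box contains x, on which a is
  positive.\<close>

lemma span_at_point:
  assumes x: "x \<in> positive_points"
  shows "span (lattice_box (\<lambda>i. (x $ i + \<epsilon> * t i) / c0)) = UNIV"
proof (rule ccontr)
  have x0: "0 < x $ i" "x \<in> L" for i using x by (simp_all add: positive_points_iff)
  have e0: "0 < \<epsilon> * t i" for i using \<epsilon>(1) t_pos by simp
  assume a: "\<not> ?thesis"
  have pos: "0 < (x $ i + \<epsilon> * t i) / c0" for i
    using x0(1)[of i] e0[of i] c0(1) by (intro divide_pos_pos add_pos_pos)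
  have "dim (span (lattice_box (\<lambda>i. c0 * ((x $ i + \<epsilon> * t i) / c0)))) \<le> dim V"
    unfolding V_def by (rule rank[OF pos a])
  then have le: "dim (span (lattice_box (\<lambda>i. x $ i + \<epsilon> * t i))) \<le> dim V" using c0(1) by simp
  have V: "V \<subseteq> span (lattice_box (\<lambda>i. x $ i + \<epsilon> * t i))"
    unfolding V_def by (intro span_mono lattice_box_mono) (simp add: x0 less_imp_le)
  then have "V = span (lattice_box (\<lambda>i. x $ i + \<epsilon> * t i))"
    using le subspace_V by (intro subspace_dim_equal) auto
  moreover have "x \<in> lattice_box (\<lambda>i. x $ i + \<epsilon> * t i)"
    using x0 e0 by (simp add: lattice_box_def less_imp_le)
  ultimately have "x \<in> V" using span_base by blast
  then have "a \<bullet> x = 0" using a_orth by (simp add: orth_def)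
  then show False using a_positive[OF x] by simp
qed

end

section \<open>Deep points and a facet of large determinant\<close>

context flat_lattice
begin

text \<open>If no point of \<open>x + V\<close> lies deep in the orthant, some functional \<open>f \<ge> 0\<close> vanishing on
  \<open>V\<close> is almost zero at \<open>x\<close>, hence almost zero at a family of lattice vectors that form a basis
  modulo \<open>V\<close>.  These vectors are then almost dependent modulo \<open>V\<close>, and simultaneous approximation
  of the coefficients yields a lattice vector outside \<open>V\<close> that is too short.\<close>

lemma deep_point:
  assumes x: "x \<in> positive_points" "a \<bullet> x \<le> 4 * CARD('n) + 1"
    and N: "0 < N" "4 * CARD('n) * (((4 * CARD('n) + 1) / \<kappa> + 1) / c0) \<le> c0 * real N"
    and c: "\<epsilon> \<le> c" "8 * CARD('n) * CARD('n) * real N ^ CARD('n) * c \<le> c0 * c0"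
  shows "\<exists>v\<in>V. \<forall>i. c * t i \<le> (x + v) $ i"
proof (rule ccontr)
  assume none: "\<not> ?thesis"
  define n where "n = real CARD('n)"
  have n: "1 \<le> n" using one_le_card by (simp add: n_def)
  \<comment> \<open>On lattice points of the box s, K1 bounds every functional of norm 1 vanishing
    on V, whereas \<open>\<delta>\<close> is the much smaller bound for the particular functional
    f.\<close>
  define K1 where "K1 = ((4 * n + 1) / \<kappa> + 1) / c0"
  define \<delta> where "\<delta> = 2 * c / c0"
  have c_pos: "0 < c" using c(1) \<epsilon>(1) by simp
  have K1: "0 < K1" "4 * n * K1 \<le> c0 * real N"
  proof -
    show "0 < K1" using n \<kappa>_pos c0(1) by (auto simp: K1_def intro!: divide_pos_pos add_nonneg_pos)
    show "4 * n * K1 \<le> c0 * real N" using N(2) by (simp add: K1_def n_def add.commute)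
  qed
  have \<delta>: "0 < \<delta>" using c_pos c0(1) by (simp add: \<delta>_def)
  define l where "l u = weighted_l1 t u" for u
  have l0: "0 \<le> l u" for u unfolding l_def by (rule weighted_l1_nonneg[OF t_pos])
  obtain f where f: "\<And>v. v \<in> V \<Longrightarrow> f \<bullet> v = 0" "\<And>i. 0 \<le> f $ i" "weighted_l1 t f = 1" "f \<bullet> x \<le> c"
    using deep_point_or_functional[OF subspace_V t_pos none] by metis
  define s where "s i = (x $ i + \<epsilon> * t i) / c0" for i
  have ls: "weighted_l1 s u = (weighted_l1 (\<lambda>i. x $ i) u + \<epsilon> * l u) / c0" for u
  proof -
    have "weighted_l1 s u = (\<Sum>k\<in>UNIV. (\<bar>u $ k\<bar> * x $ k + \<epsilon> * (\<bar>u $ k\<bar> * t k)) / c0)"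
      unfolding weighted_l1_def by (rule sum.cong) (simp_all add: s_def algebra_simps)
    then show ?thesis by (simp add: l_def weighted_l1_def sum_divide_distrib[symmetric] sum.distrib sum_distrib_left)
  qed
  have sbox: "\<bar>y $ i\<bar> \<le> s i" if "y \<in> lattice_box s" for y i using that by (simp add: lattice_box_def)
  have box: "\<bar>u \<bullet> y\<bar> \<le> K1 * l u" if u: "orth u" and y: "y \<in> lattice_box s" for u y
  proof -
    have "\<bar>u \<bullet> y\<bar> \<le> weighted_l1 s u" by (rule abs_inner_le_weighted_l1) (rule sbox[OF y])
    also have "\<dots> \<le> ((4 * n + 1) / \<kappa> * l u + 1 * l u) / c0"
      unfolding ls using c0(1)
    proof (intro divide_right_mono add_mono)
      show "weighted_l1 (\<lambda>i. x $ i) u \<le> (4 * n + 1) / \<kappa> * l u"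
        unfolding l_def n_def by (rule weighted_l1_point[OF x(1) _ u]) (use x(2) in simp)
      show "\<epsilon> * l u \<le> 1 * l u" using \<epsilon>_le(2) l0 by (rule mult_right_mono)
    qed simp
    also have "\<dots> = K1 * l u" unfolding K1_def times_divide_eq_left distrib_right ..
    finally show ?thesis .
  qed
  have fbox: "\<bar>f \<bullet> y\<bar> \<le> \<delta>" if y: "y \<in> lattice_box s" for y
  proof -
    have "\<bar>f \<bullet> y\<bar> \<le> weighted_l1 s f" by (rule abs_inner_le_weighted_l1) (rule sbox[OF y])
    also have "weighted_l1 (\<lambda>i. x $ i) f = f \<bullet> x" using f(2) by (simp add: weighted_l1_def inner_vec_def)
    then have "weighted_l1 s f = (f \<bullet> x + \<epsilon>) / c0" unfolding ls l_def f(3) by simp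
    also have "\<dots> \<le> \<delta>" unfolding \<delta>_def using f(4) c(1) c0(1) by (intro divide_right_mono) auto
    finally show ?thesis .
  qed
  have "\<exists>k. 1 / n \<le> f $ k * t k"
  proof (rule ccontr)
    assume "\<not> ?thesis"
    then have "(\<Sum>k\<in>UNIV. f $ k * t k) < (\<Sum>k\<in>(UNIV::'n set). 1 / n)"
      by (intro sum_strict_mono) (auto simp: not_le)
    then show False using f(2,3) n by (simp add: weighted_l1_def n_def)
  qed
  then obtain k where k: "1 / n \<le> f $ k * t k" by blast
  then have "0 < f $ k * t k" using n by (intro less_le_trans[OF _ k]) simp
  then have fk: "0 < f $ k" using t_pos[of k] by (simp add: zero_less_mult_iff)
  \<comment> \<open>A test vector with \<open>f \<bullet> e = 1\<close> on which every functional is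
    at most n times its norm; k is a coordinate carrying at least 1 / n of the norm of f.\<close>
  define e where "e = axis k (1 / f $ k)"
  have ue: "u \<bullet> e = u $ k / f $ k" for u by (simp add: e_def inner_axis)
  have fe: "f \<bullet> e = 1" using fk by (simp add: ue)
  have ule: "\<bar>u \<bullet> e\<bar> \<le> n * l u" for u
  proof -
    have "1 / f $ k \<le> n * t k" using k fk n by (simp add: field_simps)
    then have "\<bar>u $ k\<bar> * (1 / f $ k) \<le> \<bar>u $ k\<bar> * (n * t k)" by (intro mult_left_mono) auto
    also have "\<dots> = n * (\<bar>u $ k\<bar> * t k)" by simp
    also have "\<dots> \<le> n * l u"
      unfolding l_def weighted_l1_def using t_pos n by (intro mult_left_mono member_le_sum) (auto simp: less_imp_le)
    finally show ?thesis using fk by (simp add: ue)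
  qed
  obtain B where B: "B \<subseteq> lattice_box (\<lambda>i. \<epsilon> * t i)" "independent B" "lattice_box (\<lambda>i. \<epsilon> * t i) \<subseteq> span B"
    using maximal_independent_subset by blast
  have "V \<subseteq> span B" unfolding V_def using B(3) by (rule span_minimal) simp
  moreover have "span B \<subseteq> V" unfolding V_def by (rule span_mono[OF B(1)])
  ultimately have VB: "V = span B" by blast
  \<comment> \<open>The basis B of V is completed by lattice vectors of the box s; the added vectors
    Y form a basis modulo V.\<close>
  obtain C where C: "B \<subseteq> C" "C \<subseteq> B \<union> lattice_box s" "independent C" "B \<union> lattice_box s \<subseteq> span C"
    using maximal_independent_subset_extend[of B "B \<union> lattice_box s"] B(2) by blast
  have "span (lattice_box s) \<subseteq> span C" using C(4) by (intro span_minimal) auto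
  then have spC: "span C = UNIV" using span_at_point[OF x(1)] unfolding s_def by blast
  have fC: "finite C" using C(3) independent_imp_finite by blast
  define Y where "Y = C - B"
  have Y: "Y \<subseteq> lattice_box s" "finite Y" "B \<inter> Y = {}" "B \<union> Y = C" using C fC by (auto simp: Y_def)
  have cardY: "card Y \<le> CARD('n)"
  proof -
    have "card Y \<le> card C" using fC by (intro card_mono) (auto simp: Y_def)
    also have "\<dots> \<le> CARD('n)" using independent_bound[OF C(3)] by simp
    finally show ?thesis .
  qed
  have "e \<in> span C" using spC by simp
  then obtain \<gamma> where \<gamma>: "e = (\<Sum>b\<in>C. \<gamma> b *\<^sub>R b)" unfolding span_finite[OF fC] by auto
  have fB: "finite B" using C(1) fC by (rule finite_subset)
  have esplit: "e = (\<Sum>b\<in>B. \<gamma> b *\<^sub>R b) + (\<Sum>y\<in>Y. \<gamma> y *\<^sub>R y)"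
    unfolding \<gamma> Y(4)[symmetric] by (rule sum.union_disjoint[OF fB Y(2,3)])
  have BV: "(\<Sum>b\<in>B. g b *\<^sub>R b) \<in> V" for g unfolding VB by (intro span_sum span_scale span_base)
  have eY: "u \<bullet> e = (\<Sum>y\<in>Y. \<gamma> y * (u \<bullet> y))" if "orth u" for u
  proof -
    have "u \<bullet> e = u \<bullet> (\<Sum>b\<in>B. \<gamma> b *\<^sub>R b) + u \<bullet> (\<Sum>y\<in>Y. \<gamma> y *\<^sub>R y)"
      by (subst esplit) (rule inner_add_right)
    also have "u \<bullet> (\<Sum>b\<in>B. \<gamma> b *\<^sub>R b) = 0" using that BV[of \<gamma>] unfolding orth_def by blast
    finally show ?thesis by (simp add: inner_sum_right)
  qed
  have of: "orth f" using f(1) by (simp add: orth_def)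
  have "Y \<noteq> {}"
  proof
    assume "Y = {}"
    then have "f \<bullet> e = 0" unfolding eY[OF of] by simp
    then show False using fe by simp
  qed
  \<comment> \<open>Dividing by the largest coefficient gives the others absolute value at most 1
    and y0 the coefficient 1, which later makes its integer approximation exactly q and hence
    nonzero.\<close>
  have "Max ((\<lambda>y. \<bar>\<gamma> y\<bar>) ` Y) \<in> (\<lambda>y. \<bar>\<gamma> y\<bar>) ` Y" using Y(2) \<open>Y \<noteq> {}\<close> by (intro Max_in) auto
  then obtain y0 where y0: "y0 \<in> Y" "Max ((\<lambda>y. \<bar>\<gamma> y\<bar>) ` Y) = \<bar>\<gamma> y0\<bar>" by blast
  have max: "\<bar>\<gamma> y\<bar> \<le> \<bar>\<gamma> y0\<bar>" if "y \<in> Y" for y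
    unfolding y0(2)[symmetric] using Y(2) that by (intro Max_ge) auto
  have g0: "\<gamma> y0 \<noteq> 0"
  proof
    assume "\<gamma> y0 = 0"
    then have "\<gamma> y = 0" if "y \<in> Y" for y using max[OF that] by simp
    then have "f \<bullet> e = 0" unfolding eY[OF of] by simp
    then show False using fe by simp
  qed
  define d where "d y = \<gamma> y / \<gamma> y0" for y
  have d: "\<bar>d y\<bar> \<le> 1" if "y \<in> Y" for y using max[OF that] g0 by (simp add: d_def divide_le_eq)
  have d0: "d y0 = 1" using g0 by (simp add: d_def)
  have dsum: "(\<Sum>y\<in>Y. d y * (u \<bullet> y)) = (u \<bullet> e) / \<gamma> y0" if "orth u" for u
    unfolding eY[OF that] by (simp add: d_def sum_divide_distrib)
  have cardY': "real (card Y) \<le> n" using cardY by (simp add: n_def)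
  have sumY: "\<bar>\<Sum>y\<in>Y. p y\<bar> \<le> n * q" if "\<And>y. y \<in> Y \<Longrightarrow> \<bar>p y\<bar> \<le> q" "0 \<le> q" for p q
  proof -
    have "\<bar>\<Sum>y\<in>Y. p y\<bar> \<le> (\<Sum>y\<in>Y. \<bar>p y\<bar>)" by (rule sum_abs)
    also have "\<dots> \<le> (\<Sum>y\<in>Y. q)" using that(1) by (rule sum_mono)
    also have "\<dots> \<le> n * q" using cardY' that(2) by (simp add: mult_right_mono)
    finally show ?thesis .
  qed
  \<comment> \<open>Since \<open>f \<bullet> e = 1\<close> while f is at most
    \<open>\<delta>\<close> on Y, the coefficient of y0 is huge. The normalised combination of Y is
    therefore nearly zero modulo V.\<close>
  have inv\<gamma>: "\<bar>1 / \<gamma> y0\<bar> \<le> n * \<delta>"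
  proof -
    have "1 / \<gamma> y0 = (\<Sum>y\<in>Y. d y * (f \<bullet> y))" using dsum[OF of] fe by simp
    also have "\<bar>\<dots>\<bar> \<le> n * \<delta>"
    proof (rule sumY)
      fix y assume y: "y \<in> Y"
      have "\<bar>d y\<bar> * \<bar>f \<bullet> y\<bar> \<le> 1 * \<delta>" using d[OF y] fbox[of y] Y(1) y by (intro mult_mono) auto
      then show "\<bar>d y * (f \<bullet> y)\<bar> \<le> \<delta>" by (simp add: abs_mult)
    qed (use \<delta> in simp)
    finally show ?thesis .
  qed
  obtain h where h: "bij_betw h {0..<card Y} Y" using ex_bij_betw_nat_finite[OF Y(2)] by blast
  obtain q p where q: "0 < q" "q \<le> int (N ^ card Y)"
    and p: "\<And>i. i < card Y \<Longrightarrow> \<bar>of_int q * d (h i) - of_int (p i)\<bar> < 1 / real N"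
    using Dirichlet_approx_simult[OF N(1), of "card Y" "\<lambda>i. d (h i)"] by metis
  define m where "m y = p (inv_into {0..<card Y} h y)" for y
  have m: "\<bar>of_int q * d y - of_int (m y)\<bar> < 1 / real N" if "y \<in> Y" for y
  proof -
    have "y \<in> h ` {0..<card Y}" using that h by (simp add: bij_betw_def)
    then have "inv_into {0..<card Y} h y \<in> {0..<card Y}" "h (inv_into {0..<card Y} h y) = y"
      by (rule inv_into_into[of _ h], rule f_inv_into_f[of _ h])
    then show ?thesis using p[of "inv_into {0..<card Y} h y"] by (simp add: m_def)
  qed
  have qN: "of_int q \<le> real N ^ CARD('n)"
  proof -
    have "real_of_int q \<le> real_of_int (int (N ^ card Y))" using q(2) unfolding of_int_le_iff .
    also have "\<dots> = real N ^ card Y" by simp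
    also have "\<dots> \<le> real N ^ CARD('n)" using N(1) cardY by (intro power_increasing) auto
    finally show ?thesis .
  qed
  have N1: "1 / real N \<le> 1" using N(1) by simp
  have "\<bar>real_of_int q * 1 - real_of_int (m y0)\<bar> < 1 / real N" using m[OF y0(1)] unfolding d0 .
  then have "\<bar>real_of_int (q - m y0)\<bar> < 1" using N1 unfolding of_int_diff by linarith
  then have "m y0 = q" by linarith
  then have m0: "m y0 \<noteq> 0" using q(1) by simp
  define z where "z = (\<Sum>y\<in>Y. of_int (m y) *\<^sub>R y)"
  have zL: "z \<in> L" unfolding z_def
    using Y(1) lattice_box_subset by (intro sum_in of_int_scaleR_in) blast
  have "z \<notin> V"
  proof
    assume zV: "z \<in> V"
    have "z = of_int (m y0) *\<^sub>R y0 + (\<Sum>y\<in>Y - {y0}. of_int (m y) *\<^sub>R y)"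
      unfolding z_def by (rule sum.remove[OF Y(2) y0(1)])
    then have eq: "of_int (m y0) *\<^sub>R y0 = z - (\<Sum>y\<in>Y - {y0}. of_int (m y) *\<^sub>R y)" by simp
    have "B \<subseteq> C - {y0}" using Y(3,4) y0(1) by blast
    then have "z \<in> span (C - {y0})" using zV span_mono unfolding VB by blast
    moreover have "(\<Sum>y\<in>Y - {y0}. of_int (m y) *\<^sub>R y) \<in> span (C - {y0})"
      using Y(4) by (intro span_sum span_scale span_base) blast
    ultimately have "of_int (m y0) *\<^sub>R y0 \<in> span (C - {y0})" unfolding eq by (rule span_diff)
    then have "(1 / of_int (m y0)) *\<^sub>R (of_int (m y0) *\<^sub>R y0) \<in> span (C - {y0})" by (rule span_scale)
    then have "y0 \<in> span (C - {y0})" using m0 by simp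
    then show False using C(3) y0(1) Y(4) unfolding dependent_def by blast
  qed
  \<comment> \<open>The exact relation, multiplied by q, contributes at most a quarter of c0 by the
    hypothesis on c; the approximation errors contribute another quarter by the hypothesis on N.
    Rounding in V uses the remaining half, so z can be moved into the box
    \<open>c0 * t\<close>.\<close>
  have bound: "\<bar>u \<bullet> z\<bar> \<le> c0 / 2 * weighted_l1 t u" if "\<And>v. v \<in> V \<Longrightarrow> u \<bullet> v = 0" for u
  proof -
    have u: "orth u" using that by (simp add: orth_def)
    have "u \<bullet> z = (\<Sum>y\<in>Y. of_int (m y) * (u \<bullet> y))" by (simp add: z_def inner_sum_right)
    also have "\<dots> = (\<Sum>y\<in>Y. of_int q * (d y * (u \<bullet> y)) - (of_int q * d y - of_int (m y)) * (u \<bullet> y))"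
      by (rule sum.cong) (simp_all add: algebra_simps)
    also have "\<dots> = of_int q * ((u \<bullet> e) / \<gamma> y0) - (\<Sum>y\<in>Y. (of_int q * d y - of_int (m y)) * (u \<bullet> y))"
      unfolding sum_subtractf sum_distrib_left[symmetric] dsum[OF u] ..
    finally have uz: "u \<bullet> z = of_int q * ((u \<bullet> e) / \<gamma> y0) - (\<Sum>y\<in>Y. (of_int q * d y - of_int (m y)) * (u \<bullet> y))" .
    have "\<bar>\<Sum>y\<in>Y. (of_int q * d y - of_int (m y)) * (u \<bullet> y)\<bar> \<le> n * (1 / real N * (K1 * l u))"
    proof (rule sumY)
      fix y assume y: "y \<in> Y"
      show "\<bar>(of_int q * d y - of_int (m y)) * (u \<bullet> y)\<bar> \<le> 1 / real N * (K1 * l u)"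
        unfolding abs_mult using m[OF y] box[OF u, of y] Y(1) y by (intro mult_mono) auto
    qed (use K1(1) l0 in simp)
    also have "n * (1 / real N * (K1 * l u)) = (n * K1 / real N) * l u" by simp
    also have "\<dots> \<le> c0 / 4 * l u"
      using K1(2) N(1) l0 by (intro mult_right_mono) (auto simp: divide_le_eq)
    finally have one: "\<bar>\<Sum>y\<in>Y. (of_int q * d y - of_int (m y)) * (u \<bullet> y)\<bar> \<le> c0 / 4 * l u" .
    have "\<bar>of_int q * ((u \<bullet> e) / \<gamma> y0)\<bar> = of_int q * (\<bar>u \<bullet> e\<bar> * \<bar>1 / \<gamma> y0\<bar>)"
      using q(1) by (simp add: abs_mult)
    also have "\<dots> \<le> real N ^ CARD('n) * ((n * l u) * (n * \<delta>))"
      using qN ule inv\<gamma> n l0 q(1) by (intro mult_mono) auto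
    also have "\<dots> = (real N ^ CARD('n) * n * n * \<delta>) * l u" by simp
    also have "\<dots> \<le> c0 / 4 * l u"
    proof (intro mult_right_mono l0)
      have "real N ^ CARD('n) * n * n * \<delta> = (8 * n * n * real N ^ CARD('n) * c) / (4 * c0)" by (simp add: \<delta>_def)
      also have "\<dots> \<le> (c0 * c0) / (4 * c0)" using c(2) c0(1) unfolding n_def by (intro divide_right_mono) auto
      finally show "real N ^ CARD('n) * n * n * \<delta> \<le> c0 / 4" using c0(1) by simp
    qed
    finally have two: "\<bar>of_int q * ((u \<bullet> e) / \<gamma> y0)\<bar> \<le> c0 / 4 * l u" .
    have "\<bar>u \<bullet> z\<bar> \<le> c0 / 4 * l u + c0 / 4 * l u"
      unfolding uz by (rule order_trans[OF abs_triangle_ineq4 add_mono[OF two one]])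
    also have "\<dots> = c0 / 2 * weighted_l1 t u" unfolding l_def by (simp add: field_simps)
    finally show ?thesis .
  qed
  have "0 \<le> c0 / 2" using c0(1) by simp
  then obtain v where v: "v \<in> V" "\<And>i. \<bar>(z + v) $ i\<bar> \<le> c0 / 2 * t i"
    using bounded_lift[OF subspace_V t_pos _ bound] by metis
  obtain w where w: "w \<in> L" "w \<in> V" "\<And>i. \<bar>w $ i - v $ i\<bar> \<le> CARD('n) * \<epsilon> * t i"
    using round_in_V[OF v(1)] by blast
  have "\<bar>(z + w) $ i\<bar> \<le> c0 * t i" for i
  proof -
    have "CARD('n) * \<epsilon> * t i \<le> c0 / 2 * t i" using \<epsilon>(2) t_pos[of i] by (intro mult_right_mono) auto
    then show ?thesis using v(2)[of i] w(3)[of i] unfolding vector_add_component by linarith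
  qed
  then have "z + w \<in> lattice_box (\<lambda>i. c0 * t i)" using zL w(1) by (simp add: lattice_box_def add_in)
  then have "z + w \<in> V" using lattice_box_subset_V by blast
  then have "(z + w) - w \<in> V" using w(2) subspace_V by (intro subspace_diff) auto
  then show False using \<open>z \<notin> V\<close> by simp
qed

text \<open>A facet through a minimum of \<open>a\<close> contains a long lattice segment parallel to \<open>V\<close>.\<close>

lemma facet_with_large_det:
  assumes N: "0 < N" "4 * CARD('n) * (((4 * CARD('n) + 1) / \<kappa> + 1) / c0) \<le> c0 * real N"
    and c: "(CARD('n) + real M) * \<epsilon> < c" "8 * CARD('n) * CARD('n) * real N ^ CARD('n) * c \<le> c0 * c0"
  obtains F where "F facet_of K" "\<And>D. facet_det F \<le> ennreal D \<Longrightarrow> real M \<le> max D 0"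
proof -
  obtain x where x: "x \<in> positive_points" "a \<bullet> x \<le> 4 * CARD('n) + 1" "\<And>y. y \<in> positive_points \<Longrightarrow> a \<bullet> x \<le> a \<bullet> y"
    using minimizer by blast
  have "1 * \<epsilon> \<le> (CARD('n) + real M) * \<epsilon>"
    by (rule mult_right_mono) (use \<epsilon>(1) one_le_card in linarith)+
  then have "\<epsilon> \<le> c" using c(1) by linarith
  then obtain v where v: "v \<in> V" "\<And>i. c * t i \<le> (x + v) $ i"
    using deep_point[OF x(1,2) N _ c(2)] by blast
  obtain w where w: "w \<in> L" "w \<in> V" "\<And>i. \<bar>w $ i - v $ i\<bar> \<le> CARD('n) * \<epsilon> * t i"
    using round_in_V[OF v(1)] by blast
  obtain s where sbox: "s \<in> lattice_box (\<lambda>i. \<epsilon> * t i)" and s0: "s \<noteq> 0" using nontrivial by blast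
  have "s \<in> V" unfolding V_def by (rule span_base[OF sbox])
  moreover have "s \<in> L" "\<And>i. \<bar>s $ i\<bar> \<le> \<epsilon> * t i" using sbox by (simp_all add: lattice_box_def)
  ultimately have s: "s \<in> L" "s \<noteq> 0" "\<And>i. \<bar>s $ i\<bar> \<le> \<epsilon> * t i" "s \<in> V" using s0 by simp_all
  define p where "p = x + w"
  \<comment> \<open>The depth c pays for the rounding of v, of size n \<open>\<epsilon>\<close> t,
    and for M steps of size \<open>\<epsilon>\<close> t.\<close>
  have inA: "p + real m *\<^sub>R s \<in> positive_points" if "m \<le> M" for m
  proof -
    have "0 < (p + real m *\<^sub>R s) $ i" for i
    proof -
      have "\<bar>real m * s $ i\<bar> \<le> real M * (\<epsilon> * t i)"
        unfolding abs_mult by (rule mult_mono[OF _ s(3)]) (use that in simp_all)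
      moreover have "(CARD('n) + real M) * \<epsilon> * t i < c * t i" using c(1) t_pos by (rule mult_strict_right_mono)
      moreover have "(CARD('n) + real M) * \<epsilon> * t i = CARD('n) * \<epsilon> * t i + real M * (\<epsilon> * t i)" by (simp add: algebra_simps)
      moreover have "(p + real m *\<^sub>R s) $ i = (x + v) $ i + (w $ i - v $ i) + real m * s $ i" by (simp add: p_def)
      ultimately show ?thesis using v(2)[of i] w(3)[of i] by linarith
    qed
    moreover have "p + real m *\<^sub>R s \<in> L"
      unfolding p_def using x(1) w(1) s(1) by (intro add_in of_nat_scaleR_in) (simp_all add: positive_points_iff)
    ultimately show ?thesis by (simp add: positive_points_iff)
  qed
  define p' where "p' = p + real M *\<^sub>R s"
  have pA: "p \<in> positive_points" "p' \<in> positive_points" using inA[of 0] inA[of M] by (simp_all add: p'_def)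
  have ap: "a \<bullet> p = a \<bullet> x" "a \<bullet> p' = a \<bullet> x"
    using w(2) s(4) a_orth by (simp_all add: p_def p'_def orth_def inner_add_right)
  obtain F where F: "F facet_of K" "\<And>y. y \<in> K \<Longrightarrow> a \<bullet> y = a \<bullet> p \<Longrightarrow> y \<in> F"
    using facet_through[OF pA(1) a_nonzero] x(3) unfolding ap(1) by blast
  have "p \<in> F" "p' \<in> F" using F(2) pA positive_points_subset_K ap by auto
  have "real M \<le> max D 0" if D: "facet_det F \<le> ennreal D" for D
  proof (cases "M = 0")
    case False
    have "independent {p, p'}"
    proof -
      have "p \<notin> V" using a_positive[OF pA(1)] a_orth by (auto simp: orth_def)
      have "p \<noteq> p'" using False s(2) by (simp add: p'_def)
      moreover have "p \<notin> span {p'}"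
      proof
        assume "p \<in> span {p'}"
        then obtain r where r: "p = r *\<^sub>R p'" by (auto simp: span_singleton)
        have "a \<bullet> p = r * (a \<bullet> p')" by (subst r) simp
        then have "r = 1" using ap a_positive[OF x(1)] by simp
        then show False using r \<open>p \<noteq> p'\<close> by simp
      qed
      moreover have "p' \<noteq> 0" using pA(2) a_positive by force
      ultimately show ?thesis by (simp add: independent_insert)
    qed
    then obtain B where B: "{p, p'} \<subseteq> B" "B \<subseteq> positive_points \<inter> F" "independent B" "positive_points \<inter> F \<subseteq> span B"
      using maximal_independent_subset_extend[of "{p, p'}" "positive_points \<inter> F"] pA \<open>p \<in> F\<close> \<open>p' \<in> F\<close> by blast
    have "span (positive_points \<inter> F) \<subseteq> span B" using B(4) by (rule span_minimal) simp
    then have "span B = UNIV" using facet_points_span[OF F(1)] by blast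
    then obtain g :: "'n \<Rightarrow> real^'n" where g: "bij_betw g UNIV B" "det (\<chi> i. g i) \<noteq> 0" using enum_basis[OF B(3)] by blast
    obtain i j where ij: "g i = p" "g j = p'" using g(1) B(1) unfolding bij_betw_def by blast
    have "p \<noteq> p'" using False s(2) by (simp add: p'_def)
    then have "i \<noteq> j" using ij by auto
    have "g k \<in> B" for k using g(1) by (auto simp: bij_betw_def)
    then have gF: "g k \<in> F" "g k \<in> L" for k using B(2) positive_points_iff by blast+
    \<comment> \<open>The rows p and p' differ by M s, so the determinant is M times one with row s
      in place of p', and that one is a nonzero integer.\<close>
    have lin: "linear (\<lambda>y. det (\<chi> k. (g(j := y)) k))" by (rule linear_det_row)
    have "det (\<chi> k. (g(j := p)) k) = 0"
      by (rule det_identical_rows[OF \<open>i \<noteq> j\<close>]) (use ij \<open>i \<noteq> j\<close> in \<open>simp add: row_def vec_eq_iff\<close>)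
    moreover have "det (\<chi> k. (g(j := p')) k) = det (\<chi> k. (g(j := p)) k) + real M * det (\<chi> k. (g(j := s)) k)"
      unfolding p'_def using linear_add[OF lin, of p "real M *\<^sub>R s"] linear_scale[OF lin, of "real M" s] by simp
    moreover have "g(j := p') = g" using ij(2) by auto
    ultimately have det: "det (\<chi> k. g k) = real M * det (\<chi> k. (g(j := s)) k)" by simp
    then have "det (\<chi> k. (g(j := s)) k) \<noteq> 0" using g(2) by auto
    then have one: "1 \<le> \<bar>det (\<chi> k. (g(j := s)) k)\<bar>" by (rule abs_det_ge_1[rotated]) (simp add: gF s(1))
    have "real M * 1 \<le> \<bar>det (\<chi> k. g k)\<bar>"
      unfolding det abs_mult by (rule mult_mono[OF _ one]) simp_all
    also have "\<dots> \<le> max D 0" by (rule facet_det_bound[OF facet_is_face[OF F(1)] gF(1) D])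
    finally show ?thesis by simp
  qed simp
  then show ?thesis using that F(1) by blast
qed

end

section \<open>Reflections\<close>

definition reflect :: "real^'n::finite \<Rightarrow> real^'n \<Rightarrow> real^'n" where
  "reflect \<sigma> x = (\<chi> i. \<sigma> $ i * x $ i)"

definition sign_vector :: "real^'n::finite \<Rightarrow> bool" where
  "sign_vector \<sigma> \<longleftrightarrow> (\<forall>i. \<sigma> $ i = 1 \<or> \<sigma> $ i = -1)"

lemma reflect_nth [simp]: "reflect \<sigma> x $ i = \<sigma> $ i * x $ i"
  by (simp add: reflect_def)

lemma sign_vector_mult: "sign_vector \<sigma> \<Longrightarrow> \<sigma> $ i * (\<sigma> $ i * y) = y"
  unfolding sign_vector_def by (metis mult_1 mult_minus1 minus_minus)

lemma sign_vector_abs: "sign_vector \<sigma> \<Longrightarrow> \<bar>\<sigma> $ i\<bar> = 1"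
  unfolding sign_vector_def by (metis abs_1 abs_minus_cancel)

lemma reflect_reflect: "sign_vector \<sigma> \<Longrightarrow> reflect \<sigma> (reflect \<sigma> x) = x"
  by (simp add: vec_eq_iff sign_vector_mult)

lemma linear_reflect: "linear (reflect \<sigma>)"
  by (rule linearI) (simp_all add: vec_eq_iff distrib_left mult_ac)

lemma bij_reflect: "sign_vector \<sigma> \<Longrightarrow> bij (reflect \<sigma>)"
  by (rule o_bij[of "reflect \<sigma>"]) (simp_all add: fun_eq_iff reflect_reflect)

lemma inj_reflect: "sign_vector \<sigma> \<Longrightarrow> inj (reflect \<sigma>)"
  by (rule bij_is_inj[OF bij_reflect])

lemma reflect_image: "sign_vector \<sigma> \<Longrightarrow> reflect \<sigma> ` reflect \<sigma> ` S = S"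
  by (simp add: image_image reflect_reflect)

lemma inner_reflect: "reflect \<sigma> x \<bullet> y = x \<bullet> reflect \<sigma> y"
  by (simp add: inner_vec_def mult_ac)

lemma abs_prod_reflect:
  assumes "sign_vector \<sigma>"
  shows "\<bar>\<Prod>i\<in>UNIV. reflect \<sigma> x $ i\<bar> = \<bar>\<Prod>i\<in>UNIV. x $ i\<bar>"
  by (simp add: abs_prod abs_mult sign_vector_abs[OF assms])

lemma weighted_l1_reflect: "sign_vector \<sigma> \<Longrightarrow> weighted_l1 t (reflect \<sigma> u) = weighted_l1 t u"
  by (simp add: weighted_l1_def abs_mult sign_vector_abs)

lemma abs_det_reflect_rows:
  fixes g :: "'n::finite \<Rightarrow> real^'n"
  assumes "sign_vector \<sigma>"
  shows "\<bar>det (\<chi> i. reflect \<sigma> (g i))\<bar> = \<bar>det (\<chi> i. g i)\<bar>"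
proof -
  define E :: "real^'n^'n" where "E = (\<chi> i j. if i = j then \<sigma> $ i else 0)"
  have "((\<chi> i. g i) ** E) $ i $ j = (\<chi> i. reflect \<sigma> (g i)) $ i $ j" for i j
  proof -
    have "((\<chi> i. g i) ** E) $ i $ j = (\<Sum>k\<in>UNIV. if k = j then g i $ k * \<sigma> $ k else 0)"
      unfolding matrix_matrix_mult_def E_def vec_lambda_beta by (rule sum.cong) auto
    also have "\<dots> = g i $ j * \<sigma> $ j" by simp
    finally show ?thesis by simp
  qed
  then have "(\<chi> i. reflect \<sigma> (g i)) = (\<chi> i. g i) ** E" by (simp add: vec_eq_iff)
  moreover have "det E = (\<Prod>i\<in>UNIV. E $ i $ i)" by (rule det_diagonal) (simp add: E_def)
  then have "\<bar>det E\<bar> = 1" by (simp add: E_def abs_prod sign_vector_abs[OF assms])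
  ultimately show ?thesis by (simp add: det_mul abs_mult)
qed

lemma abs_det_reflect:
  fixes S :: "(real^'n::finite) set"
  assumes \<sigma>: "sign_vector \<sigma>" and "card S = CARD('n)"
  shows "abs_det (reflect \<sigma> ` S) = abs_det S"
proof -
  have "finite S" using assms(2) card.infinite by fastforce
  then obtain f :: "'n \<Rightarrow> real^'n" where f: "bij_betw f UNIV S"
    using assms(2) finite_same_card_bij[of "UNIV::'n set" S] by auto
  have "bij_betw (reflect \<sigma>) S (reflect \<sigma> ` S)"
    using inj_on_subset[OF inj_reflect[OF \<sigma>], of S] by (simp add: bij_betw_def)
  with f have "bij_betw (reflect \<sigma> \<circ> f) UNIV (reflect \<sigma> ` S)" by (rule bij_betw_trans)
  from abs_det_eq[OF this] show ?thesis
    unfolding abs_det_eq[OF f] o_def abs_det_reflect_rows[OF \<sigma>] .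
qed

lemma det_sum_reflect:
  fixes W :: "(real^'n::finite) set"
  assumes \<sigma>: "sign_vector \<sigma>"
  shows "det_sum (reflect \<sigma> ` W) = det_sum W"
proof -
  have cardR: "card (reflect \<sigma> ` S) = card S" for S :: "(real^'n) set"
    by (rule card_image) (rule inj_on_subset[OF inj_reflect[OF \<sigma>]], simp)
  have "bij_betw (image (reflect \<sigma>)) {S. S \<subseteq> W \<and> card S = CARD('n)} {S. S \<subseteq> reflect \<sigma> ` W \<and> card S = CARD('n)}"
  proof (rule bij_betw_byWitness[of _ "image (reflect \<sigma>)"])
    show "\<forall>S\<in>{S. S \<subseteq> W \<and> card S = CARD('n)}. reflect \<sigma> ` reflect \<sigma> ` S = S"
      "\<forall>S\<in>{S. S \<subseteq> reflect \<sigma> ` W \<and> card S = CARD('n)}. reflect \<sigma> ` reflect \<sigma> ` S = S"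
      by (simp_all add: reflect_image[OF \<sigma>])
    show "image (reflect \<sigma>) ` {S. S \<subseteq> W \<and> card S = CARD('n)} \<subseteq> {S. S \<subseteq> reflect \<sigma> ` W \<and> card S = CARD('n)}"
      using cardR by auto
    show "image (reflect \<sigma>) ` {S. S \<subseteq> reflect \<sigma> ` W \<and> card S = CARD('n)} \<subseteq> {S. S \<subseteq> W \<and> card S = CARD('n)}"
    proof (rule image_subsetI)
      fix S assume S: "S \<in> {S. S \<subseteq> reflect \<sigma> ` W \<and> card S = CARD('n)}"
      then have "reflect \<sigma> ` S \<subseteq> reflect \<sigma> ` reflect \<sigma> ` W" by blast
      then show "reflect \<sigma> ` S \<in> {S. S \<subseteq> W \<and> card S = CARD('n)}" using S cardR by (simp add: reflect_image[OF \<sigma>])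
    qed
  qed
  then have "det_sum (reflect \<sigma> ` W) = (\<Sum>\<^sub>\<infinity>S\<in>{S. S \<subseteq> W \<and> card S = CARD('n)}. ennreal (abs_det (reflect \<sigma> ` S)))"
    unfolding det_sum_def by (rule infsum_reindex_bij_betw[symmetric])
  also have "\<dots> = det_sum W"
    unfolding det_sum_def by (rule infsum_cong) (simp add: abs_det_reflect[OF \<sigma>])
  finally show ?thesis .
qed

lemma facet_det_reflect:
  assumes \<sigma>: "sign_vector \<sigma>"
  shows "facet_det (reflect \<sigma> ` F) = facet_det F"
proof -
  have "vertices (reflect \<sigma> ` F) = reflect \<sigma> ` vertices F"
  proof (rule set_eqI)
    fix v
    have "{v} face_of reflect \<sigma> ` F \<longleftrightarrow> reflect \<sigma> ` {reflect \<sigma> v} face_of reflect \<sigma> ` F"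
      by (simp add: reflect_reflect[OF \<sigma>])
    also have "\<dots> \<longleftrightarrow> reflect \<sigma> v \<in> vertices F"
      unfolding face_of_linear_image[OF linear_reflect inj_reflect[OF \<sigma>]] by (simp add: vertices_def)
    also have "\<dots> \<longleftrightarrow> v \<in> reflect \<sigma> ` vertices F"
      by (metis image_iff reflect_reflect[OF \<sigma>])
    finally show "v \<in> vertices (reflect \<sigma> ` F) \<longleftrightarrow> v \<in> reflect \<sigma> ` vertices F" by (simp add: vertices_def)
  qed
  then show ?thesis unfolding facet_det_def by (simp add: det_sum_reflect[OF \<sigma>])
qed

lemma facet_of_reflect:
  assumes \<sigma>: "sign_vector \<sigma>"
  shows "reflect \<sigma> ` F facet_of reflect \<sigma> ` P \<longleftrightarrow> F facet_of P"
  by (simp add: facet_of_def face_of_linear_image linear_reflect inj_reflect[OF \<sigma>])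

lemma klein_polyhedron_orthant:
  assumes \<sigma>: "sign_vector \<sigma>"
  shows "klein_polyhedron L (orthant \<sigma>) = reflect \<sigma> ` klein_polyhedron (reflect \<sigma> ` L) positive_orthant"
proof -
  have "x \<in> L \<inter> orthant \<sigma> - {0} \<longleftrightarrow> x \<in> reflect \<sigma> ` (reflect \<sigma> ` L \<inter> positive_orthant - {0})" for x
  proof -
    have zero: "reflect \<sigma> x = 0 \<longleftrightarrow> x = 0"
      using linear_injective_0[OF linear_reflect] inj_reflect[OF \<sigma>] linear_0[OF linear_reflect] by metis
    have mem: "y \<in> reflect \<sigma> ` S \<longleftrightarrow> reflect \<sigma> y \<in> S" for y S by (metis image_iff reflect_reflect[OF \<sigma>])
    show ?thesis
      unfolding mem[of x] using zero mem[of "reflect \<sigma> x" L]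
      by (simp add: orthant_def positive_orthant_def reflect_reflect[OF \<sigma>])
  qed
  then have "L \<inter> orthant \<sigma> - {0} = reflect \<sigma> ` (reflect \<sigma> ` L \<inter> positive_orthant - {0})" by blast
  then show ?thesis unfolding klein_polyhedron_def by (simp add: convex_hull_linear_image[OF linear_reflect])
qed

text \<open>Reflecting the lattice instead of the orthant lets everything be proved for the positive
  orthant only.\<close>

lemma facets_bounded_orthant_iff:
  assumes \<sigma>: "sign_vector \<sigma>"
  shows "(\<forall>F. F facet_of klein_polyhedron L (orthant \<sigma>) \<longrightarrow> facet_det F \<le> D) \<longleftrightarrow>
    (\<forall>F. F facet_of klein_polyhedron (reflect \<sigma> ` L) positive_orthant \<longrightarrow> facet_det F \<le> D)"
    (is "?l \<longleftrightarrow> ?r")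
proof
  assume l: ?l
  show ?r
  proof (intro allI impI)
    fix F assume "F facet_of klein_polyhedron (reflect \<sigma> ` L) positive_orthant"
    then have "reflect \<sigma> ` F facet_of klein_polyhedron L (orthant \<sigma>)"
      unfolding klein_polyhedron_orthant[OF \<sigma>] facet_of_reflect[OF \<sigma>] .
    then have "facet_det (reflect \<sigma> ` F) \<le> D" using l by blast
    then show "facet_det F \<le> D" by (simp add: facet_det_reflect[OF \<sigma>])
  qed
next
  assume r: ?r
  show ?l
  proof (intro allI impI)
    fix F assume "F facet_of klein_polyhedron L (orthant \<sigma>)"
    then have "reflect \<sigma> ` reflect \<sigma> ` F facet_of reflect \<sigma> ` klein_polyhedron (reflect \<sigma> ` L) positive_orthant"
      unfolding reflect_image[OF \<sigma>] klein_polyhedron_orthant[OF \<sigma>] .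
    then have "reflect \<sigma> ` F facet_of klein_polyhedron (reflect \<sigma> ` L) positive_orthant"
      unfolding facet_of_reflect[OF \<sigma>] .
    then have "facet_det (reflect \<sigma> ` F) \<le> D" using r by blast
    then show "facet_det F \<le> D" by (simp add: facet_det_reflect[OF \<sigma>])
  qed
qed

lemma finite_sign_vectors: "finite {\<sigma> :: real^'n::finite. sign_vector \<sigma>}"
proof (rule finite_subset)
  show "{\<sigma> :: real^'n. sign_vector \<sigma>} \<subseteq> vec_lambda ` PiE UNIV (\<lambda>_. {1, -1})"
  proof
    fix \<sigma> :: "real^'n" assume "\<sigma> \<in> {\<sigma>. sign_vector \<sigma>}"
    then have "vec_nth \<sigma> \<in> PiE UNIV (\<lambda>_. {1, -1})" by (auto simp: sign_vector_def)
    then show "\<sigma> \<in> vec_lambda ` PiE UNIV (\<lambda>_. {1, -1})" by (intro image_eqI[of _ _ "vec_nth \<sigma>"]) simp_all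
  qed
  show "finite (vec_lambda ` PiE (UNIV :: 'n set) (\<lambda>_. {1::real, -1}))" by (intro finite_imageI finite_PiE) auto
qed

context irrational_unimodular_lattice
begin

lemma lattice_reflect:
  assumes \<sigma>: "sign_vector \<sigma>"
  shows "irrational_unimodular_lattice (reflect \<sigma> ` L)"
proof
  show "CARD('n) \<ge> 2" by (rule two_le_dim)
  obtain b where b: "lattice_basis b L" "\<bar>det (\<chi> i. b i)\<bar> = 1" by (rule basis)
  have "(\<lambda>z::'n \<Rightarrow> int. \<Sum>i\<in>UNIV. of_int (z i) *\<^sub>R reflect \<sigma> (b i)) =
      (\<lambda>z. reflect \<sigma> (\<Sum>i\<in>UNIV. of_int (z i) *\<^sub>R b i))"
    by (simp add: linear_sum[OF linear_reflect] linear_scale[OF linear_reflect])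
  then have "range (\<lambda>z::'n \<Rightarrow> int. \<Sum>i\<in>UNIV. of_int (z i) *\<^sub>R reflect \<sigma> (b i)) =
      range (\<lambda>z. reflect \<sigma> (\<Sum>i\<in>UNIV. of_int (z i) *\<^sub>R b i))" by (rule arg_cong)
  also have "\<dots> = reflect \<sigma> ` range (\<lambda>z. \<Sum>i\<in>UNIV. of_int (z i) *\<^sub>R b i)" by (rule image_image[symmetric])
  also have "\<dots> = reflect \<sigma> ` L" using b(1) unfolding lattice_basis_def by metis
  finally have "range (\<lambda>z::'n \<Rightarrow> int. \<Sum>i\<in>UNIV. of_int (z i) *\<^sub>R reflect \<sigma> (b i)) = reflect \<sigma> ` L" .
  moreover have "det (\<chi> i. reflect \<sigma> (b i)) \<noteq> 0"
    using abs_det_reflect_rows[OF \<sigma>, of b] b(2) by auto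
  ultimately have b': "lattice_basis (\<lambda>i. reflect \<sigma> (b i)) (reflect \<sigma> ` L)"
    using det_nz_iff_independent[of "\<lambda>i. reflect \<sigma> (b i)"] unfolding lattice_basis_def by simp
  then show "full_lattice (reflect \<sigma> ` L)" unfolding full_lattice_def by blast
  show "lattice_det (reflect \<sigma> ` L) = 1"
    unfolding lattice_det_eq[OF b'] abs_det_reflect_rows[OF \<sigma>] by (rule b(2))
  show "irrational_lattice (reflect \<sigma> ` L)"
  proof -
    have "reflect \<sigma> x = 0" if "x \<in> L" "\<sigma> $ i * x $ i = 0" for x i
    proof -
      have "x = 0" using that coord_nonzero[of x i] sign_vector_abs[OF \<sigma>, of i] by auto
      then show ?thesis by (simp add: linear_0[OF linear_reflect])
    qed
    then show ?thesis unfolding irrational_lattice_def by auto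
  qed
qed

end

section \<open>Facets with bounded determinants\<close>

context irrational_unimodular_lattice
begin

text \<open>The factor c is uniform over all boxes s. At rank 0, a box whose lattice points do not
  span contains no nonzero lattice point after shrinking by c.\<close>

definition rank_drop :: "nat \<Rightarrow> bool" where
  "rank_drop m \<longleftrightarrow> (\<exists>c>0. c \<le> 1 \<and> (\<forall>s. (\<forall>i. 0 < s i) \<longrightarrow> span (lattice_box s) \<noteq> UNIV \<longrightarrow>
     dim (span (lattice_box (\<lambda>i. c * s i))) \<le> m))"

text \<open>If the factor \<open>\<epsilon>\<close> failed for some s, the lattice vectors at scale
  \<open>\<epsilon>\<close> would already have the largest rank that
  \<open>rank_drop (Suc m)\<close> permits at scale c0. After enlarging s this is a flat lattice up
  to reflection, with a facet of determinant exceeding D.\<close>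

lemma rank_drop_step:
  assumes facets: "\<And>\<sigma> F. sign_vector \<sigma> \<Longrightarrow> F facet_of klein_polyhedron (reflect \<sigma> ` L) positive_orthant \<Longrightarrow> facet_det F \<le> ennreal D"
    and "rank_drop (Suc m)"
  shows "rank_drop m"
proof -
  obtain c0 where c0: "0 < c0" "c0 \<le> 1" and drop: "\<And>s. (\<And>i. 0 < s i) \<Longrightarrow> span (lattice_box s) \<noteq> UNIV \<Longrightarrow>
      dim (span (lattice_box (\<lambda>i. c0 * s i))) \<le> Suc m"
    using assms(2) unfolding rank_drop_def by blast
  define n where "n = real CARD('n)"
  have n: "2 \<le> n" using two_le_dim by (simp add: n_def)
  define \<kappa> :: real where "\<kappa> = (1/4) ^ CARD('n)"
  have \<kappa>: "0 < \<kappa>" by (simp add: \<kappa>_def)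
  \<comment> \<open>X, N and c are what the inequalities assumed by
    \<open>facet_with_large_det\<close> demand; c, and with it the factor \<open>\<epsilon>\<close>,
    can be fixed only after N.\<close>
  define X where "X = 4 * n * (((4 * n + 1) / \<kappa> + 1) / c0)"
  obtain N0 :: nat where N0: "X / c0 < real N0" using reals_Archimedean2 by blast
  define N where "N = Suc N0"
  have N: "0 < N" "X \<le> c0 * real N"
  proof -
    have "X / c0 \<le> real N" using N0 by (simp add: N_def)
    then show "X \<le> c0 * real N" using c0(1) by (simp add: divide_le_eq mult.commute)
  qed (simp add: N_def)
  obtain M :: nat where M: "max D 0 < real M" using reals_Archimedean2 by blast
  define c where "c = c0 * c0 / (8 * n * n * real N ^ CARD('n))"
  have den: "0 < 8 * n * n * real N ^ CARD('n)" using n N(1) by simp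
  have c: "0 < c" "8 * n * n * real N ^ CARD('n) * c \<le> c0 * c0"
    using den c0(1) by (simp_all add: c_def)
  \<comment> \<open>The first bound leaves room at depth c for a segment of M steps; the second
    keeps rounding in V below c0 / 2.\<close>
  define \<epsilon> where "\<epsilon> = min (c / (2 * (n + real M))) (c0 / (2 * n))"
  have nM: "0 < n + real M" using n by simp
  have \<epsilon>0: "0 < \<epsilon>" using c(1) c0(1) n nM by (simp add: \<epsilon>_def)
  have \<epsilon>c: "(n + real M) * \<epsilon> < c"
  proof -
    have "(n + real M) * \<epsilon> \<le> (n + real M) * (c / (2 * (n + real M)))"
      using nM by (intro mult_left_mono) (auto simp: \<epsilon>_def)
    also have "\<dots> = c / 2"
    proof -
      have "x * (c / (2 * x)) = c / 2" if "0 < x" for x using that by simp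
      from this[OF nM] show ?thesis .
    qed
    finally show ?thesis using c(1) by simp
  qed
  have \<epsilon>n: "n * \<epsilon> \<le> c0 / 2"
  proof -
    have "n * \<epsilon> \<le> n * (c0 / (2 * n))" using n by (intro mult_left_mono) (auto simp: \<epsilon>_def)
    also have "\<dots> = c0 / 2" using n by simp
    finally show ?thesis .
  qed
  have \<epsilon>1: "\<epsilon> \<le> 1"
  proof -
    have "1 * \<epsilon> \<le> n * \<epsilon>" using n \<epsilon>0 by (intro mult_right_mono) auto
    then show ?thesis using \<epsilon>n c0(2) by linarith
  qed
  have "dim (span (lattice_box (\<lambda>i. \<epsilon> * s i))) \<le> m"
    if s: "\<And>i. 0 < s i" and ns: "span (lattice_box s) \<noteq> UNIV" for s
  proof (rule ccontr)
    assume "\<not> ?thesis"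
    then have big: "Suc m \<le> dim (span (lattice_box (\<lambda>i. \<epsilon> * s i)))" by simp
    \<comment> \<open>The box is doubled until its lattice points span. The last box t before that
      does not span while 2 t does, so modulo V the lattice is neither dense nor sparse at scale t.
      Enlarging the box cannot lower the rank of V.\<close>
    define Q where "Q k \<longleftrightarrow> span (lattice_box (\<lambda>i. 2 ^ k * s i)) = UNIV" for k :: nat
    have "\<exists>k. Q k"
    proof -
      obtain r where r: "0 < r" "\<And>t. (\<And>i. r \<le> t i) \<Longrightarrow> span (lattice_box t) = UNIV" using span_lattice_box_UNIV by blast
      have "Min (range s) \<in> range s" by (rule Min_in) auto
      then have min: "0 < Min (range s)" using s by auto
      obtain k where k: "r / Min (range s) < 2 ^ k" using real_arch_pow[of 2 "r / Min (range s)"] by auto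
      have "r \<le> 2 ^ k * s i" for i
      proof -
        have "r < 2 ^ k * Min (range s)" using k min by (simp add: divide_less_eq)
        also have "\<dots> \<le> 2 ^ k * s i" by (intro mult_left_mono Min_le) auto
        finally show ?thesis by simp
      qed
      then have "Q k" unfolding Q_def by (rule r(2))
      then show ?thesis by blast
    qed
    then obtain k where k: "Q k" "\<And>j. j < k \<Longrightarrow> \<not> Q j" using exists_least_iff[of Q] by metis
    have "\<not> Q 0" using ns by (simp add: Q_def)
    then obtain j where j: "k = Suc j" using k(1) by (cases k) auto
    define t where "t i = 2 ^ j * s i" for i
    have t: "0 < t i" for i using s by (simp add: t_def)
    have not_full: "span (lattice_box t) \<noteq> UNIV" using k(2)[of j] j unfolding Q_def t_def by simp
    have full2: "span (lattice_box (\<lambda>i. 2 * t i)) = UNIV" using k(1) j unfolding Q_def t_def by (simp add: mult.assoc)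
    define V where "V = span (lattice_box (\<lambda>i. \<epsilon> * t i))"
    have dimV: "Suc m \<le> dim V"
    proof -
      have "s i \<le> t i" for i
        using mult_right_mono[of 1 "2 ^ j" "s i"] s[of i] by (simp add: t_def)
      then have "span (lattice_box (\<lambda>i. \<epsilon> * s i)) \<subseteq> V"
        unfolding V_def using \<epsilon>0 by (intro span_mono lattice_box_mono mult_left_mono) auto
      then have "dim (span (lattice_box (\<lambda>i. \<epsilon> * s i))) \<le> dim V" by (rule dim_subset)
      then show ?thesis using big by simp
    qed
    define W where "W = {u. \<forall>v\<in>V. u \<bullet> v = 0}"
    have W: "subspace W" unfolding W_def subspace_def by (simp add: inner_add_left)
    obtain a where a: "a \<in> W" "weighted_l1 t a \<le> 1"
      and dom: "\<And>u i. u \<in> W \<Longrightarrow> \<kappa> * \<bar>u $ i\<bar> \<le> \<bar>a $ i\<bar> * weighted_l1 t u"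
      by (rule dominating_functional[OF W t, folded \<kappa>_def]) (rule that)
    \<comment> \<open>The signs of a are dictated by V and cannot be chosen; this is where bounds in
      all orthants are used.\<close>
    define \<sigma> :: "real^'n" where "\<sigma> = (\<chi> i. if 0 \<le> a $ i then 1 else - 1)"
    have \<sigma>: "sign_vector \<sigma>" by (simp add: sign_vector_def \<sigma>_def)
    interpret R: irrational_unimodular_lattice "reflect \<sigma> ` L" by (rule lattice_reflect[OF \<sigma>])
    have box: "R.lattice_box r = reflect \<sigma> ` lattice_box r" for r
      unfolding R.lattice_box_def lattice_box_def
      by (auto simp: abs_mult sign_vector_abs[OF \<sigma>])
    have span: "span (R.lattice_box r) = reflect \<sigma> ` span (lattice_box r)" for r
      unfolding box by (rule linear_span_image[OF linear_reflect])
    have UNIV: "reflect \<sigma> ` S = UNIV \<longleftrightarrow> S = UNIV" for S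
      using reflect_image[OF \<sigma>] bij_is_surj[OF bij_reflect[OF \<sigma>]] by metis
    have dim: "dim (span (R.lattice_box r)) = dim (span (lattice_box r))" for r
      unfolding span by (rule dim_image_eq[OF linear_reflect]) (rule inj_on_subset[OF inj_reflect[OF \<sigma>] subset_UNIV])
    interpret flat: flat_lattice "reflect \<sigma> ` L" t "reflect \<sigma> a" c0 \<kappa> \<epsilon>
    proof
      show "0 < t i" for i by (rule t)
      show "0 < c0" "c0 \<le> 1" "0 < \<kappa>" "0 < \<epsilon>" using c0 \<kappa> \<epsilon>0 by simp_all
      show "CARD('n) * \<epsilon> \<le> c0 / 2" using \<epsilon>n by (simp add: n_def)
      show "span (R.lattice_box t) \<noteq> UNIV" unfolding span UNIV by (rule not_full)
      show "span (R.lattice_box (\<lambda>i. 2 * t i)) = UNIV" unfolding span UNIV by (rule full2)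
      show "dim (span (R.lattice_box (\<lambda>i. c0 * r i))) \<le> dim (span (R.lattice_box (\<lambda>i. \<epsilon> * t i)))"
        if "\<And>i. 0 < r i" "span (R.lattice_box r) \<noteq> UNIV" for r
      proof -
        have "span (lattice_box r) \<noteq> UNIV" using that(2) unfolding span UNIV .
        then have "dim (span (lattice_box (\<lambda>i. c0 * r i))) \<le> Suc m" by (rule drop[OF that(1)])
        also note dimV
        finally show ?thesis unfolding dim V_def .
      qed
      show "\<exists>v\<in>R.lattice_box (\<lambda>i. \<epsilon> * t i). v \<noteq> 0"
      proof (rule ccontr)
        assume "\<not> ?thesis"
        then have "R.lattice_box (\<lambda>i. \<epsilon> * t i) \<subseteq> {0}" by blast
        then have "dim (R.lattice_box (\<lambda>i. \<epsilon> * t i)) = 0" by (simp only: dim_eq_0)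
        then show False using dimV dim[of "\<lambda>i. \<epsilon> * t i"] unfolding V_def dim_span by linarith
      qed
      show "reflect \<sigma> a \<bullet> v = 0" if "v \<in> span (R.lattice_box (\<lambda>i. \<epsilon> * t i))" for v
        using that a(1) unfolding span V_def[symmetric] W_def by (auto simp: inner_reflect reflect_reflect[OF \<sigma>])
      have abs: "reflect \<sigma> a $ i = \<bar>a $ i\<bar>" for i by (simp add: \<sigma>_def)
      then show "0 \<le> reflect \<sigma> a $ i" for i by simp
      show "weighted_l1 t (reflect \<sigma> a) \<le> 1" using a(2) by (simp add: weighted_l1_reflect[OF \<sigma>])
      show "\<kappa> * \<bar>u $ i\<bar> \<le> reflect \<sigma> a $ i * weighted_l1 t u"
        if "\<And>v. v \<in> span (R.lattice_box (\<lambda>i. \<epsilon> * t i)) \<Longrightarrow> u \<bullet> v = 0" for u i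
      proof -
        have "reflect \<sigma> u \<in> W"
          unfolding W_def using that unfolding span V_def[symmetric] by (simp add: inner_reflect)
        from dom[OF this, of i] show ?thesis
          unfolding abs by (simp add: abs_mult sign_vector_abs[OF \<sigma>] weighted_l1_reflect[OF \<sigma>])
      qed
    qed
    have num: "4 * CARD('n) * (((4 * CARD('n) + 1) / \<kappa> + 1) / c0) \<le> c0 * real N"
      using N(2) unfolding X_def n_def by (simp add: add.commute)
    have num2: "8 * CARD('n) * CARD('n) * real N ^ CARD('n) * c \<le> c0 * c0"
      using c(2) unfolding n_def by simp
    obtain F where F: "F facet_of R.K" "\<And>D. facet_det F \<le> ennreal D \<Longrightarrow> real M \<le> max D 0"
      by (rule flat.facet_with_large_det[OF N(1) num \<epsilon>c[unfolded n_def] num2]) (rule that)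
    have "facet_det F \<le> ennreal D" using facets[OF \<sigma>] F(1) unfolding R.K_def by blast
    then show False using F(2) M by fastforce
  qed
  then show ?thesis unfolding rank_drop_def using \<epsilon>0 \<epsilon>1 by blast
qed

lemma rank_drop_all_but_one: "rank_drop (CARD('n) - 1)"
proof -
  have "dim (span (lattice_box s)) \<le> CARD('n) - 1" if "span (lattice_box s) \<noteq> UNIV" for s
  proof -
    have "dim (lattice_box s) \<noteq> DIM(real^'n)" using that dim_eq_full by blast
    then show ?thesis using dim_subset_UNIV[of "lattice_box s"] by simp
  qed
  then show ?thesis unfolding rank_drop_def by (intro exI[of _ 1]) simp
qed

text \<open>The box with half-widths \<open>\<bar>y $ i\<bar> / c\<close> contains y even after
  shrinking by c, so its lattice points must span. A basis among them has determinant at least 1 and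
  at most n! times the product of the half-widths.\<close>

lemma norm_bounded_below_of_rank_drop:
  assumes "rank_drop 0"
  shows "\<exists>c>0. \<forall>x\<in>L. x \<noteq> 0 \<longrightarrow> c \<le> \<bar>\<Prod>i\<in>UNIV. x $ i\<bar>"
proof -
  obtain c where c: "0 < c" and drop: "\<And>s. (\<And>i. 0 < s i) \<Longrightarrow> span (lattice_box s) \<noteq> UNIV \<Longrightarrow>
      dim (span (lattice_box (\<lambda>i. c * s i))) \<le> 0"
    using assms unfolding rank_drop_def by blast
  have "c ^ CARD('n) / fact CARD('n) \<le> \<bar>\<Prod>i\<in>UNIV. y $ i\<bar>" if y: "y \<in> L" "y \<noteq> 0" for y
  proof -
    define s where "s i = \<bar>y $ i\<bar> / c" for i
    have s: "0 < s i" for i using coord_nonzero[OF y] c by (simp add: s_def)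
    have "span (lattice_box s) = UNIV"
    proof (rule ccontr)
      assume "\<not> ?thesis"
      then have "dim (lattice_box (\<lambda>i. c * s i)) = 0" using drop[OF s] by simp
      then have "lattice_box (\<lambda>i. c * s i) \<subseteq> {0}" by (simp add: dim_eq_0)
      moreover have "y \<in> lattice_box (\<lambda>i. c * s i)" using y(1) c by (simp add: lattice_box_def s_def)
      ultimately show False using y(2) by blast
    qed
    moreover obtain B where B: "B \<subseteq> lattice_box s" "independent B" "lattice_box s \<subseteq> span B"
      using maximal_independent_subset by blast
    ultimately have "span B = UNIV" using span_minimal[OF B(3)] by auto
    then obtain g :: "'n \<Rightarrow> real^'n" where g: "bij_betw g UNIV B" "det (\<chi> i. g i) \<noteq> 0" using enum_basis[OF B(2)] by blast
    have "g i \<in> lattice_box s" for i using g(1) B(1) by (auto simp: bij_betw_def)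
    then have gs: "g i \<in> L" "\<bar>g i $ j\<bar> \<le> 1 * s j" for i j by (simp_all add: lattice_box_def)
    have "1 \<le> \<bar>det (\<chi> i. g i)\<bar>" by (rule abs_det_ge_1[OF gs(1) g(2)])
    also have "\<dots> \<le> fact CARD('n) * (\<Prod>i\<in>(UNIV::'n set). 1) * (\<Prod>j\<in>UNIV. s j)"
      by (rule abs_det_le[OF gs(2)]) (simp_all add: s less_imp_le)
    also have "(\<Prod>j\<in>UNIV. s j) = \<bar>\<Prod>i\<in>UNIV. y $ i\<bar> / c ^ CARD('n)"
      by (simp add: s_def prod_dividef abs_prod)
    finally have "1 \<le> fact CARD('n) * (\<bar>\<Prod>i\<in>UNIV. y $ i\<bar> / c ^ CARD('n))" by simp
    then show ?thesis using c by (simp add: field_simps)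
  qed
  moreover have "0 < c ^ CARD('n) / fact CARD('n)" using c by simp
  ultimately show ?thesis by blast
qed

theorem norm_bounded_below_of_facets:
  assumes facets: "\<And>\<sigma> F. sign_vector \<sigma> \<Longrightarrow> F facet_of klein_polyhedron (reflect \<sigma> ` L) positive_orthant \<Longrightarrow> facet_det F \<le> ennreal D"
  shows "\<exists>c>0. \<forall>x\<in>L. x \<noteq> 0 \<longrightarrow> c \<le> \<bar>\<Prod>i\<in>UNIV. x $ i\<bar>"
proof -
  have "rank_drop m \<Longrightarrow> rank_drop 0" for m
  proof (induction m)
    case (Suc m)
    have "rank_drop m" by (rule rank_drop_step[OF _ Suc.prems]) (rule facets)
    then show ?case by (rule Suc.IH)
  qed
  then show ?thesis using rank_drop_all_but_one norm_bounded_below_of_rank_drop by blast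
qed

end

lemma norm_bounded_reflect:
  assumes "irrational_unimodular_lattice L" and \<sigma>: "sign_vector \<sigma>"
    and c: "0 < c" "\<And>x. x \<in> L \<Longrightarrow> x \<noteq> 0 \<Longrightarrow> c \<le> \<bar>\<Prod>i\<in>UNIV. x $ i\<bar>"
  shows "positive_norm_lattice (reflect \<sigma> ` L) c"
proof -
  interpret irrational_unimodular_lattice L by (rule assms(1))
  interpret R: irrational_unimodular_lattice "reflect \<sigma> ` L" by (rule lattice_reflect[OF \<sigma>])
  show ?thesis
  proof
    show "c \<le> \<bar>\<Prod>i\<in>UNIV. y $ i\<bar>" if y: "y \<in> reflect \<sigma> ` L" "y \<noteq> 0" for y
    proof -
      obtain x where x: "x \<in> L" "y = reflect \<sigma> x" using y(1) by blast
      then have "x \<noteq> 0" using y(2) linear_0[OF linear_reflect] by metis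
      then show ?thesis using c(2)[OF x(1)] unfolding x(2) abs_prod_reflect[OF \<sigma>] by blast
    qed
  qed (rule c(1))
qed

theorem theorem1:
  fixes \<Lambda> :: "(real^'n::finite) set"
  assumes "CARD('n) \<ge> 2"
    and "full_lattice \<Lambda>"
    and "lattice_det \<Lambda> = 1"
    and "irrational_lattice \<Lambda>"
  shows "(norm_min \<Lambda> > 0 \<longleftrightarrow>
            (\<exists>D::real. \<forall>\<O>\<in>orthants. \<forall>F. F facet_of klein_polyhedron \<Lambda> \<O> \<longrightarrow>
               facet_det F \<le> ennreal D))
       \<and> (norm_min \<Lambda> > 0 \<longleftrightarrow>
            (\<exists>D::real.
               (\<forall>F. F facet_of klein_polyhedron \<Lambda> positive_orthant \<longrightarrow>
                  facet_det F \<le> ennreal D) \<and>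
               (\<forall>v\<in>vertices (klein_polyhedron \<Lambda> positive_orthant).
                  star_det \<Lambda> (klein_polyhedron \<Lambda> positive_orthant) v \<le> ennreal D)))"
proof (intro conjI iffI)
  interpret irrational_unimodular_lattice \<Lambda> using assms by unfold_locales
  have orthants: "orthants = orthant ` {\<sigma>. sign_vector \<sigma>}" by (simp add: orthants_def sign_vector_def)
  {
    assume "norm_min \<Lambda> > 0"
    then obtain c where c: "0 < c" "\<And>x. x \<in> \<Lambda> \<Longrightarrow> x \<noteq> 0 \<Longrightarrow> c \<le> \<bar>\<Prod>i\<in>UNIV. x $ i\<bar>"
      unfolding norm_min_pos_iff by blast
    have "\<exists>D. \<forall>F. F facet_of klein_polyhedron \<Lambda> (orthant \<sigma>) \<longrightarrow> facet_det F \<le> ennreal D"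
      if \<sigma>: "sign_vector \<sigma>" for \<sigma>
    proof -
      interpret R: positive_norm_lattice "reflect \<sigma> ` \<Lambda>" c
        by (rule norm_bounded_reflect[OF irrational_unimodular_lattice_axioms \<sigma> c])
      show ?thesis using R.facets_bounded unfolding R.K_def facets_bounded_orthant_iff[OF \<sigma>] .
    qed
    then obtain D where D: "\<And>\<sigma> F. sign_vector \<sigma> \<Longrightarrow> F facet_of klein_polyhedron \<Lambda> (orthant \<sigma>) \<Longrightarrow>
        facet_det F \<le> ennreal (D \<sigma>)" by metis
    \<comment> \<open>There are finitely many orthants, so the separate bounds have a
      maximum.\<close>
    define D' where "D' = Max (D ` {\<sigma>. sign_vector \<sigma>})"
    have "facet_det F \<le> ennreal D'" if \<sigma>: "sign_vector \<sigma>" and F: "F facet_of klein_polyhedron \<Lambda> (orthant \<sigma>)" for \<sigma> F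
    proof -
      have "D \<sigma> \<le> D'" unfolding D'_def by (rule Max_ge) (use finite_sign_vectors \<sigma> in auto)
      then show ?thesis using D[OF \<sigma> F] by (meson ennreal_leI order_trans)
    qed
    then show "\<exists>D::real. \<forall>\<O>\<in>orthants. \<forall>F. F facet_of klein_polyhedron \<Lambda> \<O> \<longrightarrow> facet_det F \<le> ennreal D"
      unfolding orthants by blast
    interpret P: positive_norm_lattice \<Lambda> c using c by unfold_locales
    obtain D1 where D1: "\<And>F. F facet_of K \<Longrightarrow> facet_det F \<le> ennreal D1" using P.facets_bounded by blast
    obtain D2 where D2: "\<And>v. {v} face_of K \<Longrightarrow> star_det \<Lambda> K v \<le> ennreal D2" using P.stars_bounded by blast
    have "ennreal D1 \<le> ennreal (max D1 D2)" "ennreal D2 \<le> ennreal (max D1 D2)" by (simp_all add: ennreal_leI)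
    then have "(\<forall>F. F facet_of K \<longrightarrow> facet_det F \<le> ennreal (max D1 D2)) \<and>
        (\<forall>v\<in>vertices K. star_det \<Lambda> K v \<le> ennreal (max D1 D2))"
      using D1 D2 unfolding vertices_def by (meson mem_Collect_eq order_trans)
    then show "\<exists>D::real. (\<forall>F. F facet_of klein_polyhedron \<Lambda> positive_orthant \<longrightarrow> facet_det F \<le> ennreal D) \<and>
        (\<forall>v\<in>vertices (klein_polyhedron \<Lambda> positive_orthant).
          star_det \<Lambda> (klein_polyhedron \<Lambda> positive_orthant) v \<le> ennreal D)"
      unfolding K_def by blast
  next
    assume "\<exists>D::real. \<forall>\<O>\<in>orthants. \<forall>F. F facet_of klein_polyhedron \<Lambda> \<O> \<longrightarrow> facet_det F \<le> ennreal D"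
    then obtain D where D: "\<And>\<sigma>. sign_vector \<sigma> \<Longrightarrow>
        \<forall>F. F facet_of klein_polyhedron \<Lambda> (orthant \<sigma>) \<longrightarrow> facet_det F \<le> ennreal D"
      unfolding orthants by blast
    have "facet_det F \<le> ennreal D"
      if "sign_vector \<sigma>" "F facet_of klein_polyhedron (reflect \<sigma> ` \<Lambda>) positive_orthant" for \<sigma> F
      using D[OF that(1)] that(2) unfolding facets_bounded_orthant_iff[OF that(1)] by blast
    then show "norm_min \<Lambda> > 0" unfolding norm_min_pos_iff by (rule norm_bounded_below_of_facets)
  next
    assume "\<exists>D::real. (\<forall>F. F facet_of klein_polyhedron \<Lambda> positive_orthant \<longrightarrow> facet_det F \<le> ennreal D) \<and>
        (\<forall>v\<in>vertices (klein_polyhedron \<Lambda> positive_orthant).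
          star_det \<Lambda> (klein_polyhedron \<Lambda> positive_orthant) v \<le> ennreal D)"
    then obtain D where "\<And>F. F facet_of K \<Longrightarrow> facet_det F \<le> ennreal D"
      "\<And>v. {v} face_of K \<Longrightarrow> star_det \<Lambda> K v \<le> ennreal D"
      unfolding K_def vertices_def by blast
    then show "norm_min \<Lambda> > 0" unfolding norm_min_pos_iff by (rule norm_bounded_below_of_facets_and_stars)
  }
qed

end
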